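(* Let $\mathbb{T}_0=(t^0_{k,n})$ and $\mathbb{T}_1=(t^1_{k,n})$ be matrices of transformation, and let $\{n_a^0:a\in\mathbb{N}\}$ and $\{n_a^1:a\in\mathbb{N}\}$ be subsequences of the natural numbers. Let $\mathcal{T}_{n_a^0}^{\mathbb{T}_0}$ and $\mathcal{T}_{n_a^1}^{\mathbb{T}_1}$ be the corresponding sequences of operators on $L_1(\mathbb{I})$. Assume that for each $i\in\{0,1\}$ one of the following conditions is satisfied: (i) $\sup_{a\in\mathbb{N}}\|\mathcal{T}_{n_a^i}^{\mathbb{T}_i}\|_{H_1(\mathbb{I})\to L_1(\mathbb{I})}<\infty$; (ii) $\sup_{a\in\mathbb{N}}\|\mathcal{T}_{n_a^i}^{\mathbb{T}_i}\|_{L_\infty(\mathbb{I})\to L_\infty(\mathbb{I})}<\infty$; (iii) $\sup_{a\in\mathbb{N}}\upsilon(n_a^i,\mathbb{T}_i)<\infty$. If $$\mathfrak{T}^{\mathbb{T}_0,\mathbb{T}_1}f:=\sup_{(a,b)\in\mathbb{N}^2}\left|(\mathcal{T}_{n_a^0}^{\mathbb{T}_0}\otimes\mathcal{T}_{n_b^1}^{\mathbb{T}_1})f\right|,$$ then $$\left\|\mathfrak{T}^{\mathbb{T}_0,\mathbb{T}_1}f\right\|_{L_{1,\infty}(\mathbb{I}^2)}\lesssim 1+\int_{\mathbb{I}^2}|f|\ln^+|f|\qquad (f\in L\ln L(\mathbb{I}^2)),$$ where $a\lesssim b$ means $a<c\cdot b$ with $c>0$ an absolute constant.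
   Context: Notation: $\mathbb{I}=[0,1)$, $\mathbb{N}=\{0,1,2,\dots\}$, $\mu$ is Lebesgue measure on $\mathbb{I}$ and $\boldsymbol{\mu}=\mu\otimes\mu$ on $\mathbb{I}^2$. Walsh–Paley system: for $x\in\mathbb{I}$ write $x=\sum_{n\ge0}x_n2^{-(n+1)}$, $x_n\in\{0,1\}$ (for dyadic rationals take the expansion terminating in $0$'s). For $n\in\mathbb{N}$ write $n=\sum_{k\ge0}\varepsilon_k(n)2^k$, $\varepsilon_k(n)\in\{0,1\}$, and for $n\ge1$ let $|n|$ be the integer with $2^{|n|}\le n<2^{|n|+1}$. Put $w_n(x):=(-1)^{\sum_k\varepsilon_k(n)x_k}$. The dyadic (logical) sum is $x\dotplus y:=\sum_{n\ge0}|x_n-y_n|2^{-(n+1)}$. The Walsh–Dirichlet kernels are $D_0=0$, $D_n=\sum_{k=0}^{n-1}w_k$. For $f\in L_1(\mathbb{I})$, $\widehat f(i)=\int_{\mathbb{I}}fw_i\,d\mu$ and $S_m(f)=\sum_{i=0}^{m-1}\widehat f(i)w_i$ (so $S_0(f)=0$). Dyadic Hardy space: $E^*(f):=\sup_{n\in\mathbb{N}}|S_{2^n}(f)|$ and $H_1(\mathbb{I})=\{f\in L_1(\mathbb{I}):\|f\|_{H_1}:=\|E^*(f)\|_1<\infty\}$. Matrix of transformation: an infinite matrix $\mathbb{T}=(t_{k,n})_{k,n\in\mathbb{N}}$ of reals with $t_{k,n}\ge0$, $t_{k+1,n}\le t_{k,n}$ for all $k,n\in\mathbb{N}$, and $\sum_{k=0}^nt_{k,n}=1$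 for all $n$. Operators: $\mathcal{T}_n^{\mathbb{T}}(f):=\sum_{k=0}^nt_{n-k,n}S_k(f)$ for $f\in L_1(\mathbb{I})$; equivalently $\mathcal{T}_n^{\mathbb{T}}f(x)=\int_{\mathbb{I}}f(t)V_n^{\mathbb{T}}(x\dotplus t)\,d\mu(t)$ with kernel $V_n^{\mathbb{T}}:=\sum_{k=1}^nt_{n-k,n}D_k$. For $f\in L_1(\mathbb{I}^2)$ the tensor product is $$(\mathcal{T}_{n}^{\mathbb{T}_0}\otimes\mathcal{T}_{m}^{\mathbb{T}_1})f(x^0,x^1)=\int_{\mathbb{I}^2}f(u^0,u^1)V_n^{\mathbb{T}_0}(x^0\dotplus u^0)V_m^{\mathbb{T}_1}(x^1\dotplus u^1)\,d\boldsymbol{\mu}(u^0,u^1).$$ Variation: $\tau_{s,n}:=\sum_{l=0}^st_{l,n}$ and $\upsilon(n,\mathbb{T}):=\sum_{k=0}^{|n|}|\varepsilon_k(n)-\varepsilon_{k+1}(n)|\,\tau_{2^k,n}$ for $n\ge1$, with $\upsilon(0,\mathbb{T}):=0$. Function spaces: $\ln^+(x)=\mathbf{1}_{\{x>1\}}\ln x$; $L\ln L(\mathbb{I}^2)$ is the set of $f\in L_1(\mathbb{I}^2)$ with $\int_{\mathbb{I}^2}|f|\ln^+|f|\,d\boldsymbol{\mu}<\infty$; $\|g\|_{L_{1,\infty}(\mathbb{I}^2)}:=\sup_{\lambda>0}\lambda\,\boldsymbol{\mu}(\{|g|>\lambda\})$.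
   Formalization: The constant c is independent of f but may depend on the matrices T_0, T_1 and on the sequences n_a^0, n_a^1; a constant independent of these as well ("absolute") is impossible, as partial sums S_n with all n below 2^N in both sequences show when N grows. *)

theory Defs
  imports "HOL-Probability.Essential_Supremum" "HOL-Library.Discrete_Functions"
begin

section \<open>The dyadic unit interval and the Walsh--Paley system\<close>

abbreviation unit_ivl :: "real set" where
  "unit_ivl \<equiv> {0..<1}"

text \<open>Functions are representatives of classes modulo a.e. equality; as every Lebesgue measurable
  function has a Borel representative, the Borel \<open>\<sigma>\<close>-algebra is used throughout.\<close>

definition mu :: "real measure" where
  "mu = restrict_space lborel unit_ivl"

definition mu2 :: "(real \<times> real) measure" where
  "mu2 = mu \<Otimes>\<^sub>M mu"

text \<open>Taking the floor selects, for dyadic rationals, the expansion that terminates in zeros.\<close>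

definition dyadic_digit :: "nat \<Rightarrow> real \<Rightarrow> nat" where
  "dyadic_digit n x = nat (\<lfloor>2 ^ (n + 1) * x\<rfloor> mod 2)"

definition bin_coeff :: "nat \<Rightarrow> nat \<Rightarrow> nat" where
  "bin_coeff k n = (n div 2 ^ k) mod 2"

text \<open>The sum may stop at \<open>n\<close>, since \<open>bin_coeff k n = 0\<close> for \<open>k > n\<close>.\<close>

definition walsh :: "nat \<Rightarrow> real \<Rightarrow> real" where
  "walsh n x = (- 1) ^ (\<Sum>k\<le>n. bin_coeff k n * dyadic_digit k x)"

definition dyadic_add :: "real \<Rightarrow> real \<Rightarrow> real"  (infixl \<open>\<dotplus>\<close> 65) where
  "x \<dotplus> y = (\<Sum>n. \<bar>real (dyadic_digit n x) - real (dyadic_digit n y)\<bar> / 2 ^ (n + 1))"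

definition walsh_dirichlet :: "nat \<Rightarrow> real \<Rightarrow> real" where
  "walsh_dirichlet n x = (\<Sum>k<n. walsh k x)"

definition walsh_coeff :: "(real \<Rightarrow> real) \<Rightarrow> nat \<Rightarrow> real" where
  "walsh_coeff f i = (LINT x|mu. f x * walsh i x)"

definition walsh_partial_sum :: "nat \<Rightarrow> (real \<Rightarrow> real) \<Rightarrow> real \<Rightarrow> real" where
  "walsh_partial_sum m f x = (\<Sum>i<m. walsh_coeff f i * walsh i x)"

section \<open>Function spaces\<close>

definition L1_norm :: "(real \<Rightarrow> real) \<Rightarrow> ennreal" where
  "L1_norm f = (\<integral>\<^sup>+ x. ennreal \<bar>f x\<bar> \<partial>mu)"

definition dyadic_maximal :: "(real \<Rightarrow> real) \<Rightarrow> real \<Rightarrow> ennreal" where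
  "dyadic_maximal f x = (SUP n. ennreal \<bar>walsh_partial_sum (2 ^ n) f x\<bar>)"

definition H1_norm :: "(real \<Rightarrow> real) \<Rightarrow> ennreal" where
  "H1_norm f = (\<integral>\<^sup>+ x. dyadic_maximal f x \<partial>mu)"

definition H1_space :: "(real \<Rightarrow> real) set" where
  "H1_space = {f. integrable mu f \<and> H1_norm f < \<infinity>}"

definition Linf_norm :: "(real \<Rightarrow> real) \<Rightarrow> ennreal" where
  "Linf_norm f = esssup mu (\<lambda>x. ennreal \<bar>f x\<bar>)"

definition Linf_space :: "(real \<Rightarrow> real) set" where
  "Linf_space = {f \<in> borel_measurable mu. Linf_norm f < \<infinity>}"

definition operator_norm ::
    "(real \<Rightarrow> real) set \<Rightarrow> ((real \<Rightarrow> real) \<Rightarrow> ennreal) \<Rightarrow> ((real \<Rightarrow> real) \<Rightarrow> ennreal)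
     \<Rightarrow> ((real \<Rightarrow> real) \<Rightarrow> (real \<Rightarrow> real)) \<Rightarrow> ennreal" where
  "operator_norm X normX normY A = (SUP f \<in> {f \<in> X. normX f \<le> 1}. normY (A f))"

definition ln_plus :: "real \<Rightarrow> real" where
  "ln_plus x = (if x > 1 then ln x else 0)"

definition LlnL_integral :: "(real \<times> real \<Rightarrow> real) \<Rightarrow> ennreal" where
  "LlnL_integral f = (\<integral>\<^sup>+ z. ennreal (\<bar>f z\<bar> * ln_plus \<bar>f z\<bar>) \<partial>mu2)"

definition LlnL_space :: "(real \<times> real \<Rightarrow> real) set" where
  "LlnL_space = {f. integrable mu2 f \<and> LlnL_integral f < \<infinity>}"

text \<open>The quasi-norm of \<open>L\<^sub>1\<^sub>,\<^sub>\<infinity>\<close>, for functions that are already nonnegative and possibly infinite,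
  such as maximal functions.\<close>

definition weak_L1_norm :: "(real \<times> real \<Rightarrow> ennreal) \<Rightarrow> ennreal" where
  "weak_L1_norm g = (SUP y \<in> {0<..}. ennreal y * emeasure mu2 {z \<in> space mu2. g z > ennreal y})"

section \<open>Matrix transforms\<close>

text \<open>A matrix is a function \<open>t\<close> with \<open>t k n\<close> standing for \<open>t\<^sub>k\<^sub>,\<^sub>n\<close>.\<close>

definition transformation_matrix :: "(nat \<Rightarrow> nat \<Rightarrow> real) \<Rightarrow> bool" where
  "transformation_matrix t \<longleftrightarrow>
     (\<forall>k n. t k n \<ge> 0) \<and> (\<forall>k n. t (k + 1) n \<le> t k n) \<and> (\<forall>n. (\<Sum>k\<le>n. t k n) = 1)"

definition matrix_transform :: "(nat \<Rightarrow> nat \<Rightarrow> real) \<Rightarrow> nat \<Rightarrow> (real \<Rightarrow> real) \<Rightarrow> real \<Rightarrow> real" where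
  "matrix_transform t n f x = (\<Sum>k\<le>n. t (n - k) n * walsh_partial_sum k f x)"

definition matrix_kernel :: "(nat \<Rightarrow> nat \<Rightarrow> real) \<Rightarrow> nat \<Rightarrow> real \<Rightarrow> real" where
  "matrix_kernel t n x = (\<Sum>k=1..n. t (n - k) n * walsh_dirichlet k x)"

definition tensor_transform ::
    "(nat \<Rightarrow> nat \<Rightarrow> real) \<Rightarrow> nat \<Rightarrow> (nat \<Rightarrow> nat \<Rightarrow> real) \<Rightarrow> nat
     \<Rightarrow> (real \<times> real \<Rightarrow> real) \<Rightarrow> real \<times> real \<Rightarrow> real" where
  "tensor_transform s n t m f = (\<lambda>(x0, x1).
     LINT (u0, u1)|mu2. f (u0, u1) * matrix_kernel s n (x0 \<dotplus> u0) * matrix_kernel t m (x1 \<dotplus> u1))"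

definition tensor_maximal ::
    "(nat \<Rightarrow> nat \<Rightarrow> real) \<Rightarrow> (nat \<Rightarrow> nat) \<Rightarrow> (nat \<Rightarrow> nat \<Rightarrow> real) \<Rightarrow> (nat \<Rightarrow> nat)
     \<Rightarrow> (real \<times> real \<Rightarrow> real) \<Rightarrow> real \<times> real \<Rightarrow> ennreal" where
  "tensor_maximal s p t q f z = (SUP (a, b). ennreal \<bar>tensor_transform s (p a) t (q b) f z\<bar>)"

definition tau :: "(nat \<Rightarrow> nat \<Rightarrow> real) \<Rightarrow> nat \<Rightarrow> nat \<Rightarrow> real" where
  "tau t s n = (\<Sum>l\<le>s. t l n)"

definition upsilon :: "nat \<Rightarrow> (nat \<Rightarrow> nat \<Rightarrow> real) \<Rightarrow> real" where
  "upsilon n t = (if n = 0 then 0 else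
     (\<Sum>k\<le>floor_log n. \<bar>real (bin_coeff k n) - real (bin_coeff (k + 1) n)\<bar> * tau t (2 ^ k) n))"

end

theory Submission
  imports Defs "HOL-Probability.Probability_Measure"
begin

text \<open>Reflecting Dirichlet kernels inside each dyadic block of frequencies, \<open>D\<^bsub>2^s - j\<^esub> = D\<^bsub>2^s\<^esub> -
  w\<^bsub>2^s - 1\<^esub> D\<^sub>j\<close>, splits the kernel \<open>V\<^sub>n\<close> into \<open>w\<^sub>n \<Sum>\<^sub>k c\<^sub>k (D\<^bsub>2^(k+1)\<^esub> - D\<^bsub>2^k\<^esub>)\<close>, where \<open>c\<^sub>k\<close> is
  \<open>\<epsilon>\<^sub>k(n)\<close> times the sum of the first \<open>n mod 2\<^sup>k\<^sup>+\<^sup>1\<close> weights, and a remainder which, by monotonicity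
  of the weights, is a combination of Fejer kernels with bounded total coefficient. Hence \<open>|V\<^sub>n|\<close> is
  controlled by \<open>1 + \<Sum>\<^sub>k |c\<^sub>k - c\<^sub>k\<^sub>+\<^sub>1|\<close>, a quantity bounded by \<open>1 + \<upsilon>(n)\<close> and also, since the \<open>L\<^sub>1\<close> norm of
  the first part dominates it, by \<open>1 + \<parallel>V\<^sub>n\<parallel>\<^sub>1\<close>. The operator norms in (i) and (ii) are bounded below by
  \<open>\<parallel>V\<^sub>n\<parallel>\<^sub>1 - 5\<close>, by testing on \<open>D\<^bsub>2^(N+1)\<^esub> - D\<^bsub>2^N\<^esub>\<close> with \<open>N = |n|\<close> and on \<open>sgn V\<^sub>n\<close>.

  Convolution with \<open>|V\<^sub>n|\<close> is thus dominated, uniformly in \<open>n\<close>, by a maximal operator with explicit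
  positive kernels. A stopping time argument shows that it has weak type (1,1); as it is also bounded
  on \<open>L\<^sub>\<infinity>\<close>, it maps \<open>L ln L\<close> to \<open>L\<^sub>1\<close>. Applying it in one variable after the other gives the theorem.\<close>

text \<open>Why positive kernels: once absolute values stand inside the integral, the supremum over
  pairs of indices splits into two successive one-variable suprema, and no cancellation between the
  variables has to be tracked. Only the inner variable pays for a logarithm; the outer one needs
  nothing beyond the weak type inequality.

  Why \<open>w_n\<close> is factored out: it has modulus one, and what is left of the main part
  becomes, after summation by parts, a combination of the nonnegative kernels of order
  \<open>2^k\<close> whose coefficients are the jumps of the \<open>c_k\<close>.

  The obstacle is the Fejer kernel of order \<open>2^s\<close>. Around \<open>x\<close> it is not
  concentrated on one dyadic interval: for every \<open>i < s\<close> it also charges the interval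
  obtained by flipping digit \<open>i\<close>, with weight \<open>2^i / 2^s\<close>. Each of these
  contributions is controlled by a dyadic average at \<open>x\<close>, but their sum over
  \<open>i\<close> is not controlled uniformly in \<open>s\<close>, so the dyadic maximal function
  gives no pointwise bound. The stopping time repairs this: the mass that escapes the averages is
  summed over all \<open>s\<close> and integrated in \<open>x\<close> before it is
  estimated.\<close>

definition rad :: "nat \<Rightarrow> real \<Rightarrow> real" where
  "rad k x = (- 1) ^ dyadic_digit k x"

lemma dyadic_digit_less_2: "dyadic_digit k x < 2"
  unfolding dyadic_digit_def by (simp add: nat_less_iff)

lemma rad_cases: "rad k x = 1 \<or> rad k x = - 1"
  unfolding rad_def by (metis neg_one_even_power neg_one_odd_power)

lemma rad_square [simp]: "rad k x * rad k x = 1"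
  using rad_cases[of k x] by auto

lemma abs_rad [simp]: "\<bar>rad k x\<bar> = 1"
  using rad_cases[of k x] by auto

lemma bin_coeff_less_2: "bin_coeff k n < 2"
  unfolding bin_coeff_def by simp

lemma bin_coeff_eq_0: "n < 2 ^ k \<Longrightarrow> bin_coeff k n = 0"
  unfolding bin_coeff_def by simp

lemma bin_coeff_add_power:
  assumes "j < 2 ^ s"
  shows "bin_coeff l (2 ^ s + j) = (if l = s then 1 else bin_coeff l j)"
proof (cases "l < s")
  case True
  then have "(2::nat) ^ s = 2 ^ l * 2 ^ (s - l)"
    by (simp flip: power_add)
  then have "(2 ^ s + j) div 2 ^ l = 2 ^ (s - l) + j div 2 ^ l"
    by simp
  moreover have "even ((2::nat) ^ (s - l))" using True by simp
  ultimately show ?thesis using True unfolding bin_coeff_def by (simp add: mod2_eq_if)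
next
  case False
  show ?thesis
  proof (cases "l = s")
    case True
    then show ?thesis using assms unfolding bin_coeff_def by simp
  next
    case ls: False
    with False have "s < l" by simp
    then have "2 ^ s + 2 ^ s \<le> (2::nat) ^ l"
      by (metis Suc_leI mult_2 power_Suc power_increasing one_le_numeral)
    then have "2 ^ s + j < 2 ^ l" "j < 2 ^ l" using assms by linarith+
    then show ?thesis using ls by (simp add: bin_coeff_eq_0)
  qed
qed

section \<open>Walsh functions as products of Rademacher functions\<close>

lemma walsh_eq_prod_rad:
  assumes "n < 2 ^ K"
  shows "walsh n x = (\<Prod>l<K. rad l x ^ bin_coeff l n)"
proof -
  have "walsh n x = (\<Prod>l\<le>n. rad l x ^ bin_coeff l n)"
    unfolding walsh_def rad_def
    by (simp add: power_sum power_mult mult.commute[of "bin_coeff _ _"])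
  also have "\<dots> = (\<Prod>l<K + Suc n. rad l x ^ bin_coeff l n)"
  proof (rule prod.mono_neutral_left)
    show "\<forall>l\<in>{..<K + Suc n} - {..n}. rad l x ^ bin_coeff l n = 1"
    proof
      fix l assume "l \<in> {..<K + Suc n} - {..n}"
      then have "n < l" by simp
      then have "n < 2 ^ l" using less_exp[of l] by (meson less_trans)
      then show "rad l x ^ bin_coeff l n = 1" by (simp add: bin_coeff_eq_0)
    qed
  qed auto
  also have "\<dots> = (\<Prod>l<K. rad l x ^ bin_coeff l n)"
  proof (rule prod.mono_neutral_right)
    show "\<forall>l\<in>{..<K + Suc n} - {..<K}. rad l x ^ bin_coeff l n = 1"
    proof
      fix l assume "l \<in> {..<K + Suc n} - {..<K}"
      then have "K \<le> l" by simp
      then have "n < 2 ^ l" using assms by (meson less_le_trans one_le_numeral power_increasing)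
      then show "rad l x ^ bin_coeff l n = 1" by (simp add: bin_coeff_eq_0)
    qed
  qed auto
  finally show ?thesis .
qed

lemma abs_walsh [simp]: "\<bar>walsh n x\<bar> = 1"
  unfolding walsh_def by (simp add: power_abs)

lemma walsh_square [simp]: "walsh n x * walsh n x = 1"
  by (metis abs_mult_self_eq abs_walsh mult_1)

lemma walsh_0 [simp]: "walsh 0 x = 1"
  unfolding walsh_def bin_coeff_def by simp

lemma walsh_add_power:
  assumes "j < 2 ^ s"
  shows "walsh (2 ^ s + j) x = rad s x * walsh j x"
proof -
  have j: "2 ^ s + j < 2 ^ Suc s" "j < 2 ^ Suc s" using assms by simp_all
  show ?thesis
    unfolding walsh_eq_prod_rad[OF j(1)] walsh_eq_prod_rad[OF assms]
    by (simp add: bin_coeff_add_power[OF assms])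
qed

text \<open>Subtracting from \<open>2^s - 1\<close> complements all \<open>s\<close> binary digits,
  and since \<open>rad l x\<close> squares to 1, complementing a digit is multiplication by that
  Rademacher function.\<close>

lemma walsh_reflect:
  assumes "i < 2 ^ s"
  shows "walsh (2 ^ s - 1 - i) x = walsh (2 ^ s - 1) x * walsh i x"
  using assms
proof (induction s arbitrary: i)
  case 0
  then show ?case by simp
next
  case (Suc s)
  have "walsh (2 ^ Suc s - 1) x = walsh (2 ^ s + (2 ^ s - 1)) x"
    by (simp add: mult_2)
  then have top: "walsh (2 ^ Suc s - 1) x = rad s x * walsh (2 ^ s - 1) x"
    using walsh_add_power[of "2 ^ s - 1" s x] by simp
  show ?case
  proof (cases "i < 2 ^ s")
    case True
    have "2 ^ Suc s - 1 - i = 2 ^ s + (2 ^ s - 1 - i)" using True by simp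
    then have "walsh (2 ^ Suc s - 1 - i) x = rad s x * walsh (2 ^ s - 1 - i) x"
      using walsh_add_power[of "2 ^ s - 1 - i" s x] by simp
    then show ?thesis using Suc.IH[OF True] top by simp
  next
    case False
    define j where "j = i - 2 ^ s"
    have i: "i = 2 ^ s + j" and j: "j < 2 ^ s" using False Suc.prems unfolding j_def by auto
    have e: "2 ^ Suc s - 1 - i = 2 ^ s - 1 - j" unfolding i by simp
    have r: "rad s x * (rad s x * y) = y" for y
      by (metis mult.assoc mult_1 rad_square)
    have "walsh (2 ^ Suc s - 1) x * walsh i x
        = rad s x * (rad s x * (walsh (2 ^ s - 1) x * walsh j x))"
      unfolding top i walsh_add_power[OF j] by (simp add: ac_simps)
    then show ?thesis unfolding e Suc.IH[OF j] r by simp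
  qed
qed

section \<open>Dirichlet kernels: dyadic order, translation and reflection\<close>

lemma walsh_dirichlet_0 [simp]: "walsh_dirichlet 0 x = 0"
  unfolding walsh_dirichlet_def by simp

lemma walsh_dirichlet_Suc: "walsh_dirichlet (Suc n) x = walsh_dirichlet n x + walsh n x"
  unfolding walsh_dirichlet_def by simp

lemma walsh_dirichlet_add_power:
  assumes "j \<le> 2 ^ s"
  shows "walsh_dirichlet (2 ^ s + j) x = walsh_dirichlet (2 ^ s) x + rad s x * walsh_dirichlet j x"
  using assms
proof (induction j)
  case (Suc j)
  then show ?case
    using walsh_add_power[of j s x] by (simp add: walsh_dirichlet_Suc algebra_simps)
qed simp

lemma walsh_dirichlet_power_Suc:
  "walsh_dirichlet (2 ^ Suc s) x = (1 + rad s x) * walsh_dirichlet (2 ^ s) x"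
  using walsh_dirichlet_add_power[of "2 ^ s" s x] by (simp add: mult_2 algebra_simps)

lemma walsh_dirichlet_power: "walsh_dirichlet (2 ^ s) x = (\<Prod>l<s. 1 + rad l x)"
proof (induction s)
  case 0
  then show ?case by (simp add: walsh_dirichlet_def)
next
  case (Suc s)
  then show ?case
    unfolding walsh_dirichlet_power_Suc by simp
qed

lemma one_plus_rad_nonneg: "0 \<le> 1 + rad l x"
  using rad_cases[of l x] by auto

lemma walsh_dirichlet_power_nonneg: "0 \<le> walsh_dirichlet (2 ^ s) x"
  unfolding walsh_dirichlet_power by (intro prod_nonneg) (simp add: one_plus_rad_nonneg)

lemma walsh_dirichlet_power_cases:
  "(\<forall>l<s. rad l x = 1) \<and> walsh_dirichlet (2 ^ s) x = 2 ^ s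
    \<or> (\<exists>l<s. rad l x = - 1) \<and> walsh_dirichlet (2 ^ s) x = 0"
proof (cases "\<forall>l<s. rad l x = 1")
  case True
  then show ?thesis unfolding walsh_dirichlet_power by simp
next
  case False
  then obtain l where "l < s" "rad l x = - 1" using rad_cases by metis
  moreover from this have "(\<Prod>l<s. 1 + rad l x) = 0" by (intro prod_zero bexI[of _ l]) auto
  ultimately show ?thesis unfolding walsh_dirichlet_power by auto
qed

lemma walsh_eq_1:
  assumes "\<forall>l<s. rad l x = 1" "j < 2 ^ s"
  shows "walsh j x = 1"
  unfolding walsh_eq_prod_rad[OF assms(2)] using assms(1) by simp

text \<open>The kernel of order \<open>2^s\<close> is supported where the first \<open>s\<close>
  Rademacher functions equal 1, and there every \<open>walsh j\<close> with \<open>j < 2^s\<close>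
  is 1.\<close>

lemma walsh_mult_dirichlet_power:
  "j < 2 ^ s \<Longrightarrow> walsh j x * walsh_dirichlet (2 ^ s) x = walsh_dirichlet (2 ^ s) x"
  using walsh_dirichlet_power_cases[of s x] walsh_eq_1[of s x j] by auto

lemma walsh_dirichlet_reflect:
  assumes "j \<le> 2 ^ s"
  shows "walsh_dirichlet (2 ^ s - j) x
       = walsh_dirichlet (2 ^ s) x - walsh (2 ^ s - 1) x * walsh_dirichlet j x"
  using assms
proof (induction j)
  case (Suc j)
  then have "2 ^ s - j = Suc (2 ^ s - Suc j)" and e: "2 ^ s - 1 - j = 2 ^ s - Suc j" by simp_all
  then have "walsh_dirichlet (2 ^ s - j) x
      = walsh_dirichlet (2 ^ s - Suc j) x + walsh (2 ^ s - 1 - j) x"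
    by (simp add: walsh_dirichlet_Suc)
  then show ?case
    using Suc walsh_reflect[of j s x] by (simp add: walsh_dirichlet_Suc algebra_simps)
qed simp

lemma walsh_dirichlet_power_diff:
  "rad s x * walsh_dirichlet (2 ^ s) x = walsh_dirichlet (2 ^ Suc s) x - walsh_dirichlet (2 ^ s) x"
  unfolding walsh_dirichlet_power_Suc by (simp add: algebra_simps)

section \<open>Fejer sums\<close>

definition fejer_sum :: "nat \<Rightarrow> real \<Rightarrow> real" where
  "fejer_sum m x = (\<Sum>k<m. walsh_dirichlet k x)"

lemma fejer_sum_0 [simp]: "fejer_sum 0 x = 0"
  unfolding fejer_sum_def by simp

lemma fejer_sum_Suc: "fejer_sum (Suc m) x = fejer_sum m x + walsh_dirichlet m x"
  unfolding fejer_sum_def by simp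

lemma fejer_sum_add_power:
  assumes "m \<le> 2 ^ s"
  shows "fejer_sum (2 ^ s + m) x
       = fejer_sum (2 ^ s) x + m * walsh_dirichlet (2 ^ s) x + rad s x * fejer_sum m x"
  using assms
proof (induction m)
  case (Suc m)
  then show ?case
    using walsh_dirichlet_add_power[of m s x] by (simp add: fejer_sum_Suc algebra_simps)
qed simp

text \<open>Passing from \<open>s\<close> to \<open>s + 1\<close> multiplies by
  \<open>1 + rad s x\<close> and adds \<open>2^s\<close> times the Dirichlet kernel of order
  \<open>2^s\<close>. The summand born at step \<open>i\<close> thus misses exactly the factor with
  index \<open>i\<close>. Positivity and the later ridge kernels come from this formula.\<close>

lemma fejer_sum_power:
  "fejer_sum (2 ^ s) x = (\<Sum>i<s. 2 ^ i * (\<Prod>l\<in>{..<s} - {i}. 1 + rad l x))"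
proof (induction s)
  case 0
  then show ?case by (simp add: fejer_sum_def)
next
  case (Suc s)
  have p: "(\<Prod>l\<in>{..<Suc s} - {i}. 1 + rad l x) = (1 + rad s x) * (\<Prod>l\<in>{..<s} - {i}. 1 + rad l x)"
    if "i < s" for i
  proof -
    have "{..<Suc s} - {i} = insert s ({..<s} - {i})" using that by auto
    then show ?thesis by simp
  qed
  have q: "{..<Suc s} - {s} = {..<s}" by auto
  have "fejer_sum (2 ^ Suc s) x = (1 + rad s x) * fejer_sum (2 ^ s) x + 2 ^ s * walsh_dirichlet (2 ^ s) x"
    using fejer_sum_add_power[of "2 ^ s" s x] by (simp add: mult_2 algebra_simps)
  also have "\<dots> = (\<Sum>i<Suc s. 2 ^ i * (\<Prod>l\<in>{..<Suc s} - {i}. 1 + rad l x))"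
    unfolding Suc.IH by (simp add: p q walsh_dirichlet_power sum_distrib_left ac_simps)
  finally show ?case .
qed

lemma fejer_sum_power_nonneg: "0 \<le> fejer_sum (2 ^ s) x"
  unfolding fejer_sum_power
  by (intro sum_nonneg mult_nonneg_nonneg prod_nonneg) (auto simp: one_plus_rad_nonneg)

text \<open>The binary digits of \<open>m\<close> are removed from the top; digit \<open>i\<close>
  costs at most the \<open>i\<close>-th summand. Positions where the digit is 0 are simply
  added.\<close>

lemma abs_fejer_sum_le:
  assumes "m < 2 ^ s"
  shows "\<bar>fejer_sum m x\<bar> \<le> (\<Sum>i<s. fejer_sum (2 ^ i) x + 2 ^ i * walsh_dirichlet (2 ^ i) x)"
  using assms
proof (induction s arbitrary: m)
  case 0
  then show ?case by simp
next
  case (Suc s)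
  have nn: "0 \<le> fejer_sum (2 ^ s) x + 2 ^ s * walsh_dirichlet (2 ^ s) x"
    using fejer_sum_power_nonneg walsh_dirichlet_power_nonneg by simp
  show ?case
  proof (cases "m < 2 ^ s")
    case True
    then show ?thesis using Suc.IH[OF True] nn by simp
  next
    case False
    define j where "j = m - 2 ^ s"
    have m: "m = 2 ^ s + j" and j: "j < 2 ^ s" using False Suc.prems unfolding j_def by auto
    have "\<bar>fejer_sum m x\<bar> \<le> \<bar>fejer_sum (2 ^ s) x\<bar> + \<bar>j * walsh_dirichlet (2 ^ s) x\<bar> + \<bar>fejer_sum j x\<bar>"
      unfolding m fejer_sum_add_power[OF less_imp_le[OF j]]
      by (rule order_trans[OF abs_triangle_ineq add_mono[OF abs_triangle_ineq]]) (simp add: abs_mult)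
    also have "\<dots> \<le> fejer_sum (2 ^ s) x + 2 ^ s * walsh_dirichlet (2 ^ s) x + \<bar>fejer_sum j x\<bar>"
      using walsh_dirichlet_power_nonneg[of s x] fejer_sum_power_nonneg[of s x] j
      by (simp add: abs_mult) (intro mult_right_mono, auto)
    finally show ?thesis using Suc.IH[OF j] by simp
  qed
qed

section \<open>Integrals of Walsh products\<close>

lemma space_mu [simp]: "space mu = {0..<1}"
  unfolding mu_def by (simp add: space_restrict_space)

lemma measurable_mu: "f \<in> measurable borel N \<Longrightarrow> f \<in> measurable mu N"
  unfolding mu_def by (intro measurable_restrict_space1) simp

interpretation mu: prob_space mu
proof
  show "emeasure mu (space mu) = 1"
    unfolding mu_def by (subst emeasure_restrict_space) (auto simp: space_restrict_space)
qed

lemma integral_mu: "(LINT x|mu. f x) = (LINT x|lborel. indicator {0..<1} x * f x)"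
  for f :: "real \<Rightarrow> real"
  unfolding mu_def by (subst integral_restrict_space) auto

lemma integrable_mu: "integrable mu f \<longleftrightarrow> integrable lborel (\<lambda>x. indicator {0..<1} x * f x)"
  for f :: "real \<Rightarrow> real"
  unfolding mu_def by (subst integrable_restrict_space) auto

lemma rad_eq: "rad k x = (if even \<lfloor>2 ^ (k + 1) * x\<rfloor> then 1 else - 1)"
  unfolding rad_def dyadic_digit_def by (auto simp: even_nat_iff mod2_eq_if)

lemma measurable_rad [measurable]: "rad k \<in> borel_measurable borel"
proof -
  have "(\<lambda>x::real. \<lfloor>2 ^ (k + 1) * x\<rfloor>) \<in> measurable borel (count_space UNIV)"
    by (rule measurable_compose[OF _ measurable_real_floor]) measurable
  then have "(\<lambda>x::real. if even \<lfloor>2 ^ (k + 1) * x\<rfloor> then 1 else - 1 :: real) \<in> borel_measurable borel"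
    by measurable
  then show ?thesis unfolding rad_eq[abs_def] .
qed

lemma measurable_rad_mu [measurable]: "rad k \<in> borel_measurable mu"
  by (rule measurable_mu) measurable

lemma rad_half:
  assumes "0 \<le> x" "x < 1"
  shows "rad 0 (x / 2) = 1" "rad (Suc k) (x / 2) = rad k x"
    "rad 0 ((x + 1) / 2) = - 1" "rad (Suc k) ((x + 1) / 2) = rad k x"
proof -
  have "\<lfloor>2 ^ (0 + 1) * (x / 2)\<rfloor> = 0" "\<lfloor>2 ^ (0 + 1) * ((x + 1) / 2)\<rfloor> = 1"
    using assms by (simp_all add: floor_eq_iff)
  then show "rad 0 (x / 2) = 1" "rad 0 ((x + 1) / 2) = - 1"
    by (simp_all only: rad_eq) simp_all
  show "rad (Suc k) (x / 2) = rad k x"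
    unfolding rad_eq by (simp add: ac_simps)
  have "2 ^ (Suc k + 1) * ((x + 1) / 2) = 2 ^ (k + 1) * x + of_int (2 ^ (k + 1))"
    by (simp add: algebra_simps)
  then have "\<lfloor>2 ^ (Suc k + 1) * ((x + 1) / 2)\<rfloor> = \<lfloor>2 ^ (k + 1) * x\<rfloor> + 2 ^ (k + 1)"
    by (metis floor_add_int)
  then show "rad (Suc k) ((x + 1) / 2) = rad k x"
    unfolding rad_eq by simp
qed

text \<open>The two affine branches onto the halves of the unit interval shift Rademacher indices by
  one, so this is the induction step for integrals of Rademacher products.\<close>

lemma integral_mu_split:
  fixes f :: "real \<Rightarrow> real"
  assumes "integrable mu f"
  shows "(LINT x|mu. f x) = ((LINT x|mu. f (x / 2)) + (LINT x|mu. f ((x + 1) / 2))) / 2"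
proof -
  define g where "g A x = indicator A x * f x" for A x
  have int: "integrable lborel (g {0..<1})"
    using assms unfolding integrable_mu g_def .
  have "integrable lborel (\<lambda>x. indicator {0..<1/2} x * g {0..<1} x)"
    "integrable lborel (\<lambda>x. indicator {1/2..<1} x * g {0..<1} x)"
    using integrable_mult_indicator[OF _ int] by auto
  moreover have "indicator {0..<1/2} x * g {0..<1} x = g {0..<1/2} x"
    "indicator {1/2..<1} x * g {0..<1} x = g {1/2..<1} x" for x
    unfolding g_def by (auto simp: indicator_def)
  ultimately have ints: "integrable lborel (g {0..<1/2})" "integrable lborel (g {1/2..<1})"
    by (auto cong: integrable_cong)
  have "(LINT x|mu. f x) = (LINT x|lborel. g {0..<1/2} x + g {1/2..<1} x)"
    unfolding integral_mu by (rule Bochner_Integration.integral_cong) (auto simp: g_def indicator_def)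
  also have "\<dots> = (LINT x|lborel. g {0..<1/2} x) + (LINT x|lborel. g {1/2..<1} x)"
    using ints by simp
  also have "(LINT x|lborel. g {0..<1/2} x) = (LINT x|mu. f (x / 2)) / 2"
    unfolding integral_mu
    by (subst lborel_integral_real_affine[where c = "1/2" and t = 0])
      (auto simp: g_def indicator_def intro!: Bochner_Integration.integral_cong)
  also have "(LINT x|lborel. g {1/2..<1} x) = (LINT x|mu. f ((x + 1) / 2)) / 2"
    unfolding integral_mu
    by (subst lborel_integral_real_affine[where c = "1/2" and t = "1/2"])
      (auto simp: g_def indicator_def add_divide_distrib add.commute intro!: Bochner_Integration.integral_cong)
  finally show ?thesis by simp
qed

lemma integrable_prod_rad: "integrable mu (\<lambda>x. \<Prod>l<s. \<alpha> l + \<beta> l * rad l x)"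
proof (rule mu.integrable_const_bound)
  show "AE x in mu. norm (\<Prod>l<s. \<alpha> l + \<beta> l * rad l x) \<le> (\<Prod>l<s. \<bar>\<alpha> l\<bar> + \<bar>\<beta> l\<bar>)"
  proof (intro AE_I2)
    fix x
    have "\<bar>\<alpha> l + \<beta> l * rad l x\<bar> \<le> \<bar>\<alpha> l\<bar> + \<bar>\<beta> l\<bar>" for l
      by (rule order_trans[OF abs_triangle_ineq]) (simp add: abs_mult)
    then show "norm (\<Prod>l<s. \<alpha> l + \<beta> l * rad l x) \<le> (\<Prod>l<s. \<bar>\<alpha> l\<bar> + \<bar>\<beta> l\<bar>)"
      unfolding real_norm_def abs_prod by (intro prod_mono) auto
  qed
qed measurable

text \<open>Independence of the Rademacher functions: the two halves contribute the first factors
  \<open>\<alpha> 0 + \<beta> 0\<close> and \<open>\<alpha> 0 - \<beta> 0\<close>, whose mean is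
  \<open>\<alpha> 0\<close>.\<close>

lemma integral_prod_rad: "(LINT x|mu. (\<Prod>l<s. \<alpha> l + \<beta> l * rad l x)) = (\<Prod>l<s. \<alpha> l)"
proof (induction s arbitrary: \<alpha> \<beta>)
  case 0
  then show ?case using mu.prob_space by simp
next
  case (Suc s)
  have p: "(\<Prod>l<Suc s. h l) = h 0 * (\<Prod>l<s. h (Suc l))" for h :: "nat \<Rightarrow> real"
    by (rule prod.lessThan_Suc_shift)
  have "(LINT x|mu. (\<Prod>l<Suc s. \<alpha> l + \<beta> l * rad l x))
      = ((LINT x|mu. (\<Prod>l<Suc s. \<alpha> l + \<beta> l * rad l (x / 2)))
         + (LINT x|mu. (\<Prod>l<Suc s. \<alpha> l + \<beta> l * rad l ((x + 1) / 2)))) / 2"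
    by (rule integral_mu_split[OF integrable_prod_rad])
  also have "(LINT x|mu. (\<Prod>l<Suc s. \<alpha> l + \<beta> l * rad l (x / 2)))
      = (LINT x|mu. (\<alpha> 0 + \<beta> 0) * (\<Prod>l<s. \<alpha> (Suc l) + \<beta> (Suc l) * rad l x))"
    unfolding p by (rule Bochner_Integration.integral_cong) (auto simp: rad_half)
  also have "(LINT x|mu. (\<Prod>l<Suc s. \<alpha> l + \<beta> l * rad l ((x + 1) / 2)))
      = (LINT x|mu. (\<alpha> 0 - \<beta> 0) * (\<Prod>l<s. \<alpha> (Suc l) + \<beta> (Suc l) * rad l x))"
    unfolding p by (rule Bochner_Integration.integral_cong) (auto simp: rad_half)
  finally show ?case
    unfolding p by (simp only: integral_mult_right_zero Suc.IH) (simp add: algebra_simps)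
qed

lemma measurable_walsh [measurable]: "walsh n \<in> borel_measurable borel"
  unfolding walsh_eq_prod_rad[OF less_exp, abs_def] by measurable

lemma measurable_walsh_dirichlet [measurable]: "walsh_dirichlet n \<in> borel_measurable borel"
  unfolding walsh_dirichlet_def[abs_def] by measurable

lemma measurable_fejer_sum [measurable]: "fejer_sum n \<in> borel_measurable borel"
  unfolding fejer_sum_def[abs_def] by measurable

lemma measurable_walsh_mu [measurable]:
  "walsh n \<in> borel_measurable mu" "walsh_dirichlet n \<in> borel_measurable mu"
  "fejer_sum n \<in> borel_measurable mu"
  by (rule measurable_mu, measurable)+

lemma integral_walsh_mult:
  "(LINT x|mu. walsh i x * walsh j x) = (if i = j then 1 else 0)"
proof (cases "i = j")
  case True
  then show ?thesis using mu.prob_space by simp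
next
  case False
  define s where "s = max i j"
  have s: "i < 2 ^ s" "j < 2 ^ s"
    unfolding s_def by (meson le_less_trans less_exp max.cobounded1 max.cobounded2)+
  \<comment> \<open>Equal digits contribute the factor 1, different ones the factor
    \<open>rad l x\<close>; a single differing position makes some \<open>\<alpha> l\<close> vanish
    and kills the integral.\<close>
  define \<alpha> where "\<alpha> l = (if bin_coeff l i = bin_coeff l j then 1 else 0 :: real)" for l
  have "walsh i x * walsh j x = (\<Prod>l<s. \<alpha> l + (1 - \<alpha> l) * rad l x)" for x
    unfolding walsh_eq_prod_rad[OF s(1)] walsh_eq_prod_rad[OF s(2)] prod.distrib[symmetric]
  proof (rule prod.cong)
    fix l
    have "bin_coeff l i = 0 \<or> bin_coeff l i = 1" "bin_coeff l j = 0 \<or> bin_coeff l j = 1"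
      using bin_coeff_less_2[of l i] bin_coeff_less_2[of l j] by linarith+
    then show "rad l x ^ bin_coeff l i * rad l x ^ bin_coeff l j = \<alpha> l + (1 - \<alpha> l) * rad l x"
      unfolding \<alpha>_def by (elim disjE) simp_all
  qed simp
  then have "(LINT x|mu. walsh i x * walsh j x) = (\<Prod>l<s. \<alpha> l)"
    by (simp add: integral_prod_rad)
  moreover have "\<exists>l<s. bin_coeff l i \<noteq> bin_coeff l j"
  proof (rule ccontr)
    assume "\<not> ?thesis"
    then have e: "bin_coeff l i = bin_coeff l j" if "l < s" for l using that by blast
    have "bit i l = bit j l" for l
    proof (cases "l < s")
      case True
      then show ?thesis using e[OF True] unfolding bin_coeff_def bit_iff_odd
        by (simp add: odd_iff_mod_2_eq_one)
    next
      case False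
      then have "i < 2 ^ l" "j < 2 ^ l"
        using s by (meson less_le_trans not_less one_le_numeral power_increasing)+
      then show ?thesis unfolding bit_iff_odd by simp
    qed
    then show False using \<open>i \<noteq> j\<close> bit_eq_iff by blast
  qed
  then obtain l where "l < s" "\<alpha> l = 0" unfolding \<alpha>_def by auto
  then have "(\<Prod>l<s. \<alpha> l) = 0" by (intro prod_zero bexI[of _ l]) auto
  ultimately show ?thesis using False by simp
qed

lemma integrable_walsh_mult: "integrable mu (\<lambda>x. walsh i x * walsh j x)"
  by (rule mu.integrable_const_bound[where B = 1]) (auto simp: abs_mult)

lemma integral_walsh: "(LINT x|mu. walsh i x) = (if i = 0 then 1 else 0)"
  using integral_walsh_mult[of i 0] by simp

lemma integrable_walsh [simp]: "integrable mu (walsh i)"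
  using integrable_walsh_mult[of i 0] by simp

lemma integrable_walsh_dirichlet [simp]: "integrable mu (walsh_dirichlet n)"
  unfolding walsh_dirichlet_def[abs_def] by simp

lemma integrable_fejer_sum [simp]: "integrable mu (fejer_sum n)"
  unfolding fejer_sum_def[abs_def] by simp

lemma integral_walsh_dirichlet: "(LINT x|mu. walsh_dirichlet n x) = (if n = 0 then 0 else 1)"
  unfolding walsh_dirichlet_def by (simp add: integral_walsh)

lemma integral_fejer_sum_le: "(LINT x|mu. fejer_sum n x) \<le> n"
proof -
  have "(LINT x|mu. fejer_sum n x) = (\<Sum>k<n. if k = 0 then 0 else 1)"
    unfolding fejer_sum_def by (simp add: integral_walsh_dirichlet)
  also have "\<dots> \<le> (\<Sum>k<n. 1)" by (intro sum_mono) simp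
  finally show ?thesis by simp
qed

section \<open>Digits of the dyadic sum\<close>

text \<open>Infinitely many zeros keep the scaled tail \<open>T\<close> strictly below 1. The floor
  then returns the integer \<open>I\<close> formed by the first \<open>n + 1\<close> digits, and its
  parity is digit \<open>n\<close>.\<close>

lemma dyadic_digit_suminf:
  assumes d: "\<And>n. d n < 2" and inf: "\<And>n. \<exists>k>n. d k = 0"
  shows "dyadic_digit n (\<Sum>n. real (d n) / 2 ^ (n + 1)) = d n"
proof -
  have geo: "(\<lambda>k. 1 / 2 ^ (k + 1) :: real) sums 1"
    using power_half_series by (simp add: power_one_over)
  have d1: "real (d k) \<le> 1" for k using d[of k] by linarith
  have sm: "summable (\<lambda>k. real (d (k + m)) / 2 ^ (k + 1))" for m
    by (rule summable_comparison_test'[OF sums_summable[OF geo], of 0])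
      (use d1 in \<open>auto intro!: divide_right_mono\<close>)
  define T where "T = (\<Sum>k. real (d (k + Suc n)) / 2 ^ (k + 1))"
  have "0 \<le> T" unfolding T_def by (intro suminf_nonneg sm) simp
  have "T < 1"
  proof -
    obtain k where k: "k > n" "d k = 0" using inf by blast
    have "0 < (\<Sum>k. 1 / 2 ^ (k + 1) - real (d (k + Suc n)) / 2 ^ (k + 1))"
    proof (rule suminf_pos2)
      show "summable (\<lambda>k. 1 / 2 ^ (k + 1) - real (d (k + Suc n)) / 2 ^ (k + 1))"
        by (intro summable_diff sums_summable[OF geo] sm)
      show "0 \<le> 1 / 2 ^ (i + 1) - real (d (i + Suc n)) / 2 ^ (i + 1)" for i
        using d1[of "i + Suc n"] by (simp add: divide_right_mono flip: diff_divide_distrib)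
      show "0 < 1 / 2 ^ (k - Suc n + 1) - real (d (k - Suc n + Suc n)) / 2 ^ (k - Suc n + 1)"
        using k by simp
    qed
    also have "\<dots> = 1 - T"
      unfolding T_def using suminf_diff[OF sums_summable[OF geo] sm[of "Suc n"]] sums_unique[OF geo]
      by simp
    finally show ?thesis by simp
  qed
  define I :: int where "I = (\<Sum>k\<le>n. int (d k) * 2 ^ (n - k))"
  have "(\<Sum>k. real (d k) / 2 ^ (k + 1))
      = (\<Sum>k. real (d (k + Suc n)) / 2 ^ (k + Suc n + 1)) + (\<Sum>k<Suc n. real (d k) / 2 ^ (k + 1))"
    using suminf_split_initial_segment[OF sm[of 0, simplified], of "Suc n"] by simp
  also have "(\<Sum>k. real (d (k + Suc n)) / 2 ^ (k + Suc n + 1)) = T / 2 ^ (n + 1)"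
    unfolding T_def suminf_divide[OF sm, symmetric]
    by (intro suminf_cong) (simp add: power_add)
  finally have "2 ^ (n + 1) * (\<Sum>k. real (d k) / 2 ^ (k + 1))
      = T + 2 ^ (n + 1) * (\<Sum>k<Suc n. real (d k) / 2 ^ (k + 1))"
    by (simp add: field_simps)
  also have "2 ^ (n + 1) * (\<Sum>k<Suc n. real (d k) / 2 ^ (k + 1)) = of_int I"
    unfolding I_def sum_distrib_left lessThan_Suc_atMost of_int_sum
  proof (rule sum.cong)
    fix k assume "k \<in> {..n}"
    then have "(2::real) ^ (n + 1) = 2 ^ (n - k) * 2 ^ (k + 1)" by (simp flip: power_add)
    then show "2 ^ (n + 1) * (real (d k) / 2 ^ (k + 1)) = of_int (int (d k) * 2 ^ (n - k))"
      by simp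
  qed simp
  finally have "\<lfloor>2 ^ (n + 1) * (\<Sum>k. real (d k) / 2 ^ (k + 1))\<rfloor> = I"
    using \<open>0 \<le> T\<close> \<open>T < 1\<close> by (simp add: floor_eq_iff)
  moreover have "I mod 2 = int (d n)"
  proof -
    have "I = int (d n) + (\<Sum>k<n. int (d k) * 2 ^ (n - k))"
      unfolding I_def by (simp flip: lessThan_Suc_atMost)
    moreover have "even (\<Sum>k<n. int (d k) * 2 ^ (n - k))" by (intro dvd_sum) simp
    ultimately have "I mod 2 = int (d n) mod 2" by presburger
    then show ?thesis using d[of n] by simp
  qed
  ultimately show ?thesis unfolding dyadic_digit_def by simp
qed

text \<open>The exceptional points are those \<open>u\<close> for which \<open>x \<dotplus> u\<close> is given by an expansion ending
  in ones.\<close>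

lemma AE_rad_dyadic_add: "AE u in mu. \<forall>k. rad k (x \<dotplus> u) = rad k x * rad k u"
proof -
  have "AE u in mu. \<exists>k>n. rad k x = rad k u" for n
  proof -
    let ?N = "{u \<in> space mu. \<not> (\<exists>k>n. rad k x = rad k u)}"
    have N: "?N \<in> sets mu" by measurable
    have le: "measure mu ?N \<le> (1 / 2) ^ s" for s
    proof -
      \<comment> \<open>For \<open>l > n\<close> the factor is
        \<open>(1 - rad l x * rad l u) / 2\<close>, which is 1 where the digits of \<open>x\<close>
        and \<open>u\<close> differ and 0 otherwise. The product therefore dominates the indicator
        of the exceptional set, and its integral is \<open>(1 / 2)^s\<close>.\<close>
      define \<alpha> where "\<alpha> l = (if l \<le> n then 1 else 1 / 2 :: real)" for l
      define \<beta> where "\<beta> l = (if l \<le> n then 0 else - rad l x / 2)" for l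
      have nn: "0 \<le> \<alpha> l + \<beta> l * rad l u" for l u
        unfolding \<alpha>_def \<beta>_def using rad_cases[of l x] rad_cases[of l u] by auto
      have "measure mu ?N = (LINT u|mu. indicator ?N u)"
      proof -
        have "?N \<inter> space mu = ?N" by blast
        then show ?thesis using Bochner_Integration.integral_indicator[of mu ?N] by simp
      qed
      also have "\<dots> \<le> (LINT u|mu. (\<Prod>l<Suc n + s. \<alpha> l + \<beta> l * rad l u))"
      proof (rule integral_mono)
        show "integrable mu (indicator ?N :: real \<Rightarrow> real)"
          using N by (intro integrable_real_indicator) (simp_all add: mu.emeasure_eq_measure)
        fix u assume "u \<in> space mu"
        show "indicator ?N u \<le> (\<Prod>l<Suc n + s. \<alpha> l + \<beta> l * rad l u)"
        proof (cases "u \<in> ?N")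
          case True
          have "\<alpha> l + \<beta> l * rad l u = 1" for l
          proof (cases "l \<le> n")
            case False
            then have "rad l x \<noteq> rad l u" using True by auto
            then have "rad l x * rad l u = - 1" using rad_cases[of l x] rad_cases[of l u] by auto
            then show ?thesis using False unfolding \<alpha>_def \<beta>_def by simp
          qed (simp add: \<alpha>_def \<beta>_def)
          then show ?thesis by (simp add: indicator_def)
        next
          case False
          then have "indicator ?N u = (0::real)" by (rule indicator_simps(2))
          then show ?thesis using nn by (simp add: prod_nonneg)
        qed
      qed (rule integrable_prod_rad)
      also have "\<dots> = (\<Prod>l<Suc n + s. \<alpha> l)" by (rule integral_prod_rad)
      also have "\<dots> = (1 / 2) ^ s"
      proof (induction s)
        case 0
        then show ?case unfolding \<alpha>_def by simp
      qed (simp add: \<alpha>_def)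
      finally show ?thesis .
    qed
    have "measure mu ?N \<le> 0"
      by (rule LIMSEQ_le_const[of "\<lambda>s. (1 / 2) ^ s"]) (use le in \<open>auto intro!: LIMSEQ_power_zero\<close>)
    then have "emeasure mu ?N = 0"
      by (simp add: mu.emeasure_eq_measure measure_le_0_iff)
    then show ?thesis by (intro AE_I[of _ _ ?N] N) auto
  qed
  then have "AE u in mu. \<forall>n. \<exists>k>n. rad k x = rad k u" by (subst AE_all_countable) blast
  then show ?thesis
  proof eventually_elim
    case (elim u)
    define d where "d n = (if dyadic_digit n x = dyadic_digit n u then 0 else 1 :: nat)" for n
    have dig: "dyadic_digit n y = 0 \<or> dyadic_digit n y = 1" for n y
      using dyadic_digit_less_2[of n y] by linarith
    have "real (d n) = \<bar>real (dyadic_digit n x) - real (dyadic_digit n u)\<bar>" for n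
      unfolding d_def using dig[of n x] dig[of n u] by auto
    then have sum: "x \<dotplus> u = (\<Sum>n. real (d n) / 2 ^ (n + 1))"
      unfolding dyadic_add_def by simp
    have d0: "d k = 0" if "rad k x = rad k u" for k
      using that dig[of k x] dig[of k u] unfolding d_def rad_def by auto
    have "dyadic_digit n (x \<dotplus> u) = d n" for n
      unfolding sum
    proof (rule dyadic_digit_suminf)
      show "d n < 2" for n by (simp add: d_def)
      show "\<exists>k>n. d k = 0" for n using elim d0 by blast
    qed
    moreover have "(- 1) ^ d n = rad n x * rad n u" for n
      using dig[of n x] dig[of n u] unfolding d_def rad_def by (elim disjE) simp_all
    ultimately show ?case by (simp add: rad_def[of _ "x \<dotplus> u"])
  qed
qed

section \<open>The structure of the kernels\<close>

definition partial_weight :: "(nat \<Rightarrow> real) \<Rightarrow> nat \<Rightarrow> real" where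
  "partial_weight t n = (\<Sum>j<n. t j)"

text \<open>The weights are decoupled from \<open>n\<close>: the recursion on the top binary digit
  replaces \<open>n\<close> by \<open>n - 2^N\<close> and keeps the same weights, whereas a matrix
  ties the column to the order.\<close>

definition transform_kernel :: "(nat \<Rightarrow> real) \<Rightarrow> nat \<Rightarrow> real \<Rightarrow> real" where
  "transform_kernel t n x = (\<Sum>j<n. t j * walsh_dirichlet (n - j) x)"

lemma matrix_kernel_eq: "matrix_kernel t n x = transform_kernel (\<lambda>k. t k n) n x"
  unfolding matrix_kernel_def transform_kernel_def
  by (rule sum.reindex_bij_witness[of _ "\<lambda>j. n - j" "\<lambda>k. n - k"]) auto

lemma sum_lessThan_add:
  fixes g :: "nat \<Rightarrow> 'a::comm_monoid_add"
  shows "(\<Sum>j<m + k. g j) = (\<Sum>j<m. g j) + (\<Sum>j<k. g (m + j))"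
  by (induction k) (auto simp: ac_simps)

lemma partial_weight_add: "partial_weight t (k + m) = partial_weight t m + (\<Sum>j<k. t (m + j))"
  unfolding partial_weight_def add.commute[of k] by (rule sum_lessThan_add)

text \<open>For \<open>j < m\<close> the order \<open>2^N + m - j\<close> lies above
  \<open>2^N\<close> and the translation formula applies; for the other indices it is
  \<open>2^N - (j - m)\<close> and is reflected. The first group reproduces the kernel of order
  \<open>m\<close>, the second leaves a block of decreasing weights in front of low Dirichlet
  kernels.\<close>

lemma transform_kernel_add_power:
  assumes "m < 2 ^ N"
  shows "transform_kernel t (2 ^ N + m) x
       = partial_weight t (2 ^ N + m) * walsh_dirichlet (2 ^ N) x + rad N x * transform_kernel t m x
         - walsh (2 ^ N - 1) x * (\<Sum>j<2 ^ N. t (m + j) * walsh_dirichlet j x)"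
proof -
  let ?D = "\<lambda>k. walsh_dirichlet k x"
  have "transform_kernel t (m + 2 ^ N) x
      = (\<Sum>j<m. t j * ?D (m + 2 ^ N - j)) + (\<Sum>j<2 ^ N. t (m + j) * ?D (m + 2 ^ N - (m + j)))"
    unfolding transform_kernel_def by (rule sum_lessThan_add)
  also have "(\<Sum>j<m. t j * ?D (m + 2 ^ N - j)) = (\<Sum>j<m. t j * (?D (2 ^ N) + rad N x * ?D (m - j)))"
  proof (rule sum.cong)
    fix j assume "j \<in> {..<m}"
    then have "m + 2 ^ N - j = 2 ^ N + (m - j)" "m - j \<le> 2 ^ N" using assms by auto
    then show "t j * ?D (m + 2 ^ N - j) = t j * (?D (2 ^ N) + rad N x * ?D (m - j))"
      by (simp only: walsh_dirichlet_add_power)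
  qed simp
  also have "(\<Sum>j<2 ^ N. t (m + j) * ?D (m + 2 ^ N - (m + j)))
      = (\<Sum>j<2 ^ N. t (m + j) * (?D (2 ^ N) - walsh (2 ^ N - 1) x * ?D j))"
    by (rule sum.cong) (auto simp: walsh_dirichlet_reflect)
  finally have "transform_kernel t (m + 2 ^ N) x
     = (\<Sum>j<m. t j * (?D (2 ^ N) + rad N x * ?D (m - j)))
     + (\<Sum>j<2 ^ N. t (m + j) * (?D (2 ^ N) - walsh (2 ^ N - 1) x * ?D j))" .
  moreover have "(\<Sum>j<m. t j * (?D (2 ^ N) + rad N x * ?D (m - j)))
      = partial_weight t m * ?D (2 ^ N) + rad N x * transform_kernel t m x"
    unfolding partial_weight_def transform_kernel_def
    by (simp add: algebra_simps sum.distrib sum_distrib_left sum_distrib_right)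
  moreover have "(\<Sum>j<2 ^ N. t (m + j) * (?D (2 ^ N) - walsh (2 ^ N - 1) x * ?D j))
      = (\<Sum>j<2 ^ N. t (m + j)) * ?D (2 ^ N) - walsh (2 ^ N - 1) x * (\<Sum>j<2 ^ N. t (m + j) * ?D j)"
    by (simp add: algebra_simps sum_subtractf sum_distrib_left sum_distrib_right)
  ultimately show ?thesis
    unfolding partial_weight_add unfolding add.commute[of "2 ^ N" m] by (simp add: distrib_right)
qed

lemma sum_by_parts:
  fixes a D F :: "nat \<Rightarrow> real"
  assumes "F 0 = 0" "\<And>j. F (Suc j) = F j + D j"
  shows "(\<Sum>j<Suc l. a j * D j) = a l * F (Suc l) + (\<Sum>j<l. (a j - a (Suc j)) * F (Suc j))"
proof (induction l)
  case (Suc l)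
  then show ?case using assms(2)[of "Suc l"] by (simp add: algebra_simps)
qed (simp add: assms)

text \<open>The \<open>c_k\<close> of the overview. \<open>n mod 2^(k + 1)\<close> is what remains
  of \<open>n\<close> when the recursion reaches digit \<open>k\<close>; it does not see higher
  digits, so adding a top digit leaves the earlier weights unchanged.\<close>

definition digit_weight :: "(nat \<Rightarrow> real) \<Rightarrow> nat \<Rightarrow> nat \<Rightarrow> real" where
  "digit_weight t n k = bin_coeff k n * partial_weight t (n mod 2 ^ (k + 1))"

text \<open>The last summand is the whole top weight, since \<open>digit_weight\<close> vanishes
  above the leading digit.\<close>

definition digit_variation :: "(nat \<Rightarrow> real) \<Rightarrow> nat \<Rightarrow> real" where
  "digit_variation t n = (\<Sum>k\<le>floor_log n. \<bar>digit_weight t n k - digit_weight t n (Suc k)\<bar>)"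

definition main_kernel :: "(nat \<Rightarrow> real) \<Rightarrow> nat \<Rightarrow> nat \<Rightarrow> real \<Rightarrow> real" where
  "main_kernel t n K x
     = (\<Sum>k<K. digit_weight t n k * (walsh_dirichlet (2 ^ Suc k) x - walsh_dirichlet (2 ^ k) x))"

lemma main_kernel_Suc_low: "n < 2 ^ N \<Longrightarrow> main_kernel t n (Suc N) x = main_kernel t n N x"
  unfolding main_kernel_def digit_weight_def by (simp add: bin_coeff_eq_0)

lemma main_kernel_Suc_high:
  assumes "m < 2 ^ N"
  shows "main_kernel t (2 ^ N + m) (Suc N) x
       = main_kernel t m N x + partial_weight t (2 ^ N + m) * (rad N x * walsh_dirichlet (2 ^ N) x)"
proof -
  have "digit_weight t (2 ^ N + m) k = digit_weight t m k" if "k < N" for k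
  proof -
    have "(2::nat) ^ N = 2 ^ (k + 1) * 2 ^ (N - (k + 1))" using that by (simp del: power_Suc flip: power_add)
    then have "(2 ^ N + m) mod 2 ^ (k + 1) = m mod 2 ^ (k + 1)" by simp
    then show ?thesis
      using that unfolding digit_weight_def by (simp add: bin_coeff_add_power[OF assms])
  qed
  moreover have "digit_weight t (2 ^ N + m) N = partial_weight t (2 ^ N + m)"
    using assms unfolding digit_weight_def by (simp add: bin_coeff_add_power[OF assms])
  ultimately show ?thesis
    unfolding main_kernel_def by (simp add: walsh_dirichlet_power_diff)
qed

definition kernel_majorant :: "nat \<Rightarrow> real \<Rightarrow> real" where
  "kernel_majorant s x = walsh_dirichlet (2 ^ s) x + fejer_sum (2 ^ s) x / 2 ^ s"

lemma kernel_majorant_nonneg: "0 \<le> kernel_majorant s x"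
  unfolding kernel_majorant_def
  by (simp add: walsh_dirichlet_power_nonneg fejer_sum_power_nonneg)

lemma measurable_kernel_majorant [measurable]: "kernel_majorant s \<in> borel_measurable borel"
  unfolding kernel_majorant_def[abs_def] by measurable

lemma measurable_transform_kernel [measurable]: "transform_kernel t n \<in> borel_measurable borel"
  unfolding transform_kernel_def[abs_def] by measurable

lemma measurable_main_kernel [measurable]: "main_kernel t n K \<in> borel_measurable borel"
  unfolding main_kernel_def[abs_def] by measurable

text \<open>The kernel estimates use the measure only through the integrals of
  \<open>kernel_majorant\<close>. They are applied to \<open>mu\<close> itself, with
  \<open>A = 2\<close>, for bounds of norms, and to the image of the measure with density
  \<open>g\<close> under \<open>u\<close> to \<open>x \<dotplus> u\<close>, with
  \<open>A = majorant_op g x\<close> (possibly infinite), for the pointwise domination.\<close>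

locale majorized_measure =
  fixes M :: "real measure" and A :: ennreal
  assumes sets_M [measurable_cong]: "sets M = sets borel"
    and majorant_le: "(\<integral>\<^sup>+ x. kernel_majorant s x \<partial>M) \<le> A"
begin

lemma nn_integral_dirichlet_power_le: "(\<integral>\<^sup>+ x. walsh_dirichlet (2 ^ s) x \<partial>M) \<le> A"
  by (rule order_trans[OF nn_integral_mono majorant_le[of s]])
    (auto simp: kernel_majorant_def fejer_sum_power_nonneg intro!: ennreal_leI)

text \<open>With \<open>s\<close> the number of binary digits of \<open>m\<close>, the bound by
  \<open>2^i * kernel_majorant i\<close> for \<open>i < s\<close> is geometric and sums to less than
  \<open>2^s\<close>, hence to at most \<open>2 * m\<close>.\<close>

lemma nn_integral_fejer_le: "(\<integral>\<^sup>+ x. \<bar>fejer_sum m x\<bar> \<partial>M) \<le> ennreal (2 * m) * A"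
proof (cases "m = 0")
  case True
  then show ?thesis by simp
next
  case False
  define s where "s = Suc (floor_log m)"
  have m: "m < 2 ^ s" "2 ^ s \<le> 2 * m"
    unfolding s_def using floor_log_exp2_gt[of m] floor_log_exp2_le[of m] False by auto
  have eq: "fejer_sum (2 ^ i) x + 2 ^ i * walsh_dirichlet (2 ^ i) x = 2 ^ i * kernel_majorant i x" for i x
    unfolding kernel_majorant_def by (simp add: algebra_simps)
  have "(\<integral>\<^sup>+ x. \<bar>fejer_sum m x\<bar> \<partial>M) \<le> (\<integral>\<^sup>+ x. (\<Sum>i<s. ennreal (2 ^ i) * kernel_majorant i x) \<partial>M)"
  proof (rule nn_integral_mono)
    fix x
    have "ennreal \<bar>fejer_sum m x\<bar> \<le> ennreal (\<Sum>i<s. 2 ^ i * kernel_majorant i x)"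
      using abs_fejer_sum_le[OF m(1), of x] unfolding eq by (rule ennreal_leI)
    also have "\<dots> = (\<Sum>i<s. ennreal (2 ^ i * kernel_majorant i x))"
      by (rule sum_ennreal[symmetric]) (simp add: kernel_majorant_nonneg)
    also have "\<dots> = (\<Sum>i<s. ennreal (2 ^ i) * kernel_majorant i x)"
      by (simp add: ennreal_mult kernel_majorant_nonneg)
    finally show "ennreal \<bar>fejer_sum m x\<bar> \<le> (\<Sum>i<s. ennreal (2 ^ i) * kernel_majorant i x)" .
  qed
  also have "\<dots> = (\<Sum>i<s. ennreal (2 ^ i) * (\<integral>\<^sup>+ x. kernel_majorant i x \<partial>M))"
    by (subst nn_integral_sum) (auto simp: nn_integral_cmult)
  also have "\<dots> \<le> (\<Sum>i<s. ennreal (2 ^ i) * A)"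
    by (intro sum_mono mult_left_mono majorant_le) simp
  also have "\<dots> = ennreal (\<Sum>i<s. 2 ^ i) * A"
    by (simp add: sum_distrib_right flip: sum_ennreal)
  also have "\<dots> \<le> ennreal (2 * m) * A"
  proof (intro mult_right_mono ennreal_leI)
    have "(\<Sum>i<s. 2 ^ i :: real) = 2 ^ s - 1" by (induction s) auto
    also have "\<dots> \<le> 2 * m" using m(2) by (metis diff_le_eq le_add_same_cancel1 of_nat_le_iff
        of_nat_mult of_nat_numeral of_nat_power order_trans zero_le_one)
    finally show "(\<Sum>i<s. 2 ^ i :: real) \<le> 2 * m" .
  qed simp
  finally show ?thesis .
qed

text \<open>Summation by parts turns Dirichlet kernels into Fejer sums with coefficients
  \<open>a j - a (Suc j)\<close>, which are nonnegative because the weights decrease; the linear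
  growth of the Fejer bound then loses nothing but the factor 2.\<close>

lemma nn_integral_decreasing_dirichlet_le:
  assumes "\<And>j. 0 \<le> a j" "\<And>j. a (Suc j) \<le> a j"
  shows "(\<integral>\<^sup>+ x. \<bar>\<Sum>j<k. a j * walsh_dirichlet j x\<bar> \<partial>M) \<le> ennreal (2 * (\<Sum>j<k. a j)) * A"
proof (cases k)
  case 0
  then show ?thesis by simp
next
  case (Suc l)
  have eq: "(\<Sum>j<k. a j * walsh_dirichlet j x)
      = a l * fejer_sum k x + (\<Sum>j<l. (a j - a (Suc j)) * fejer_sum (Suc j) x)" for x
    unfolding Suc by (rule sum_by_parts) (simp_all add: fejer_sum_Suc)
  have nn: "0 \<le> a j - a (Suc j)" for j using assms(2)[of j] by simp
  have "(\<integral>\<^sup>+ x. \<bar>\<Sum>j<k. a j * walsh_dirichlet j x\<bar> \<partial>M)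
      \<le> (\<integral>\<^sup>+ x. ennreal (a l) * \<bar>fejer_sum k x\<bar>
            + (\<Sum>j<l. ennreal (a j - a (Suc j)) * \<bar>fejer_sum (Suc j) x\<bar>) \<partial>M)"
  proof (rule nn_integral_mono)
    fix x
    have "\<bar>\<Sum>j<k. a j * walsh_dirichlet j x\<bar>
        \<le> a l * \<bar>fejer_sum k x\<bar> + (\<Sum>j<l. (a j - a (Suc j)) * \<bar>fejer_sum (Suc j) x\<bar>)"
      unfolding eq using assms nn
      by (intro order_trans[OF abs_triangle_ineq] add_mono order_trans[OF sum_abs])
        (simp_all add: abs_mult)
    then have "ennreal \<bar>\<Sum>j<k. a j * walsh_dirichlet j x\<bar>
        \<le> ennreal (a l * \<bar>fejer_sum k x\<bar> + (\<Sum>j<l. (a j - a (Suc j)) * \<bar>fejer_sum (Suc j) x\<bar>))"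
      by (rule ennreal_leI)
    also have "\<dots> = ennreal (a l) * \<bar>fejer_sum k x\<bar>
            + (\<Sum>j<l. ennreal (a j - a (Suc j)) * \<bar>fejer_sum (Suc j) x\<bar>)"
      using assms(1) nn
      by (simp add: ennreal_plus sum_nonneg ennreal_mult flip: sum_ennreal)
    finally show "ennreal \<bar>\<Sum>j<k. a j * walsh_dirichlet j x\<bar> \<le> \<dots>" .
  qed
  also have "\<dots> = ennreal (a l) * (\<integral>\<^sup>+ x. \<bar>fejer_sum k x\<bar> \<partial>M)
      + (\<Sum>j<l. ennreal (a j - a (Suc j)) * (\<integral>\<^sup>+ x. \<bar>fejer_sum (Suc j) x\<bar> \<partial>M))"
    by (simp add: nn_integral_add nn_integral_sum nn_integral_cmult)
  also have "\<dots> \<le> ennreal (a l) * (ennreal (2 * k) * A)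
      + (\<Sum>j<l. ennreal (a j - a (Suc j)) * (ennreal (2 * Suc j) * A))"
    by (intro add_mono mult_left_mono sum_mono nn_integral_fejer_le) simp_all
  also have "\<dots> = ennreal (a l * (2 * k) + (\<Sum>j<l. (a j - a (Suc j)) * (2 * Suc j))) * A"
    using assms(1) nn
    by (simp add: ennreal_plus sum_nonneg ennreal_mult sum_distrib_right distrib_right mult.assoc
        del: of_nat_Suc flip: sum_ennreal)
  \<comment> \<open>Summation by parts read backwards, with the constant 2 in place of the Dirichlet
    kernels.\<close>
  also have "a l * (2 * k) + (\<Sum>j<l. (a j - a (Suc j)) * (2 * Suc j)) = 2 * (\<Sum>j<k. a j)"
    using sum_by_parts[of "\<lambda>j. 2 * real j" "\<lambda>_. 2" a l] unfolding Suc
    by (simp add: sum_distrib_left mult.commute)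
  finally show ?thesis .
qed

text \<open>Each binary digit of \<open>n\<close> adds one block of reflected terms to the error.
  Successive digits use disjoint blocks of weights, so the total is governed by
  \<open>partial_weight t n\<close>, independently of the number of digits.\<close>

lemma nn_integral_kernel_error_le:
  assumes t: "\<And>j. 0 \<le> t j" "\<And>j. t (Suc j) \<le> t j" and "n < 2 ^ N"
  shows "(\<integral>\<^sup>+ x. \<bar>transform_kernel t n x - walsh n x * main_kernel t n N x\<bar> \<partial>M)
         \<le> ennreal (2 * partial_weight t n) * A"
  using assms(3)
proof (induction N arbitrary: n)
  case 0
  then show ?case by (simp add: transform_kernel_def main_kernel_def)
next
  case (Suc N)
  show ?case
  proof (cases "n < 2 ^ N")
    case True
    then show ?thesis using Suc.IH[OF True] by (simp add: main_kernel_Suc_low)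
  next
    case False
    define m where "m = n - 2 ^ N"
    have n: "n = 2 ^ N + m" and m: "m < 2 ^ N" using False Suc.prems unfolding m_def by auto
    let ?S = "\<lambda>x. \<Sum>j<2 ^ N. t (m + j) * walsh_dirichlet j x"
    have eq: "transform_kernel t n x - walsh n x * main_kernel t n (Suc N) x
        = rad N x * (transform_kernel t m x - walsh m x * main_kernel t m N x)
          - walsh (2 ^ N - 1) x * ?S x" for x
    proof -
      \<comment> \<open>On the support of the kernel of order \<open>2^N\<close> the function
        \<open>walsh m\<close> is 1, so \<open>walsh n\<close> reduces to \<open>rad N\<close> and
        cancels the other factor \<open>rad N\<close>.\<close>
      have "walsh n x * (rad N x * walsh_dirichlet (2 ^ N) x)
          = (rad N x * rad N x) * (walsh m x * walsh_dirichlet (2 ^ N) x)"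
        unfolding n walsh_add_power[OF m] by (simp add: ac_simps)
      then have e: "walsh n x * (rad N x * walsh_dirichlet (2 ^ N) x) = walsh_dirichlet (2 ^ N) x"
        using walsh_mult_dirichlet_power[OF m, of x] by simp
      have "walsh n x * main_kernel t n (Suc N) x
          = walsh n x * main_kernel t m N x
            + partial_weight t n * (walsh n x * (rad N x * walsh_dirichlet (2 ^ N) x))"
        unfolding n main_kernel_Suc_high[OF m] by (simp add: algebra_simps)
      also have "\<dots> = rad N x * walsh m x * main_kernel t m N x
            + partial_weight t n * walsh_dirichlet (2 ^ N) x"
        unfolding e unfolding n walsh_add_power[OF m] ..
      finally show ?thesis
        unfolding n transform_kernel_add_power[OF m] by (simp add: algebra_simps)
    qed
    have "(\<integral>\<^sup>+ x. \<bar>transform_kernel t n x - walsh n x * main_kernel t n (Suc N) x\<bar> \<partial>M)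
        \<le> (\<integral>\<^sup>+ x. ennreal \<bar>transform_kernel t m x - walsh m x * main_kernel t m N x\<bar> + \<bar>?S x\<bar> \<partial>M)"
      unfolding eq
      by (intro nn_integral_mono)
        (simp add: ennreal_leI order_trans[OF abs_triangle_ineq4] abs_mult flip: ennreal_plus)
    also have "\<dots> = (\<integral>\<^sup>+ x. \<bar>transform_kernel t m x - walsh m x * main_kernel t m N x\<bar> \<partial>M)
        + (\<integral>\<^sup>+ x. \<bar>?S x\<bar> \<partial>M)"
      by (rule nn_integral_add) measurable
    also have "\<dots> \<le> ennreal (2 * partial_weight t m) * A + ennreal (2 * (\<Sum>j<2 ^ N. t (m + j))) * A"
      using t by (intro add_mono Suc.IH m nn_integral_decreasing_dirichlet_le) auto
    also have "\<dots> = ennreal (2 * partial_weight t n) * A"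
    proof -
      have "0 \<le> partial_weight t m" "0 \<le> (\<Sum>j<2 ^ N. t (m + j))"
        using t(1) unfolding partial_weight_def by (auto intro: sum_nonneg)
      then show ?thesis
        unfolding n partial_weight_add by (simp add: distrib_left distrib_right ennreal_plus)
    qed
    finally show ?thesis .
  qed
qed

text \<open>The constant 3 consists of 2 for the error term and 1 for the boundary term at digit
  0.\<close>

lemma nn_integral_transform_kernel_le:
  assumes t: "\<And>j. 0 \<le> t j" "\<And>j. t (Suc j) \<le> t j" and le1: "\<And>m. m \<le> n \<Longrightarrow> partial_weight t m \<le> 1"
  shows "(\<integral>\<^sup>+ x. \<bar>transform_kernel t n x\<bar> \<partial>M) \<le> ennreal (3 + digit_variation t n) * A"
proof -
  define K where "K = Suc (floor_log n)"
  have n: "n < 2 ^ K" unfolding K_def using floor_log_exp2_gt[of n] by simp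
  define c where "c = digit_weight t n"
  have cK: "c K = 0" unfolding c_def digit_weight_def by (simp add: bin_coeff_eq_0[OF n])
  have c0: "\<bar>c 0\<bar> \<le> 1"
  proof -
    have "0 \<le> partial_weight t (n mod 2)" "partial_weight t (n mod 2) \<le> 1"
      using t(1) le1[of "n mod 2"] unfolding partial_weight_def by (auto intro: sum_nonneg)
    moreover have "bin_coeff 0 n = 0 \<or> bin_coeff 0 n = 1" using bin_coeff_less_2[of 0 n] by linarith
    ultimately show ?thesis unfolding c_def digit_weight_def by auto
  qed
  \<comment> \<open>Summation by parts over the digits; \<open>c K = 0\<close> removes the upper
    boundary term, and the kernels that remain are nonnegative.\<close>
  have main: "main_kernel t n K x = c K * walsh_dirichlet (2 ^ K) x - c 0 * walsh_dirichlet (2 ^ 0) x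
      + (\<Sum>k<K. (c k - c (Suc k)) * walsh_dirichlet (2 ^ Suc k) x)" for x
    unfolding main_kernel_def c_def[symmetric]
    by (induction K) (auto simp: algebra_simps)
  have "(\<integral>\<^sup>+ x. \<bar>transform_kernel t n x\<bar> \<partial>M)
      \<le> (\<integral>\<^sup>+ x. ennreal \<bar>transform_kernel t n x - walsh n x * main_kernel t n K x\<bar>
           + (walsh_dirichlet (2 ^ 0) x
           + (\<Sum>k<K. ennreal \<bar>c k - c (Suc k)\<bar> * walsh_dirichlet (2 ^ Suc k) x)) \<partial>M)"
  proof (rule nn_integral_mono)
    fix x
    have d: "0 \<le> walsh_dirichlet (2 ^ k) x" for k by (rule walsh_dirichlet_power_nonneg)
    have "\<bar>main_kernel t n K x\<bar>
        \<le> \<bar>- c 0 * walsh_dirichlet (2 ^ 0) x\<bar> + \<bar>\<Sum>k<K. (c k - c (Suc k)) * walsh_dirichlet (2 ^ Suc k) x\<bar>"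
      unfolding main cK using abs_triangle_ineq[of "- c 0 * walsh_dirichlet (2 ^ 0) x"] by simp
    also have "\<dots> \<le> walsh_dirichlet (2 ^ 0) x + (\<Sum>k<K. \<bar>c k - c (Suc k)\<bar> * walsh_dirichlet (2 ^ Suc k) x)"
    proof (intro add_mono order_trans[OF sum_abs])
      show "\<bar>- c 0 * walsh_dirichlet (2 ^ 0) x\<bar> \<le> walsh_dirichlet (2 ^ 0) x"
        using mult_right_mono[OF c0 d[of 0]] d[of 0] by (simp add: abs_mult)
    qed (use d[of "Suc _"] in \<open>simp add: abs_mult\<close>)
    finally have m: "\<bar>main_kernel t n K x\<bar> \<le> \<dots>" .
    have "\<bar>transform_kernel t n x\<bar> \<le> \<bar>transform_kernel t n x - walsh n x * main_kernel t n K x\<bar>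
        + \<bar>walsh n x * main_kernel t n K x\<bar>" by linarith
    also have "\<bar>walsh n x * main_kernel t n K x\<bar> = \<bar>main_kernel t n K x\<bar>" by (simp add: abs_mult)
    finally have "\<bar>transform_kernel t n x\<bar> \<le> \<bar>transform_kernel t n x - walsh n x * main_kernel t n K x\<bar>
        + (walsh_dirichlet (2 ^ 0) x + (\<Sum>k<K. \<bar>c k - c (Suc k)\<bar> * walsh_dirichlet (2 ^ Suc k) x))"
      using m by linarith
    then have "ennreal \<bar>transform_kernel t n x\<bar> \<le> ennreal (\<bar>transform_kernel t n x - walsh n x * main_kernel t n K x\<bar>
        + (walsh_dirichlet (2 ^ 0) x + (\<Sum>k<K. \<bar>c k - c (Suc k)\<bar> * walsh_dirichlet (2 ^ Suc k) x)))"
      by (rule ennreal_leI)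
    also have "\<dots> = ennreal \<bar>transform_kernel t n x - walsh n x * main_kernel t n K x\<bar>
           + (walsh_dirichlet (2 ^ 0) x
           + (\<Sum>k<K. ennreal \<bar>c k - c (Suc k)\<bar> * walsh_dirichlet (2 ^ Suc k) x))"
      using d[of 0] d[of "Suc _"]
      by (simp add: ennreal_plus sum_nonneg ennreal_mult del: power_0 power_Suc flip: sum_ennreal)
    finally show "ennreal \<bar>transform_kernel t n x\<bar> \<le> \<dots>" .
  qed
  also have "\<dots> = (\<integral>\<^sup>+ x. \<bar>transform_kernel t n x - walsh n x * main_kernel t n K x\<bar> \<partial>M)
      + ((\<integral>\<^sup>+ x. walsh_dirichlet (2 ^ 0) x \<partial>M)
      + (\<Sum>k<K. ennreal \<bar>c k - c (Suc k)\<bar> * (\<integral>\<^sup>+ x. walsh_dirichlet (2 ^ Suc k) x \<partial>M)))"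
    by (simp add: nn_integral_add nn_integral_sum nn_integral_cmult del: power_0 power_Suc)
  also have "\<dots> \<le> ennreal (2 * partial_weight t n) * A + (A + (\<Sum>k<K. ennreal \<bar>c k - c (Suc k)\<bar> * A))"
    by (intro add_mono mult_left_mono sum_mono nn_integral_dirichlet_power_le
        nn_integral_kernel_error_le t n) simp
  also have "\<dots> = ennreal (2 * partial_weight t n) * A + (1 * A + ennreal (digit_variation t n) * A)"
    unfolding digit_variation_def c_def K_def lessThan_Suc_atMost
    by (simp add: sum_distrib_right flip: sum_ennreal)
  also have "\<dots> \<le> ennreal 2 * A + (1 * A + ennreal (digit_variation t n) * A)"
    using le1[of n] by (intro add_mono mult_right_mono ennreal_leI) auto
  also have "\<dots> = ennreal (3 + digit_variation t n) * A"
  proof -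
    have "0 \<le> digit_variation t n" unfolding digit_variation_def by (simp add: sum_nonneg)
    then have "ennreal (2 + (1 + digit_variation t n)) = ennreal 2 + (1 + ennreal (digit_variation t n))"
      by (simp only: ennreal_plus zero_le_numeral zero_le_one add_nonneg_nonneg ennreal_1)
    then have "ennreal (3 + digit_variation t n) = ennreal 2 + (1 + ennreal (digit_variation t n))"
      by simp
    then show ?thesis by (simp only: distrib_right)
  qed
  finally show ?thesis .
qed

end

section \<open>The majorant maximal operator\<close>

text \<open>For \<open>i < s\<close> this is a multiple of the indicator that \<open>x\<close> and
  \<open>u\<close> agree in their first \<open>s\<close> digits except possibly digit
  \<open>i\<close>: two dyadic intervals, that of \<open>x\<close> and its mate. For
  \<open>i = s\<close> no factor is missing and only the interval of \<open>x\<close>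
  remains.\<close>

definition ridge_kernel :: "nat \<Rightarrow> nat \<Rightarrow> real \<Rightarrow> real \<Rightarrow> real" where
  "ridge_kernel s i x u = (\<Prod>l\<in>{..<s} - {i}. 1 + rad l x * rad l u)"

text \<open>Equals \<open>kernel_majorant s (x \<dotplus> u)\<close> for almost every
  \<open>u\<close>; the term \<open>i = s\<close> is the Dirichlet part. Writing it through
  Rademacher functions gives joint measurability and symmetry at once.\<close>

definition majorant_kernel :: "nat \<Rightarrow> real \<Rightarrow> real \<Rightarrow> real" where
  "majorant_kernel s x u = (\<Sum>i\<le>s. 2 ^ i / 2 ^ s * ridge_kernel s i x u)"

definition majorant_op :: "(real \<Rightarrow> ennreal) \<Rightarrow> real \<Rightarrow> ennreal" where
  "majorant_op g x = (SUP s. \<integral>\<^sup>+ u. g u * ennreal (majorant_kernel s x u) \<partial>mu)"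

lemma one_plus_rad_mult_cases:
  "rad l x = rad l u \<and> 1 + rad l x * rad l u = 2 \<or> rad l x = - rad l u \<and> 1 + rad l x * rad l u = 0"
  using rad_cases[of l x] rad_cases[of l u] by auto

lemma ridge_kernel_nonneg: "0 \<le> ridge_kernel s i x u"
  unfolding ridge_kernel_def
  by (intro prod_nonneg) (metis one_plus_rad_mult_cases order_refl zero_le_numeral)

lemma ridge_kernel_commute: "ridge_kernel s i x u = ridge_kernel s i u x"
  unfolding ridge_kernel_def by (simp add: mult.commute)

lemma ridge_kernel_nonzeroD:
  assumes "ridge_kernel s i x u \<noteq> 0" "l < s" "l \<noteq> i"
  shows "rad l x = rad l u"
proof (rule ccontr)
  assume "rad l x \<noteq> rad l u"
  then have "1 + rad l x * rad l u = 0" using one_plus_rad_mult_cases[of l x u] by blast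
  then have "ridge_kernel s i x u = 0"
    unfolding ridge_kernel_def using assms(2,3) by (intro prod_zero) auto
  then show False using assms(1) by simp
qed

lemma ridge_kernel_cong:
  assumes "\<And>l. l < s \<Longrightarrow> l \<noteq> i \<Longrightarrow> rad l x = rad l y"
  shows "ridge_kernel s i x u = ridge_kernel s i y u"
  unfolding ridge_kernel_def using assms by (intro prod.cong) auto

lemma ridge_kernel_self: "ridge_kernel s s x u = (\<Prod>l<s. 1 + rad l x * rad l u)"
  unfolding ridge_kernel_def by (rule prod.cong) auto

lemma ridge_kernel_split:
  assumes "i < s"
  shows "ridge_kernel s s x u = (1 + rad i x * rad i u) * ridge_kernel s i x u"
  unfolding ridge_kernel_self unfolding ridge_kernel_def
  using assms by (intro prod.remove) auto

lemma measurable_ridge_kernel [measurable]: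
  assumes [measurable]: "f \<in> borel_measurable N" "g \<in> borel_measurable N"
  shows "(\<lambda>z. ridge_kernel s i (f z) (g z)) \<in> borel_measurable N"
  unfolding ridge_kernel_def by measurable

lemma measurable_majorant_kernel [measurable]:
  assumes [measurable]: "f \<in> borel_measurable N" "g \<in> borel_measurable N"
  shows "(\<lambda>z. majorant_kernel s (f z) (g z)) \<in> borel_measurable N"
  unfolding majorant_kernel_def by measurable

lemma measurable_ident_mu [measurable]: "(\<lambda>x. x) \<in> borel_measurable mu"
  by (rule measurable_mu) simp

lemma nn_integral_ridge_kernel: "(\<integral>\<^sup>+ u. ridge_kernel s i x u \<partial>mu) = 1"
proof -
  define \<beta> where "\<beta> l = (if l = i then 0 else rad l x)" for l
  have eq: "ridge_kernel s i x u = (\<Prod>l<s. 1 + \<beta> l * rad l u)" for u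
    unfolding ridge_kernel_def \<beta>_def by (rule prod.mono_neutral_cong_left) auto
  have "(\<integral>\<^sup>+ u. ridge_kernel s i x u \<partial>mu) = ennreal (LINT u|mu. ridge_kernel s i x u)"
  proof (rule nn_integral_eq_integral)
    show "integrable mu (ridge_kernel s i x)"
      unfolding eq[abs_def] by (rule integrable_prod_rad)
  qed (simp add: ridge_kernel_nonneg)
  also have "(LINT u|mu. ridge_kernel s i x u) = 1"
    unfolding eq integral_prod_rad[of "\<lambda>_. 1"] by simp
  finally show ?thesis by simp
qed

lemma nn_integral_ridge_kernel': "(\<integral>\<^sup>+ x. ridge_kernel s i x u \<partial>mu) = 1"
  by (subst ridge_kernel_commute) (rule nn_integral_ridge_kernel)

lemma sum_powers_ratio: "(\<Sum>i<s. 2 ^ i / 2 ^ s :: real) \<le> 1"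
proof -
  have "(\<Sum>i<s. 2 ^ i :: real) = 2 ^ s - 1" by (induction s) auto
  then show ?thesis unfolding sum_divide_distrib[symmetric] by simp
qed

lemma sum_powers_ratio': "(\<Sum>i\<le>s. 2 ^ i / 2 ^ s :: real) \<le> 2"
proof -
  have "(\<Sum>i\<le>s. 2 ^ i / 2 ^ s :: real) = (\<Sum>i<s. 2 ^ i / 2 ^ s) + 1"
    by (simp flip: lessThan_Suc_atMost)
  then show ?thesis using sum_powers_ratio[of s] by simp
qed

lemma ennreal_majorant_kernel:
  "ennreal (majorant_kernel s x u) = (\<Sum>i\<le>s. ennreal (2 ^ i / 2 ^ s) * ridge_kernel s i x u)"
proof -
  have "ennreal (2 ^ i / 2 ^ s * ridge_kernel s i x u) = ennreal (2 ^ i / 2 ^ s) * ridge_kernel s i x u" for i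
    by (rule ennreal_mult) (simp_all add: ridge_kernel_nonneg)
  moreover have "ennreal (majorant_kernel s x u) = (\<Sum>i\<le>s. ennreal (2 ^ i / 2 ^ s * ridge_kernel s i x u))"
    unfolding majorant_kernel_def by (rule sum_ennreal[symmetric]) (simp add: ridge_kernel_nonneg)
  ultimately show ?thesis by simp
qed

lemma nn_integral_majorant_kernel:
  assumes [measurable]: "g \<in> borel_measurable mu"
  shows "(\<integral>\<^sup>+ u. g u * ennreal (majorant_kernel s x u) \<partial>mu)
    = (\<Sum>i\<le>s. ennreal (2 ^ i / 2 ^ s) * (\<integral>\<^sup>+ u. g u * ridge_kernel s i x u \<partial>mu))"
proof -
  have "(\<integral>\<^sup>+ u. g u * ennreal (majorant_kernel s x u) \<partial>mu)
      = (\<integral>\<^sup>+ u. (\<Sum>i\<le>s. ennreal (2 ^ i / 2 ^ s) * (g u * ridge_kernel s i x u)) \<partial>mu)"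
    unfolding ennreal_majorant_kernel by (simp add: sum_distrib_left ac_simps)
  also have "\<dots> = (\<Sum>i\<le>s. ennreal (2 ^ i / 2 ^ s) * (\<integral>\<^sup>+ u. g u * ridge_kernel s i x u \<partial>mu))"
    by (simp add: nn_integral_sum nn_integral_cmult)
  finally show ?thesis .
qed

lemma measurable_majorant_op:
  assumes [measurable]: "case_prod g \<in> borel_measurable (N \<Otimes>\<^sub>M mu)" "h \<in> borel_measurable N"
  shows "(\<lambda>z. majorant_op (g z) (h z)) \<in> borel_measurable N"
  unfolding majorant_op_def by measurable

lemma majorant_op_le_const:
  assumes "\<And>u. g u \<le> ennreal c"
  shows "majorant_op g x \<le> ennreal (2 * c)"
  unfolding majorant_op_def
proof (rule SUP_least)
  fix s
  have "(\<integral>\<^sup>+ u. g u * ennreal (majorant_kernel s x u) \<partial>mu)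
      \<le> (\<integral>\<^sup>+ u. ennreal c * ennreal (majorant_kernel s x u) \<partial>mu)"
    by (intro nn_integral_mono mult_right_mono assms) simp
  also have "\<dots> = (\<Sum>i\<le>s. ennreal (2 ^ i / 2 ^ s) * (\<integral>\<^sup>+ u. ennreal c * ridge_kernel s i x u \<partial>mu))"
    by (rule nn_integral_majorant_kernel) simp
  also have "\<dots> = (\<Sum>i\<le>s. ennreal (2 ^ i / 2 ^ s) * ennreal c)"
    by (simp add: nn_integral_cmult nn_integral_ridge_kernel)
  also have "\<dots> = ennreal (\<Sum>i\<le>s. 2 ^ i / 2 ^ s) * ennreal c"
    unfolding sum_distrib_right[symmetric] by (simp flip: sum_ennreal)
  also have "\<dots> \<le> ennreal 2 * ennreal c"
    by (intro mult_right_mono ennreal_leI sum_powers_ratio') simp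
  finally show "(\<integral>\<^sup>+ u. g u * ennreal (majorant_kernel s x u) \<partial>mu) \<le> ennreal (2 * c)"
    by (simp add: ennreal_mult')
qed

lemma majorant_op_add_le:
  assumes [measurable]: "g \<in> borel_measurable mu" "h \<in> borel_measurable mu"
  shows "majorant_op (\<lambda>u. g u + h u) x \<le> majorant_op g x + majorant_op h x"
  unfolding majorant_op_def
proof (rule SUP_least)
  fix s
  have "(\<integral>\<^sup>+ u. (g u + h u) * ennreal (majorant_kernel s x u) \<partial>mu)
     = (\<integral>\<^sup>+ u. g u * ennreal (majorant_kernel s x u) \<partial>mu) + (\<integral>\<^sup>+ u. h u * ennreal (majorant_kernel s x u) \<partial>mu)"
    by (simp add: distrib_right nn_integral_add)
  also have "\<dots> \<le> (SUP s. \<integral>\<^sup>+ u. g u * ennreal (majorant_kernel s x u) \<partial>mu)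
    + (SUP s. \<integral>\<^sup>+ u. h u * ennreal (majorant_kernel s x u) \<partial>mu)"
    by (intro add_mono SUP_upper) simp_all
  finally show "(\<integral>\<^sup>+ u. (g u + h u) * ennreal (majorant_kernel s x u) \<partial>mu) \<le> \<dots>" .
qed

lemma majorant_op_mono: "(\<And>u. g u \<le> h u) \<Longrightarrow> majorant_op g x \<le> majorant_op h x"
  unfolding majorant_op_def by (intro SUP_mono' nn_integral_mono mult_right_mono) auto

section \<open>The weak type estimate\<close>

text \<open>\<open>P\<close> holds exactly below its first failure \<open>m\<close>. The inner sum
  vanishes for \<open>s < m\<close> and is at most \<open>2^m / 2^s\<close> afterwards, and these
  bounds add up to 2.\<close>

lemma suminf_stopping_le:
  assumes anti: "\<And>i s. i \<le> s \<Longrightarrow> P s \<Longrightarrow> P i"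
  shows "(\<Sum>s. \<Sum>i<s. ennreal (2 ^ i / 2 ^ s) * (if P i \<and> \<not> P s then 1 else 0)) \<le> 2"
proof (cases "\<forall>s. P s")
  case True
  then show ?thesis by simp
next
  case False
  define m where "m = (LEAST s. \<not> P s)"
  have m: "\<not> P m" unfolding m_def using False by (metis LeastI_ex)
  have P: "P i \<longleftrightarrow> i < m" for i
    using m anti not_less_Least[of i "\<lambda>s. \<not> P s"] unfolding m_def by (metis not_le)
  define a where "a s = (if s < m then 0 else 2 ^ m / 2 ^ s :: real)" for s
  have a0: "0 \<le> a s" for s unfolding a_def by simp
  have le: "(\<Sum>i<s. ennreal (2 ^ i / 2 ^ s) * (if P i \<and> \<not> P s then 1 else 0)) \<le> ennreal (a s)" for s
  proof (cases "s < m")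
    case True
    then show ?thesis by (simp add: P)
  next
    case False
    have "(\<Sum>i<s. ennreal (2 ^ i / 2 ^ s) * (if P i \<and> \<not> P s then 1 else 0))
        = (\<Sum>i<m. ennreal (2 ^ i / 2 ^ s))"
      using False by (intro sum.mono_neutral_cong_right) (auto simp: P)
    also have "\<dots> = ennreal ((\<Sum>i<m. 2 ^ i) / 2 ^ s)"
      by (simp add: sum_divide_distrib)
    also have "(\<Sum>i<m. 2 ^ i :: real) = 2 ^ m - 1" by (induction m) auto
    also have "ennreal ((2 ^ m - 1) / 2 ^ s) \<le> ennreal (a s)"
      using False unfolding a_def by (intro ennreal_leI) (simp add: divide_right_mono)
    finally show ?thesis .
  qed
  have part: "(\<Sum>s<n. a s) = (if n \<le> m then 0 else 2 - 2 * 2 ^ m / 2 ^ n)" for n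
  proof (induction n)
    case (Suc n)
    then show ?case by (cases "n < m"; cases "n = m") (auto simp: a_def field_simps)
  qed simp
  have "(\<Sum>s. \<Sum>i<s. ennreal (2 ^ i / 2 ^ s) * (if P i \<and> \<not> P s then 1 else 0)) \<le> (\<Sum>s. ennreal (a s))"
    by (intro suminf_le le) auto
  also have "\<dots> \<le> ennreal 2"
  proof (rule suminf_le_const)
    fix n
    have "(\<Sum>s<n. ennreal (a s)) = ennreal (\<Sum>s<n. a s)" using a0 by simp
    also have "\<dots> \<le> ennreal 2" unfolding part by (intro ennreal_leI) simp
    finally show "(\<Sum>s<n. ennreal (a s)) \<le> ennreal 2" .
  qed simp
  finally show ?thesis by simp
qed

section \<open>Stopping times at a fixed level\<close>

locale stopping =
  fixes g :: "real \<Rightarrow> ennreal" and y :: real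
  assumes g [measurable]: "g \<in> borel_measurable mu" and y: "0 < y"
begin

text \<open>The dyadic martingale of \<open>g\<close>: the mean of \<open>g\<close> over the dyadic
  interval of length \<open>2^-s\<close> around \<open>x\<close>.\<close>

definition avg :: "nat \<Rightarrow> real \<Rightarrow> ennreal" where
  "avg s x = (\<integral>\<^sup>+ u. g u * ridge_kernel s s x u \<partial>mu)"

definition low :: "nat \<Rightarrow> real \<Rightarrow> bool" where
  "low s x \<longleftrightarrow> (\<forall>r\<le>s. avg r x \<le> ennreal y)"

text \<open>If all averages at \<open>x\<close> are at most \<open>y\<close>, then the ridge kernel with index \<open>i < s\<close> meets a point \<open>u\<close>
  with \<open>\<not> low s u\<close> only if \<open>low i u\<close>, because \<open>x\<close> and \<open>u\<close> share the digits below \<open>i\<close>. The factors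
  \<open>2\<^sup>i / 2\<^sup>s\<close> are summable over all \<open>i\<close> below and \<open>s\<close> above the stopping time of \<open>u\<close>.\<close>

definition excess :: "real \<Rightarrow> ennreal" where
  "excess x = (\<Sum>s. \<Sum>i<s. ennreal (2 ^ i / 2 ^ s) *
     (\<integral>\<^sup>+ u. g u * (if low i u \<and> \<not> low s u then 1 else 0) * ridge_kernel s i x u \<partial>mu))"

lemma avg_cong: "(\<And>l. l < s \<Longrightarrow> rad l x = rad l z) \<Longrightarrow> avg s x = avg s z"
  unfolding avg_def using ridge_kernel_cong[of s s x z] by auto

lemma low_cong: "(\<And>l. l < s \<Longrightarrow> rad l x = rad l z) \<Longrightarrow> low s x \<longleftrightarrow> low s z"
  unfolding low_def using avg_cong[of _ x z] by (metis order_less_le_trans)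

lemma measurable_avg [measurable]: "avg s \<in> borel_measurable mu"
  unfolding avg_def[abs_def] by measurable

lemma measurable_low [measurable]: "Measurable.pred mu (low s)"
  unfolding low_def[abs_def] by measurable

lemma measurable_excess [measurable]: "excess \<in> borel_measurable mu"
  unfolding excess_def[abs_def] by measurable

text \<open>Integrating first in \<open>x\<close> removes the ridge kernels, which have integral 1
  in either variable; the double sum is then bounded pointwise in \<open>u\<close> by the stopping
  time estimate.\<close>

lemma nn_integral_excess_le: "(\<integral>\<^sup>+ x. excess x \<partial>mu) \<le> 2 * (\<integral>\<^sup>+ u. g u \<partial>mu)"
proof -
  interpret pair_sigma_finite mu mu ..
  let ?w = "\<lambda>s i u. if low i u \<and> \<not> low s u then 1 else 0 :: ennreal"
  have inner: "(\<integral>\<^sup>+ x. (\<integral>\<^sup>+ u. g u * ?w s i u * ridge_kernel s i x u \<partial>mu) \<partial>mu)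
      = (\<integral>\<^sup>+ u. g u * ?w s i u \<partial>mu)" for s i
    by (subst Fubini') (simp_all add: nn_integral_cmult nn_integral_ridge_kernel' split_beta')
  have "(\<integral>\<^sup>+ x. excess x \<partial>mu)
      = (\<Sum>s. \<Sum>i<s. ennreal (2 ^ i / 2 ^ s) * (\<integral>\<^sup>+ u. g u * ?w s i u \<partial>mu))"
    unfolding excess_def
    by (simp add: nn_integral_suminf nn_integral_sum nn_integral_cmult inner)
  also have "\<dots> = (\<integral>\<^sup>+ u. (\<Sum>s. \<Sum>i<s. ennreal (2 ^ i / 2 ^ s) * (g u * ?w s i u)) \<partial>mu)"
    by (simp add: nn_integral_suminf nn_integral_sum nn_integral_cmult)
  also have "\<dots> = (\<integral>\<^sup>+ u. g u * (\<Sum>s. \<Sum>i<s. ennreal (2 ^ i / 2 ^ s) * ?w s i u) \<partial>mu)"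
  proof (rule nn_integral_cong)
    fix u
    have "(\<Sum>i<s. ennreal (2 ^ i / 2 ^ s) * (g u * ?w s i u))
        = g u * (\<Sum>i<s. ennreal (2 ^ i / 2 ^ s) * ?w s i u)" for s
      by (simp only: sum_distrib_left mult.left_commute)
    then show "(\<Sum>s. \<Sum>i<s. ennreal (2 ^ i / 2 ^ s) * (g u * ?w s i u))
        = g u * (\<Sum>s. \<Sum>i<s. ennreal (2 ^ i / 2 ^ s) * ?w s i u)"
      by (simp only: ennreal_suminf_cmult)
  qed
  also have "\<dots> \<le> (\<integral>\<^sup>+ u. g u * 2 \<partial>mu)"
    by (intro nn_integral_mono mult_left_mono suminf_stopping_le) (auto simp: low_def)
  also have "\<dots> = 2 * (\<integral>\<^sup>+ u. g u \<partial>mu)"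
    by (simp add: nn_integral_multc mult.commute)
  finally show ?thesis .
qed

text \<open>A ridge kernel is the mean of the plain kernels of the interval of \<open>x\<close> and
  of its mate. If the mate contains a point \<open>z\<close> with \<open>low s z\<close>, the
  average there is at most \<open>y\<close>. If not, the mate contributes nothing to the restricted
  integral, and \<open>z = x\<close> serves.\<close>

lemma nn_integral_low_ridge_le:
  assumes x: "avg s x \<le> ennreal y" and i: "i < s"
  shows "(\<integral>\<^sup>+ u. g u * (if low s u then 1 else 0) * ridge_kernel s i x u \<partial>mu) \<le> ennreal y"
proof -
  obtain z where z: "avg s z \<le> ennreal y"
    and le: "\<And>u. low s u \<Longrightarrow> 2 * ridge_kernel s i x u \<le> ridge_kernel s s x u + ridge_kernel s s z u"
  proof (cases "\<exists>z. low s z \<and> ridge_kernel s i x z \<noteq> 0 \<and> rad i z \<noteq> rad i x")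
    case True
    then obtain z where z: "low s z" "ridge_kernel s i x z \<noteq> 0" "rad i z \<noteq> rad i x" by blast
    have "ridge_kernel s i z u = ridge_kernel s i x u" for u
      by (rule ridge_kernel_cong) (use ridge_kernel_nonzeroD[OF z(2)] in auto)
    moreover have "rad i z = - rad i x" using z(3) rad_cases[of i z] rad_cases[of i x] by auto
    ultimately have "2 * ridge_kernel s i x u = ridge_kernel s s x u + ridge_kernel s s z u" for u
      unfolding ridge_kernel_split[OF i] by (simp add: algebra_simps)
    then show ?thesis using z(1) that[of z] unfolding low_def by simp
  next
    case False
    have "2 * ridge_kernel s i x u \<le> ridge_kernel s s x u + ridge_kernel s s x u" if "low s u" for u
    proof (cases "ridge_kernel s i x u = 0")
      case True
      then show ?thesis using ridge_kernel_nonneg[of s s x u] by simp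
    next
      case nz: False
      then have "rad i u = rad i x" using False that by blast
      then have "ridge_kernel s s x u = 2 * ridge_kernel s i x u"
        unfolding ridge_kernel_split[OF i] by simp
      then show ?thesis using ridge_kernel_nonneg[of s s x u] by simp
    qed
    then show ?thesis using x that[of x] by blast
  qed
  have "2 * (\<integral>\<^sup>+ u. g u * (if low s u then 1 else 0) * ridge_kernel s i x u \<partial>mu)
      = (\<integral>\<^sup>+ u. 2 * (g u * (if low s u then 1 else 0) * ridge_kernel s i x u) \<partial>mu)"
    by (simp add: nn_integral_cmult)
  also have "\<dots> \<le> (\<integral>\<^sup>+ u. g u * ridge_kernel s s x u + g u * ridge_kernel s s z u \<partial>mu)"
  proof (rule nn_integral_mono)
    fix u
    show "2 * (g u * (if low s u then 1 else 0) * ridge_kernel s i x u)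
        \<le> g u * ridge_kernel s s x u + g u * ridge_kernel s s z u"
    proof (cases "low s u")
      case True
      have "2 * ennreal (ridge_kernel s i x u) = ennreal (2 * ridge_kernel s i x u)"
        by (simp add: ennreal_mult')
      also have "\<dots> \<le> ennreal (ridge_kernel s s x u) + ennreal (ridge_kernel s s z u)"
        using le[OF True] by (simp add: ridge_kernel_nonneg ennreal_leI flip: ennreal_plus)
      finally have "g u * (2 * ennreal (ridge_kernel s i x u))
          \<le> g u * (ennreal (ridge_kernel s s x u) + ennreal (ridge_kernel s s z u))"
        by (rule mult_left_mono) simp
      then show ?thesis using True by (simp add: distrib_left mult.left_commute)
    qed simp
  qed
  also have "\<dots> = avg s x + avg s z"
    unfolding avg_def by (simp add: nn_integral_add)
  also have "\<dots> \<le> ennreal y + ennreal y" by (intro add_mono x z)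
  also have "\<dots> = 2 * ennreal y" by (simp add: mult_2)
  finally show ?thesis by (simp add: ennreal_mult_le_mult_iff)
qed

text \<open>One \<open>y\<close> comes from the ridges with \<open>i < s\<close>, whose weights sum
  to at most 1, the other from the plain average \<open>i = s\<close>. The parts of the ridges where
  \<open>low s\<close> fails go into \<open>excess\<close>.\<close>

lemma majorant_op_le:
  assumes x: "\<And>r. avg r x \<le> ennreal y"
  shows "majorant_op g x \<le> ennreal (2 * y) + excess x"
  unfolding majorant_op_def
proof (rule SUP_least)
  fix s
  let ?I = "\<lambda>i. \<integral>\<^sup>+ u. g u * (if low i u \<and> \<not> low s u then 1 else 0) * ridge_kernel s i x u \<partial>mu"
  let ?c = "\<lambda>i. ennreal (2 ^ i / 2 ^ s)"
  have lowx: "low r x" for r using x unfolding low_def by blast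
  have le: "(\<integral>\<^sup>+ u. g u * ridge_kernel s i x u \<partial>mu) \<le> ennreal y + ?I i" if "i < s" for i
  proof -
    have "(\<integral>\<^sup>+ u. g u * ridge_kernel s i x u \<partial>mu)
        \<le> (\<integral>\<^sup>+ u. g u * (if low s u then 1 else 0) * ridge_kernel s i x u
            + g u * (if low i u \<and> \<not> low s u then 1 else 0) * ridge_kernel s i x u \<partial>mu)"
    proof (rule nn_integral_mono)
      fix u
      have "low i u" if "ridge_kernel s i x u \<noteq> 0"
        using low_cong[of i x u] lowx ridge_kernel_nonzeroD[OF that] \<open>i < s\<close> by auto
      then show "g u * ridge_kernel s i x u \<le> g u * (if low s u then 1 else 0) * ridge_kernel s i x u
            + g u * (if low i u \<and> \<not> low s u then 1 else 0) * ridge_kernel s i x u"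
        by (cases "ridge_kernel s i x u = 0") auto
    qed
    also have "\<dots> = (\<integral>\<^sup>+ u. g u * (if low s u then 1 else 0) * ridge_kernel s i x u \<partial>mu) + ?I i"
      by (rule nn_integral_add) measurable
    also have "\<dots> \<le> ennreal y + ?I i"
      by (intro add_right_mono nn_integral_low_ridge_le x that)
    finally show ?thesis .
  qed
  have "(\<integral>\<^sup>+ u. g u * ennreal (majorant_kernel s x u) \<partial>mu)
      = (\<Sum>i<s. ?c i * (\<integral>\<^sup>+ u. g u * ridge_kernel s i x u \<partial>mu)) + avg s x"
    unfolding nn_integral_majorant_kernel[OF g] avg_def by (simp flip: lessThan_Suc_atMost)
  also have "\<dots> \<le> (\<Sum>i<s. ?c i * (ennreal y + ?I i)) + ennreal y"
    by (intro add_mono sum_mono mult_left_mono le x) auto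
  also have "\<dots> = ennreal (\<Sum>i<s. 2 ^ i / 2 ^ s) * ennreal y + (\<Sum>i<s. ?c i * ?I i) + ennreal y"
    by (simp add: distrib_left sum.distrib sum_distrib_right flip: sum_ennreal)
  also have "\<dots> \<le> ennreal 1 * ennreal y + excess x + ennreal y"
  proof (intro add_mono mult_right_mono ennreal_leI sum_powers_ratio)
    show "(\<Sum>i<s. ?c i * ?I i) \<le> excess x"
      unfolding excess_def
      using sum_le_suminf[of "\<lambda>s. \<Sum>i<s. ennreal (2 ^ i / 2 ^ s) *
        (\<integral>\<^sup>+ u. g u * (if low i u \<and> \<not> low s u then 1 else 0) * ridge_kernel s i x u \<partial>mu)" "{s}"]
      by simp
  qed simp_all
  also have "\<dots> = ennreal (2 * y) + excess x"
    using y by (simp add: ac_simps mult_2 flip: ennreal_plus)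
  finally show "(\<integral>\<^sup>+ u. g u * ennreal (majorant_kernel s x u) \<partial>mu) \<le> ennreal (2 * y) + excess x" .
qed

text \<open>Doob's maximal inequality. The set is split by the first time \<open>r\<close> at which
  the average exceeds \<open>y\<close>; each piece \<open>B r\<close> depends only on the first
  \<open>r\<close> digits, so its indicator passes through the kernel from \<open>x\<close> to
  \<open>u\<close>.\<close>

lemma emeasure_high_le:
  "ennreal y * emeasure mu {x \<in> space mu. \<exists>r. \<not> avg r x \<le> ennreal y} \<le> (\<integral>\<^sup>+ u. g u \<partial>mu)"
proof -
  interpret pair_sigma_finite mu mu ..
  define B where "B r = {x \<in> space mu. \<not> avg r x \<le> ennreal y \<and> (\<forall>q<r. avg q x \<le> ennreal y)}" for r
  have B [measurable]: "B r \<in> sets mu" for r unfolding B_def by measurable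
  have disj: "disjoint_family B"
    unfolding disjoint_family_on_def B_def by (auto dest: linorder_neqE_nat)
  have un: "{x \<in> space mu. \<exists>r. \<not> avg r x \<le> ennreal y} = (\<Union>r. B r)"
  proof (intro equalityI subsetI)
    fix x assume "x \<in> {x \<in> space mu. \<exists>r. \<not> avg r x \<le> ennreal y}"
    then have "x \<in> space mu" "\<exists>r. \<not> avg r x \<le> ennreal y" by auto
    from exists_least_iff[THEN iffD1, OF this(2)] this(1) show "x \<in> (\<Union>r. B r)"
      unfolding B_def by auto
  qed (auto simp: B_def)
  have step: "ennreal y * emeasure mu (B r) \<le> (\<integral>\<^sup>+ u. g u * indicator (B r) u \<partial>mu)" for r
  proof -
    have "ennreal y * emeasure mu (B r) = (\<integral>\<^sup>+ x. ennreal y * indicator (B r) x \<partial>mu)"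
      by (simp add: nn_integral_cmult_indicator)
    also have "\<dots> \<le> (\<integral>\<^sup>+ x. avg r x * indicator (B r) x \<partial>mu)"
      by (intro nn_integral_mono) (auto simp: B_def indicator_def)
    also have "\<dots> = (\<integral>\<^sup>+ x. (\<integral>\<^sup>+ u. g u * ridge_kernel r r x u * indicator (B r) x \<partial>mu) \<partial>mu)"
      unfolding avg_def by (simp add: nn_integral_multc)
    also have "\<dots> = (\<integral>\<^sup>+ x. (\<integral>\<^sup>+ u. g u * indicator (B r) u * ridge_kernel r r x u \<partial>mu) \<partial>mu)"
    proof (intro nn_integral_cong)
      fix x u assume xu: "x \<in> space mu" "u \<in> space mu"
      have "x \<in> B r \<longleftrightarrow> u \<in> B r" if "ridge_kernel r r x u \<noteq> 0"
      proof -
        have "avg q x = avg q u" if "q \<le> r" for q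
          using ridge_kernel_nonzeroD[OF \<open>ridge_kernel r r x u \<noteq> 0\<close>] that by (intro avg_cong) auto
        then show ?thesis using xu unfolding B_def by auto
      qed
      then show "g u * ridge_kernel r r x u * indicator (B r) x
          = g u * indicator (B r) u * ridge_kernel r r x u"
        by (cases "ridge_kernel r r x u = 0") (auto simp: indicator_def)
    qed
    also have "\<dots> = (\<integral>\<^sup>+ u. g u * indicator (B r) u \<partial>mu)"
      by (subst Fubini') (simp_all add: nn_integral_cmult nn_integral_ridge_kernel' split_beta')
    finally show ?thesis .
  qed
  have "ennreal y * emeasure mu (\<Union>r. B r) = (\<Sum>r. ennreal y * emeasure mu (B r))"
    using suminf_emeasure[OF _ disj, of mu] B by (simp add: image_subset_iff)
  also have "\<dots> \<le> (\<Sum>r. \<integral>\<^sup>+ u. g u * indicator (B r) u \<partial>mu)"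
    by (intro suminf_le step) auto
  also have "\<dots> = (\<integral>\<^sup>+ u. g u * (\<Sum>r. indicator (B r) u) \<partial>mu)"
    by (simp add: nn_integral_suminf[symmetric])
  also have "\<dots> \<le> (\<integral>\<^sup>+ u. g u * 1 \<partial>mu)"
    unfolding suminf_indicator[OF disj]
    by (intro nn_integral_mono mult_left_mono) (auto simp: indicator_def)
  finally show ?thesis unfolding un by simp
qed

lemma emeasure_majorant_op_le:
  "ennreal y * emeasure mu {x \<in> space mu. ennreal (3 * y) < majorant_op g x} \<le> 3 * (\<integral>\<^sup>+ u. g u \<partial>mu)"
proof -
  let ?B = "{x \<in> space mu. \<exists>r. \<not> avg r x \<le> ennreal y}"
  let ?E = "{x \<in> space mu. ennreal y \<le> excess x}"
  have "{x \<in> space mu. ennreal (3 * y) < majorant_op g x} \<subseteq> ?B \<union> ?E"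
  proof
    fix x assume x: "x \<in> {x \<in> space mu. ennreal (3 * y) < majorant_op g x}"
    show "x \<in> ?B \<union> ?E"
    proof (rule ccontr)
      assume "x \<notin> ?B \<union> ?E"
      then have *: "\<And>r. avg r x \<le> ennreal y" "excess x \<le> ennreal y" using x by auto
      have "majorant_op g x \<le> ennreal (2 * y) + ennreal y"
        using majorant_op_le[OF *(1)] *(2) by (meson add_left_mono order_trans)
      also have "\<dots> = ennreal (3 * y)" using y by (simp flip: ennreal_plus)
      finally show False using x leD by blast
    qed
  qed
  then have "emeasure mu {x \<in> space mu. ennreal (3 * y) < majorant_op g x} \<le> emeasure mu (?B \<union> ?E)"
    by (intro emeasure_mono) measurable
  also have "\<dots> \<le> emeasure mu ?B + emeasure mu ?E"
    by (intro emeasure_subadditive) measurable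
  finally have "ennreal y * emeasure mu {x \<in> space mu. ennreal (3 * y) < majorant_op g x}
      \<le> ennreal y * emeasure mu ?B + ennreal y * emeasure mu ?E"
    unfolding distrib_left[symmetric] by (intro mult_left_mono) simp_all
  also have "ennreal y * emeasure mu ?E \<le> (\<integral>\<^sup>+ x. excess x \<partial>mu)"
  proof -
    have "ennreal y * emeasure mu ?E = (\<integral>\<^sup>+ x. ennreal y * indicator ?E x \<partial>mu)"
      by (intro nn_integral_cmult_indicator[symmetric]) measurable
    also have "\<dots> \<le> (\<integral>\<^sup>+ x. excess x \<partial>mu)"
      by (intro nn_integral_mono) (auto simp: indicator_def)
    finally show ?thesis .
  qed
  also note nn_integral_excess_le
  also note emeasure_high_le
  finally have "ennreal y * emeasure mu {x \<in> space mu. ennreal (3 * y) < majorant_op g x}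
      \<le> (\<integral>\<^sup>+ u. g u \<partial>mu) + 2 * (\<integral>\<^sup>+ u. g u \<partial>mu)"
    by (simp add: add_mono)
  also have "\<dots> = 3 * (\<integral>\<^sup>+ u. g u \<partial>mu)"
    using distrib_right[of 1 2 "\<integral>\<^sup>+ u. g u \<partial>mu"] by simp
  finally show ?thesis .
qed

end

lemma emeasure_majorant_op_le:
  assumes "g \<in> borel_measurable mu" "0 < y"
  shows "ennreal y * emeasure mu {x \<in> space mu. ennreal (3 * y) < majorant_op g x} \<le> 3 * (\<integral>\<^sup>+ u. g u \<partial>mu)"
proof -
  interpret stopping g y using assms by unfold_locales
  show ?thesis by (rule emeasure_majorant_op_le)
qed

section \<open>The estimate on \<open>L ln L\<close>\<close>

text \<open>Since \<open>c * 2^k\<close> is \<open>c\<close> plus the sum of all earlier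
  \<open>c * 2^j\<close>, the layers lying below \<open>v\<close> already reach \<open>v\<close>.
  Truncating at \<open>c * 2^k\<close> first covers infinite values too.\<close>

lemma le_dyadic_layers:
  fixes v :: ennreal and c :: real
  assumes "0 < c"
  shows "v \<le> ennreal c + (\<Sum>k. ennreal (c * 2 ^ k) * (if ennreal (c * 2 ^ k) < v then 1 else 0))"
    (is "v \<le> _ + ?S")
proof -
  let ?f = "\<lambda>k. ennreal (c * 2 ^ k) * (if ennreal (c * 2 ^ k) < v then 1 else 0)"
  have part: "min v (ennreal (c * 2 ^ k)) \<le> ennreal c + (\<Sum>j<k. ?f j)" for k
  proof (induction k)
    case (Suc k)
    show ?case
    proof (cases "ennreal (c * 2 ^ k) < v")
      case True
      have le: "ennreal (c * 2 ^ k) \<le> ennreal c + (\<Sum>j<k. ?f j)"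
        using Suc unfolding min_absorb2[OF less_imp_le[OF True]] .
      have "ennreal (c * 2 ^ Suc k) = ennreal (c * 2 ^ k) + ennreal (c * 2 ^ k)"
        using assms by (simp flip: ennreal_plus)
      also have "\<dots> \<le> (ennreal c + (\<Sum>j<k. ?f j)) + ?f k"
        using True by (intro add_mono le) simp
      finally show ?thesis by (simp add: add.assoc min.coboundedI2)
    next
      case False
      then have "v \<le> ennreal (c * 2 ^ k)" by simp
      moreover have "ennreal (c * 2 ^ k) \<le> ennreal (c * 2 ^ Suc k)"
        using assms by (intro ennreal_leI) simp
      ultimately show ?thesis using Suc False by (simp add: min_absorb1 order_trans)
    qed
  qed simp
  have le: "min v (ennreal (c * 2 ^ k)) \<le> ennreal c + ?S" for k
    by (rule order_trans[OF part]) (intro add_left_mono sum_le_suminf; simp)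
  show ?thesis
  proof (cases v)
    case (real r)
    obtain k :: nat where "r / c < 2 ^ k" using real_arch_pow[of 2 "r / c"] by auto
    then have "r \<le> c * 2 ^ k" using assms by (simp add: field_simps)
    then have "v \<le> ennreal (c * 2 ^ k)" unfolding real by (rule ennreal_leI)
    then show ?thesis using le[of k] by (simp add: min_absorb1)
  next
    case top
    have "ennreal c + ?S = top"
    proof (rule ccontr)
      assume "ennreal c + ?S \<noteq> top"
      then obtain r where r: "ennreal c + ?S = ennreal r" "0 \<le> r" by (cases "ennreal c + ?S") auto
      obtain k :: nat where "r / c < 2 ^ k" using real_arch_pow[of 2 "r / c"] by auto
      then have "r < c * 2 ^ k" using assms by (simp add: field_simps)
      then have "ennreal r < ennreal (c * 2 ^ k)" using r(2) by (simp add: ennreal_lessI)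
      moreover have "ennreal (c * 2 ^ k) \<le> ennreal r" using le[of k, unfolded r(1)] by (simp add: top)
      ultimately show False by simp
    qed
    then show ?thesis by simp
  qed
qed

lemma sum_dyadic_below_le:
  fixes a :: real
  assumes "1 < a"
  shows "(\<Sum>k<n. if 2 ^ k < a then 1 else 0 :: real) \<le> 1 + log 2 a"
proof (induction n)
  case 0
  then show ?case using assms by simp
next
  case (Suc n)
  show ?case
  proof (cases "2 ^ n < a")
    case True
    have "(\<Sum>k<Suc n. if 2 ^ k < a then 1 else 0 :: real) \<le> (\<Sum>k<Suc n. 1)"
      by (intro sum_mono) auto
    also have "\<dots> = 1 + log 2 (2 ^ n)" by simp
    also have "\<dots> \<le> 1 + log 2 a"
      using True assms by (simp add: le_log_iff powr_realpow)
    finally show ?thesis .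
  next
    case False
    then show ?thesis using Suc by simp
  qed
qed

text \<open>Two crude facts suffice: \<open>ln 2\<close> is at least 1/2, and
  \<open>a \<le> 3 + a * ln a\<close>, where the split at 3 is chosen because
  \<open>exp 1 \<le> 3\<close>.\<close>

lemma mult_one_plus_log_le:
  assumes "1 < a"
  shows "a * (1 + log 2 a) \<le> 3 * (1 + a * ln_plus a)"
proof -
  have ln: "ln_plus a = ln a" "0 < ln a" using assms unfolding ln_plus_def by auto
  have "(1::real) / 2 \<le> ln 2" using exp_half_le2 by (subst ln_ge_iff) simp_all
  then have "log 2 a \<le> 2 * ln a"
    using ln(2) unfolding log_def by (simp add: field_simps)
  then have "a * log 2 a \<le> 2 * (a * ln a)" using assms by (simp add: mult_left_mono mult.left_commute)
  moreover have "a \<le> 3 + a * ln a"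
  proof (cases "a \<le> 3")
    case True
    then show ?thesis using ln(2) assms by (simp add: add_increasing2)
  next
    case False
    have "1 \<le> ln a" using False exp_le assms by (subst ln_ge_iff) auto
    then have "a * 1 \<le> a * ln a" using assms by (intro mult_left_mono) auto
    then show ?thesis by simp
  qed
  ultimately show ?thesis unfolding ln by (simp add: distrib_left)
qed

text \<open>At height \<open>5 * 2^k\<close> the function is cut at \<open>2^k\<close>. The lower
  part contributes at most \<open>2 * 2^k\<close>, so the upper part must exceed
  \<open>3 * 2^k\<close>, the level of the weak type inequality. Summing over \<open>k\<close>
  counts \<open>\<bar>h u\<bar>\<close> once for each \<open>2^k\<close> below it, which produces
  the logarithm. The constant is \<open>50 = 5 + 15 * 3\<close>.\<close>

lemma nn_integral_majorant_op_le:
  fixes h :: "real \<Rightarrow> real"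
  assumes [measurable]: "h \<in> borel_measurable mu"
  shows "(\<integral>\<^sup>+ x. majorant_op (\<lambda>u. ennreal \<bar>h u\<bar>) x \<partial>mu)
    \<le> 50 * (1 + (\<integral>\<^sup>+ x. ennreal (\<bar>h x\<bar> * ln_plus \<bar>h x\<bar>) \<partial>mu))"
proof -
  let ?g = "\<lambda>u. ennreal \<bar>h u\<bar>"
  define hi where "hi k u = (if 2 ^ k < \<bar>h u\<bar> then ?g u else 0)" for k :: nat and u
  have [measurable]: "hi k \<in> borel_measurable mu" for k unfolding hi_def[abs_def] by measurable
  have [measurable]: "majorant_op ?g \<in> borel_measurable mu"
    using measurable_majorant_op[of "\<lambda>_. ?g" mu "\<lambda>x. x"] by simp
  have [measurable]: "ln_plus \<in> borel_measurable borel" unfolding ln_plus_def[abs_def] by measurable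
  have layer: "ennreal (5 * 2 ^ k) * emeasure mu {x \<in> space mu. ennreal (5 * 2 ^ k) < majorant_op ?g x}
      \<le> 15 * (\<integral>\<^sup>+ u. hi k u \<partial>mu)" for k
  proof -
    have sub: "{x \<in> space mu. ennreal (5 * 2 ^ k) < majorant_op ?g x}
        \<subseteq> {x \<in> space mu. ennreal (3 * 2 ^ k) < majorant_op (hi k) x}"
    proof (safe, rule ccontr)
      fix x assume x: "ennreal (5 * 2 ^ k) < majorant_op ?g x"
        "\<not> ennreal (3 * 2 ^ k) < majorant_op (hi k) x"
      have "majorant_op ?g x \<le> majorant_op (\<lambda>u. (?g u - hi k u) + hi k u) x"
        by (intro majorant_op_mono) (simp add: hi_def)
      also have "\<dots> \<le> majorant_op (\<lambda>u. ?g u - hi k u) x + majorant_op (hi k) x"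
        by (rule majorant_op_add_le) measurable
      also have "\<dots> \<le> ennreal (2 * 2 ^ k) + ennreal (3 * 2 ^ k)"
        using x(2) by (intro add_mono majorant_op_le_const) (auto simp: hi_def intro!: ennreal_leI)
      also have "\<dots> = ennreal (5 * 2 ^ k)" by (simp flip: ennreal_plus)
      finally show False using x(1) by simp
    qed
    have [measurable]: "majorant_op (hi k) \<in> borel_measurable mu"
      using measurable_majorant_op[of "\<lambda>_. hi k" mu "\<lambda>x. x"] by simp
    have "ennreal (5 * 2 ^ k) * emeasure mu {x \<in> space mu. ennreal (5 * 2 ^ k) < majorant_op ?g x}
        \<le> ennreal (5 * 2 ^ k) * emeasure mu {x \<in> space mu. ennreal (3 * 2 ^ k) < majorant_op (hi k) x}"
    proof (intro mult_left_mono emeasure_mono sub)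
      show "{x \<in> space mu. ennreal (3 * 2 ^ k) < majorant_op (hi k) x} \<in> sets mu" by measurable
    qed simp
    also have "\<dots> = 5 * (ennreal (2 ^ k) * emeasure mu {x \<in> space mu. ennreal (3 * 2 ^ k) < majorant_op (hi k) x})"
      by (simp add: ennreal_mult' mult.assoc)
    also have "\<dots> \<le> 5 * (3 * (\<integral>\<^sup>+ u. hi k u \<partial>mu))"
      by (intro mult_left_mono emeasure_majorant_op_le) simp_all
    also have "\<dots> = 15 * (\<integral>\<^sup>+ u. hi k u \<partial>mu)" by (simp flip: mult.assoc)
    finally show ?thesis .
  qed
  have count: "(\<Sum>k. hi k u) \<le> 3 * (1 + ennreal (\<bar>h u\<bar> * ln_plus \<bar>h u\<bar>))" for u
  proof (cases "1 < \<bar>h u\<bar>")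
    case True
    show ?thesis
    proof (rule suminf_le_const)
      fix n
      have "(\<Sum>k<n. hi k u) = (\<Sum>k<n. ennreal (\<bar>h u\<bar> * (if 2 ^ k < \<bar>h u\<bar> then 1 else 0)))"
        unfolding hi_def by (intro sum.cong) auto
      also have "\<dots> = ennreal (\<bar>h u\<bar> * (\<Sum>k<n. if 2 ^ k < \<bar>h u\<bar> then 1 else 0))"
        by (subst sum_ennreal) (auto simp: sum_distrib_left)
      also have "\<dots> \<le> ennreal (\<bar>h u\<bar> * (1 + log 2 \<bar>h u\<bar>))"
        by (intro ennreal_leI mult_left_mono sum_dyadic_below_le True) simp
      also have "\<dots> \<le> ennreal (3 * (1 + \<bar>h u\<bar> * ln_plus \<bar>h u\<bar>))"
        by (intro ennreal_leI mult_one_plus_log_le True)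
      also have "\<dots> = 3 * (1 + ennreal (\<bar>h u\<bar> * ln_plus \<bar>h u\<bar>))"
        by (simp add: ennreal_mult' ln_plus_def)
      finally show "(\<Sum>k<n. hi k u) \<le> \<dots>" .
    qed simp
  next
    case False
    have "\<not> 2 ^ k < \<bar>h u\<bar>" for k :: nat
      using False one_le_power[of "2::real" k] by linarith
    then show ?thesis unfolding hi_def by simp
  qed
  have "(\<integral>\<^sup>+ x. majorant_op ?g x \<partial>mu) \<le> (\<integral>\<^sup>+ x. ennreal 5
      + (\<Sum>k. ennreal (5 * 2 ^ k) * (if ennreal (5 * 2 ^ k) < majorant_op ?g x then 1 else 0)) \<partial>mu)"
    by (intro nn_integral_mono le_dyadic_layers) simp
  also have "\<dots> = 5 + (\<Sum>k. ennreal (5 * 2 ^ k)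
      * (\<integral>\<^sup>+ x. (if ennreal (5 * 2 ^ k) < majorant_op ?g x then 1 else 0) \<partial>mu))"
    by (simp add: nn_integral_add nn_integral_suminf nn_integral_cmult mu.emeasure_space_1[simplified])
  also have "\<dots> = 5 + (\<Sum>k. ennreal (5 * 2 ^ k)
      * emeasure mu {x \<in> space mu. ennreal (5 * 2 ^ k) < majorant_op ?g x})"
  proof -
    have "(\<integral>\<^sup>+ x. (if ennreal (5 * 2 ^ k) < majorant_op ?g x then 1 else 0) \<partial>mu)
        = (\<integral>\<^sup>+ x. indicator {x \<in> space mu. ennreal (5 * 2 ^ k) < majorant_op ?g x} x \<partial>mu)" for k
      by (intro nn_integral_cong) (auto simp: indicator_def)
    also have "\<dots> k = emeasure mu {x \<in> space mu. ennreal (5 * 2 ^ k) < majorant_op ?g x}" for k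
      by (intro nn_integral_indicator) measurable
    finally show ?thesis by simp
  qed
  also have "\<dots> \<le> 5 + (\<Sum>k. 15 * (\<integral>\<^sup>+ u. hi k u \<partial>mu))"
    by (intro add_left_mono suminf_le layer) auto
  also have "\<dots> = 5 + 15 * (\<integral>\<^sup>+ u. (\<Sum>k. hi k u) \<partial>mu)"
    by (simp add: nn_integral_suminf)
  also have "\<dots> \<le> 5 + 15 * (\<integral>\<^sup>+ u. 3 * (1 + ennreal (\<bar>h u\<bar> * ln_plus \<bar>h u\<bar>)) \<partial>mu)"
    by (intro add_left_mono mult_left_mono nn_integral_mono count) simp
  also have "\<dots> = 5 + 45 * (1 + (\<integral>\<^sup>+ x. ennreal (\<bar>h x\<bar> * ln_plus \<bar>h x\<bar>) \<partial>mu))"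
    by (simp add: nn_integral_add nn_integral_cmult mu.emeasure_space_1[simplified] flip: mult.assoc)
  also have "\<dots> \<le> 5 * (1 + (\<integral>\<^sup>+ x. ennreal (\<bar>h x\<bar> * ln_plus \<bar>h x\<bar>) \<partial>mu))
      + 45 * (1 + (\<integral>\<^sup>+ x. ennreal (\<bar>h x\<bar> * ln_plus \<bar>h x\<bar>) \<partial>mu))"
    by (intro add_right_mono) (simp add: distrib_left)
  also have "\<dots> = 50 * (1 + (\<integral>\<^sup>+ x. ennreal (\<bar>h x\<bar> * ln_plus \<bar>h x\<bar>) \<partial>mu))"
    by (subst distrib_right[symmetric]) simp
  finally show ?thesis .
qed

section \<open>Domination of the matrix transforms\<close>

lemma measurable_dyadic_digit [measurable]: "(\<lambda>x. real (dyadic_digit n x)) \<in> borel_measurable borel"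
proof -
  have "(\<lambda>x. real (dyadic_digit n x)) = (\<lambda>x. (1 - rad n x) / 2)"
  proof
    fix x
    show "real (dyadic_digit n x) = (1 - rad n x) / 2"
      unfolding rad_def using dyadic_digit_less_2[of n x]
      by (cases "dyadic_digit n x = 0") (auto simp: less_2_cases_iff)
  qed
  then show ?thesis by simp
qed

lemma measurable_dyadic_add [measurable]:
  assumes [measurable]: "h \<in> borel_measurable N"
  shows "(\<lambda>u. x \<dotplus> h u) \<in> borel_measurable N"
proof -
  have [measurable]: "(\<lambda>u. real (dyadic_digit n (h u))) \<in> borel_measurable N" for n
    by (rule measurable_compose[OF assms measurable_dyadic_digit])
  show ?thesis unfolding dyadic_add_def by measurable
qed

lemma AE_kernel_majorant_dyadic_add:
  "AE u in mu. kernel_majorant s (x \<dotplus> u) = majorant_kernel s x u"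
  using AE_rad_dyadic_add[of x]
proof eventually_elim
  case (elim u)
  then show ?case
    unfolding kernel_majorant_def majorant_kernel_def walsh_dirichlet_power fejer_sum_power
    by (simp add: ridge_kernel_def ridge_kernel_self sum_divide_distrib flip: lessThan_Suc_atMost)
qed

lemma nn_integral_translated:
  assumes [measurable]: "g \<in> borel_measurable mu" "h \<in> borel_measurable borel"
  shows "(\<integral>\<^sup>+ z. h z \<partial>distr (density mu g) borel (\<lambda>u. x \<dotplus> u)) = (\<integral>\<^sup>+ u. g u * h (x \<dotplus> u) \<partial>mu)"
  by (subst nn_integral_distr) (auto simp: nn_integral_density)

lemma nn_integral_transform_kernel_le_majorant_op:
  assumes g [measurable]: "g \<in> borel_measurable mu"
    and t: "\<And>j. 0 \<le> t j" "\<And>j. t (Suc j) \<le> t j" "\<And>m. m \<le> n \<Longrightarrow> partial_weight t m \<le> 1"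
  shows "(\<integral>\<^sup>+ u. g u * ennreal \<bar>transform_kernel t n (x \<dotplus> u)\<bar> \<partial>mu)
    \<le> ennreal (3 + digit_variation t n) * majorant_op g x"
proof -
  \<comment> \<open>Under this image measure, integrating a kernel is the same as convolving its
    translate with \<open>g\<close>.\<close>
  interpret majorized_measure "distr (density mu g) borel (\<lambda>u. x \<dotplus> u)" "majorant_op g x"
  proof
    fix s
    have "(\<integral>\<^sup>+ z. kernel_majorant s z \<partial>distr (density mu g) borel (\<lambda>u. x \<dotplus> u))
        = (\<integral>\<^sup>+ u. g u * kernel_majorant s (x \<dotplus> u) \<partial>mu)"
      by (rule nn_integral_translated) measurable
    also have "\<dots> = (\<integral>\<^sup>+ u. g u * majorant_kernel s x u \<partial>mu)"
      using AE_kernel_majorant_dyadic_add[of s x] by (intro nn_integral_cong_AE) auto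
    also have "\<dots> \<le> majorant_op g x" unfolding majorant_op_def by (rule SUP_upper) simp
    finally show "(\<integral>\<^sup>+ z. kernel_majorant s z \<partial>distr (density mu g) borel (\<lambda>u. x \<dotplus> u))
        \<le> majorant_op g x" .
  qed simp
  show ?thesis
    using nn_integral_transform_kernel_le[OF t] by (subst (asm) nn_integral_translated) auto
qed

section \<open>Bounds for the digit variation\<close>

lemma partial_weight_mono:
  assumes "\<And>j. 0 \<le> t j" "a \<le> b"
  shows "partial_weight t a \<le> partial_weight t b"
  unfolding partial_weight_def using assms by (intro sum_mono2) auto

lemma partial_weight_nonneg: "(\<And>j. 0 \<le> t j) \<Longrightarrow> 0 \<le> partial_weight t a"
  unfolding partial_weight_def by (rule sum_nonneg)

text \<open>Decreasing weights make \<open>partial_weight\<close> subadditive.\<close>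

lemma partial_weight_triple_le:
  assumes "\<And>j. 0 \<le> t j" "\<And>j. t (Suc j) \<le> t j" "m \<le> 3 * p" "p \<le> q"
  shows "partial_weight t m \<le> 3 * partial_weight t q"
proof -
  have anti: "t (i + j) \<le> t j" for i j
    by (induction i) (auto intro: order_trans assms(2))
  have sub: "partial_weight t (a + b) \<le> partial_weight t a + partial_weight t b" for a b
    unfolding partial_weight_add unfolding partial_weight_def
    by (simp add: sum_mono anti)
  have "partial_weight t m \<le> partial_weight t (p + (p + p))"
    using assms by (intro partial_weight_mono) auto
  also have "\<dots> \<le> 3 * partial_weight t p" using sub[of p "p + p"] sub[of p p] by simp
  also have "\<dots> \<le> 3 * partial_weight t q" using assms by (simp add: partial_weight_mono)
  finally show ?thesis .
qed

lemma mod_power_Suc: "n mod 2 ^ Suc k = 2 ^ k * bin_coeff k n + n mod 2 ^ k"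
  unfolding bin_coeff_def using mod_mult2_eq[of n "2 ^ k" 2] by (simp add: mult.commute)

lemma bin_coeff_cases: "bin_coeff k n = 0 \<or> bin_coeff k n = 1"
  using bin_coeff_less_2[of k n] by linarith

text \<open>If digits \<open>k\<close> and \<open>k + 1\<close> agree, the difference is at most the
  increment of partial weights, which will telescope. If they differ, a single weight survives; it
  counts at most \<open>3 * 2^k\<close> terms, for when digit \<open>k\<close> is 0 the residue
  modulo \<open>2^(k + 2)\<close> is at most \<open>2^(k + 1) + 2^k\<close>.\<close>

lemma digit_weight_diff_le:
  assumes t: "\<And>j. 0 \<le> t j" "\<And>j. t (Suc j) \<le> t j"
  shows "\<bar>digit_weight t n k - digit_weight t n (Suc k)\<bar>
    \<le> 3 * (\<bar>real (bin_coeff k n) - real (bin_coeff (Suc k) n)\<bar> * partial_weight t (2 ^ k + 1))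
      + (partial_weight t (n mod 2 ^ Suc (Suc k)) - partial_weight t (n mod 2 ^ Suc k))"
proof -
  let ?a = "partial_weight t (n mod 2 ^ Suc k)" and ?b = "partial_weight t (n mod 2 ^ Suc (Suc k))"
  have ab: "?a \<le> ?b"
    by (intro partial_weight_mono t) (simp only: mod_power_Suc[of n "Suc k"] le_add2)
  have a0: "0 \<le> ?a" by (intro partial_weight_nonneg t)
  have lt: "n mod 2 ^ k < 2 ^ k" "n mod 2 ^ Suc k < 2 ^ Suc k" by simp_all
  have a3: "?a \<le> 3 * partial_weight t (2 ^ k + 1)"
  proof (rule partial_weight_triple_le[of t, OF t])
    show "n mod 2 ^ Suc k \<le> 3 * 2 ^ k" using lt(2) unfolding power_Suc by linarith
  qed simp_all
  have b3: "?b \<le> 3 * partial_weight t (2 ^ k + 1)" if "bin_coeff k n = 0"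
  proof (rule partial_weight_triple_le[of t, OF t])
    have "n mod 2 ^ Suc (Suc k) = 2 ^ Suc k * bin_coeff (Suc k) n + n mod 2 ^ k"
      by (simp only: mod_power_Suc[of n "Suc k"] mod_power_Suc[of n k] that mult_0_right add_0)
    also have "\<dots> \<le> 2 ^ Suc k + 2 ^ k"
      using bin_coeff_cases[of "Suc k" n] by (intro add_mono less_imp_le[OF lt(1)]) auto
    finally show "n mod 2 ^ Suc (Suc k) \<le> 3 * 2 ^ k" by simp
  qed simp_all
  have d: "digit_weight t n k = real (bin_coeff k n) * ?a"
    "digit_weight t n (Suc k) = real (bin_coeff (Suc k) n) * ?b"
    unfolding digit_weight_def by simp_all
  show ?thesis
    unfolding d using bin_coeff_cases[of k n] bin_coeff_cases[of "Suc k" n] ab a0 a3 b3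
    by (elim disjE) (simp_all del: power_Suc)
qed

lemma digit_variation_le_upsilon:
  assumes t: "\<And>j. 0 \<le> T j n" "\<And>j. T (Suc j) n \<le> T j n"
    and le1: "\<And>m. m \<le> n \<Longrightarrow> partial_weight (\<lambda>j. T j n) m \<le> 1"
  shows "digit_variation (\<lambda>j. T j n) n \<le> 3 * upsilon n T + 1"
proof (cases "n = 0")
  case True
  then show ?thesis
    unfolding digit_variation_def digit_weight_def upsilon_def by (simp add: bin_coeff_def)
next
  case False
  let ?t = "\<lambda>j. T j n" and ?K = "floor_log n"
  let ?p = "\<lambda>k. partial_weight ?t (n mod 2 ^ Suc k)"
  \<comment> \<open>\<open>tau\<close> includes its upper index, \<open>partial_weight\<close> does
    not; hence the \<open>2^k + 1\<close> in the preceding estimate.\<close>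
  have tau: "tau T s n = partial_weight ?t (s + 1)" for s
    unfolding tau_def partial_weight_def by (simp add: lessThan_Suc_atMost)
  have "digit_variation ?t n \<le> (\<Sum>k\<le>?K.
      3 * (\<bar>real (bin_coeff k n) - real (bin_coeff (Suc k) n)\<bar> * partial_weight ?t (2 ^ k + 1))
      + (?p (Suc k) - ?p k))"
    unfolding digit_variation_def by (intro sum_mono digit_weight_diff_le t)
  also have "\<dots> = 3 * upsilon n T + (\<Sum>k<Suc ?K. ?p (Suc k) - ?p k)"
    unfolding upsilon_def tau using False by (simp add: sum.distrib sum_distrib_left lessThan_Suc_atMost)
  also have "(\<Sum>k<Suc ?K. ?p (Suc k) - ?p k) = ?p (Suc ?K) - ?p 0"
    by (rule sum_lessThan_telescope)
  also have "\<dots> \<le> 1"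
    using le1[of "n mod 2 ^ Suc (Suc ?K)"] partial_weight_nonneg[of ?t "n mod 2 ^ Suc 0"] t(1)
    by (simp add: mod_le_divisor)
  finally show ?thesis by simp
qed

text \<open>On the dyadic shell \<open>[2\<^sup>-\<^sup>m\<^sup>-\<^sup>1, 2\<^sup>-\<^sup>m)\<close> the sum below equals \<open>2\<^sup>m (v m - c m)\<close>, where \<open>v m\<close> is the
  average of \<open>c 0, \<dots>, c (m - 1)\<close> with weights \<open>2\<^sup>k\<close>.\<close>

lemma variation_le_integral:
  fixes c :: "nat \<Rightarrow> real"
  assumes c: "\<And>k. 0 \<le> c k" "\<And>k. c k \<le> 1" and cK: "c K = 0"
  shows "(\<Sum>k<K. \<bar>c k - c (Suc k)\<bar>)
    \<le> 3 * (LINT x|mu. \<bar>\<Sum>k<K. c k * (walsh_dirichlet (2 ^ Suc k) x - walsh_dirichlet (2 ^ k) x)\<bar>) + 1"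
proof -
  define v where "v m = (\<Sum>k<m. c k * 2 ^ k) / 2 ^ m" for m
  define E where "E = (\<Sum>m<K. \<bar>v m - c m\<bar>)"
  let ?D = "\<lambda>k x. walsh_dirichlet (2 ^ k) x"
  let ?W = "\<lambda>x. \<Sum>k<K. c k * (?D (Suc k) x - ?D k x)"
  \<comment> \<open>The bracket is the indicator of shell \<open>m\<close>. This writes the absolute
    value on the shells as a combination of Dirichlet kernels, whose integrals are known; where the
    first \<open>K\<close> Rademacher functions are all 1 it vanishes.\<close>
  let ?R = "\<lambda>x. \<Sum>m<K. (2 ^ m * \<bar>v m - c m\<bar>) * (?D m x / 2 ^ m - ?D (Suc m) x / 2 ^ Suc m)"
  have pointwise: "?R x \<le> \<bar>?W x\<bar>" for x
  proof (cases "\<forall>l<K. rad l x = 1")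
    case True
    then have D: "?D m x = 2 ^ m" if "m \<le> K" for m
      using walsh_dirichlet_power_cases[of m x] that by (metis one_neq_neg_one order_less_le_trans)
    have "?R x = (\<Sum>m<K. 0)" by (intro sum.cong) (auto simp: D simp del: power_Suc)
    then show ?thesis by simp
  next
    case False
    define p where "p = (LEAST l. rad l x \<noteq> 1)"
    obtain l where l: "l < K" "rad l x \<noteq> 1" using False by blast
    have p: "rad p x \<noteq> 1" "p \<le> l" 
      unfolding p_def using l LeastI[of "\<lambda>l. rad l x \<noteq> 1" l] Least_le[of "\<lambda>l. rad l x \<noteq> 1" l] by auto
    have below: "rad k x = 1" if "k < p" for k
      using that not_less_Least[of k "\<lambda>l. rad l x \<noteq> 1"] unfolding p_def by blast
    have D: "?D k x = (if k \<le> p then 2 ^ k else 0)" for k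
      using walsh_dirichlet_power_cases[of k x] below p(1)
      by (metis not_le one_neq_neg_one order_less_le_trans)
    have "p < K" using p l by simp
    have "?R x = (\<Sum>m<K. if m = p then 2 ^ p * \<bar>v p - c p\<bar> else 0)"
      by (intro sum.cong) (auto simp: D simp del: power_Suc)
    also have "\<dots> = 2 ^ p * \<bar>v p - c p\<bar>" using \<open>p < K\<close> by simp
    finally have R: "?R x = 2 ^ p * \<bar>v p - c p\<bar>" .
    have "?W x = (\<Sum>k<Suc p. c k * (?D (Suc k) x - ?D k x))"
      using \<open>p < K\<close> by (intro sum.mono_neutral_right) (auto simp: D simp del: power_Suc)
    also have "\<dots> = (\<Sum>k<p. c k * 2 ^ k) - c p * 2 ^ p"
      by (simp add: D del: power_Suc) simp
    also have "\<dots> = 2 ^ p * (v p - c p)" unfolding v_def by (simp add: field_simps)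
    finally show ?thesis unfolding R by (simp add: abs_mult)
  qed
  have int: "integrable mu (walsh_dirichlet n)" for n by simp
  have "E / 2 = (\<Sum>m<K. (2 ^ m * \<bar>v m - c m\<bar>) * (1 / 2 ^ m - 1 / 2 ^ Suc m))"
    unfolding E_def sum_divide_distrib by (intro sum.cong) (auto simp: field_simps)
  also have "\<dots> = (LINT x|mu. ?R x)"
    using int by (subst Bochner_Integration.integral_sum)
      (auto simp: integral_walsh_dirichlet simp del: power_Suc)
  also have "\<dots> \<le> (LINT x|mu. \<bar>?W x\<bar>)"
    using int by (intro integral_mono pointwise) (auto simp del: power_Suc)
  finally have EW: "E \<le> 2 * (LINT x|mu. \<bar>?W x\<bar>)" by simp
  have vSuc: "v (Suc m) = (v m + c m) / 2" for m
    unfolding v_def by (simp add: field_simps)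
  have vK: "\<bar>v K\<bar> \<le> 1"
  proof -
    have "0 \<le> v K" unfolding v_def using c by (simp add: sum_nonneg)
    moreover have "v m \<le> 1" for m
    proof (induction m)
      case (Suc m)
      then show ?case using c(2)[of m] unfolding vSuc by simp
    qed (simp add: v_def)
    ultimately show ?thesis by simp
  qed
  \<comment> \<open>The averaging recursion expresses a jump of \<open>c\<close> by two deviations
    \<open>v - c\<close>. Their sum costs \<open>E + E / 2\<close>, with \<open>E\<close> at most
    twice the integral, which explains the factor 3; the shifted sum ends in
    \<open>v K - c K = v K\<close>, which explains the 1.\<close>
  have step: "\<bar>c m - c (Suc m)\<bar> \<le> \<bar>v (Suc m) - c (Suc m)\<bar> + \<bar>v m - c m\<bar> / 2" for m
  proof -
    have "c m - c (Suc m) = (v (Suc m) - c (Suc m)) - (v m - c m) / 2"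
      unfolding vSuc by (simp add: field_simps)
    then show ?thesis
      using abs_triangle_ineq4[of "v (Suc m) - c (Suc m)" "(v m - c m) / 2"] by simp
  qed
  have "(\<Sum>m<K. \<bar>c m - c (Suc m)\<bar>) \<le> (\<Sum>m<K. \<bar>v (Suc m) - c (Suc m)\<bar> + \<bar>v m - c m\<bar> / 2)"
    by (intro sum_mono step)
  also have "\<dots> = (\<Sum>m<K. \<bar>v (Suc m) - c (Suc m)\<bar>) + E / 2"
    unfolding E_def by (simp add: sum.distrib sum_divide_distrib)
  also have "(\<Sum>m<K. \<bar>v (Suc m) - c (Suc m)\<bar>) \<le> E + \<bar>v K\<bar>"
    using sum.lessThan_Suc_shift[of "\<lambda>m. \<bar>v m - c m\<bar>" K] unfolding E_def cK[symmetric] by (simp add: cK)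
  finally show ?thesis using vK EW by simp
qed

text \<open>The value 2 is 1 for the Dirichlet part plus at most 1 for the normalized Fejer part.
  The push-forward under the identity only replaces the restricted sigma-algebra by
  \<open>borel\<close>.\<close>

interpretation mu_borel: majorized_measure "distr mu borel (\<lambda>x. x)" 2
proof
  fix s
  have "(\<integral>\<^sup>+ x. kernel_majorant s x \<partial>distr mu borel (\<lambda>x. x)) = (\<integral>\<^sup>+ x. kernel_majorant s x \<partial>mu)"
    by (rule nn_integral_distr[OF measurable_ident_mu]) (unfold measurable_distr_eq1, measurable)
  also have "\<dots> = ennreal (LINT x|mu. kernel_majorant s x)"
    by (rule nn_integral_eq_integral) (auto simp: kernel_majorant_nonneg, simp add: kernel_majorant_def[abs_def])
  also have "(LINT x|mu. kernel_majorant s x) \<le> 1 + 1"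
    unfolding kernel_majorant_def using integral_fejer_sum_le[of "2 ^ s"]
    by (simp add: integral_walsh_dirichlet)
  finally show "(\<integral>\<^sup>+ x. kernel_majorant s x \<partial>distr mu borel (\<lambda>x. x)) \<le> 2"
    by (simp add: ennreal_leI)
qed simp

lemma nn_integral_mu_borel:
  assumes [measurable]: "h \<in> borel_measurable borel"
  shows "(\<integral>\<^sup>+ x. h x \<partial>distr mu borel (\<lambda>x. x)) = (\<integral>\<^sup>+ x. h x \<partial>mu)"
  by (rule nn_integral_distr[OF measurable_ident_mu]) (unfold measurable_distr_eq1, rule assms)

lemma measurable_kernels_mu [measurable]:
  "transform_kernel t n \<in> borel_measurable mu" "main_kernel t n K \<in> borel_measurable mu"
  by (rule measurable_mu, measurable)+

text \<open>As \<open>walsh n\<close> has modulus 1, the main part differs from the kernel by at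
  most 4 in norm (the error bound with \<open>A = 2\<close>); \<open>13 = 3 * 4 + 1\<close>.\<close>

lemma digit_variation_le_L1:
  assumes t: "\<And>j. 0 \<le> t j" "\<And>j. t (Suc j) \<le> t j" and le1: "\<And>m. m \<le> n \<Longrightarrow> partial_weight t m \<le> 1"
  shows "ennreal (digit_variation t n) \<le> 3 * (\<integral>\<^sup>+ x. \<bar>transform_kernel t n x\<bar> \<partial>mu) + 13"
proof -
  define K where "K = Suc (floor_log n)"
  have n: "n < 2 ^ K" unfolding K_def using floor_log_exp2_gt[of n] by simp
  let ?W = "main_kernel t n K" and ?V = "transform_kernel t n"
  have c: "0 \<le> digit_weight t n k" "digit_weight t n k \<le> 1" for k
  proof -
    have "0 \<le> partial_weight t (n mod 2 ^ (k + 1))" "partial_weight t (n mod 2 ^ (k + 1)) \<le> 1"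
      using t(1) le1[of "n mod 2 ^ (k + 1)"] by (auto intro: partial_weight_nonneg)
    then show "0 \<le> digit_weight t n k" "digit_weight t n k \<le> 1"
      unfolding digit_weight_def using bin_coeff_cases[of k n] by auto
  qed
  have "digit_weight t n K = 0" unfolding digit_weight_def by (simp add: bin_coeff_eq_0[OF n])
  then have "digit_variation t n \<le> 3 * (LINT x|mu. \<bar>?W x\<bar>) + 1"
    using variation_le_integral[of "digit_weight t n" K] c
    unfolding digit_variation_def main_kernel_def K_def lessThan_Suc_atMost by simp
  moreover have "0 \<le> (LINT x|mu. \<bar>?W x\<bar>)" by simp
  ultimately have "ennreal (digit_variation t n) \<le> ennreal 3 * ennreal (LINT x|mu. \<bar>?W x\<bar>) + ennreal 1"
    by (subst ennreal_mult[symmetric], simp, simp, subst ennreal_plus[symmetric])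
      (simp_all only: ennreal_leI mult_nonneg_nonneg zero_le_numeral zero_le_one)
  then have "ennreal (digit_variation t n) \<le> 3 * ennreal (LINT x|mu. \<bar>?W x\<bar>) + 1"
    by simp
  also have "ennreal (LINT x|mu. \<bar>?W x\<bar>) = (\<integral>\<^sup>+ x. \<bar>?W x\<bar> \<partial>mu)"
    by (rule nn_integral_eq_integral[symmetric]) (auto simp: main_kernel_def[abs_def] simp del: power_Suc)
  also have "\<dots> \<le> (\<integral>\<^sup>+ x. \<bar>?V x\<bar> \<partial>mu) + (\<integral>\<^sup>+ x. \<bar>?V x - walsh n x * ?W x\<bar> \<partial>mu)"
  proof (subst nn_integral_add[symmetric])
    show "(\<integral>\<^sup>+ x. \<bar>?W x\<bar> \<partial>mu) \<le> (\<integral>\<^sup>+ x. ennreal \<bar>?V x\<bar> + ennreal \<bar>?V x - walsh n x * ?W x\<bar> \<partial>mu)"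
    proof (rule nn_integral_mono)
      fix x
      have "\<bar>?W x\<bar> = \<bar>walsh n x * ?W x\<bar>" by (simp add: abs_mult)
      also have "\<dots> \<le> \<bar>?V x\<bar> + \<bar>?V x - walsh n x * ?W x\<bar>" by linarith
      finally show "ennreal \<bar>?W x\<bar> \<le> ennreal \<bar>?V x\<bar> + ennreal \<bar>?V x - walsh n x * ?W x\<bar>"
        by (simp add: ennreal_leI flip: ennreal_plus)
    qed
  qed measurable
  also have "(\<integral>\<^sup>+ x. \<bar>?V x - walsh n x * ?W x\<bar> \<partial>mu) \<le> ennreal (2 * partial_weight t n) * 2"
    using mu_borel.nn_integral_kernel_error_le[of t, OF t n] by (simp add: nn_integral_mu_borel)
  also have "\<dots> \<le> ennreal 2 * 2"
    using le1[of n] by (intro mult_right_mono ennreal_leI) auto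
  finally have "ennreal (digit_variation t n) \<le> 3 * ((\<integral>\<^sup>+ x. \<bar>?V x\<bar> \<partial>mu) + ennreal 2 * 2) + 1"
    by (simp add: add_mono mult_left_mono)
  also have "\<dots> = 3 * (\<integral>\<^sup>+ x. \<bar>?V x\<bar> \<partial>mu) + 13"
    by (simp add: distrib_left add.assoc)
  finally show ?thesis .
qed

section \<open>Test functions for the operator norms\<close>

lemma matrix_transform_eq:
  "matrix_transform T n f x = (\<Sum>j\<le>n. T j n * walsh_partial_sum (n - j) f x)"
  unfolding matrix_transform_def
  by (rule sum.reindex_bij_witness[of _ "\<lambda>j. n - j" "\<lambda>j. n - j"]) auto

text \<open>Where the first \<open>n\<close> Rademacher functions are 1, all Walsh functions
  involved equal 1, so the transform of \<open>sgn\<close> of the kernel is constant there with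
  value the norm of the kernel. This dyadic interval has positive measure and is seen by the
  essential supremum.\<close>

lemma L1_kernel_le_Linf_operator_norm:
  "(\<integral>\<^sup>+ x. \<bar>matrix_kernel T n x\<bar> \<partial>mu) \<le> operator_norm Linf_space Linf_norm Linf_norm (matrix_transform T n)"
proof -
  let ?V = "matrix_kernel T n"
  define f where "f x = sgn (?V x)" for x
  have V: "?V = transform_kernel (\<lambda>k. T k n) n" by (rule ext) (rule matrix_kernel_eq)
  have Vm [measurable]: "?V \<in> borel_measurable mu" unfolding V by measurable
  have f [measurable]: "f \<in> borel_measurable mu" unfolding f_def[abs_def] by measurable
  have f1: "\<bar>f x\<bar> \<le> 1" for x unfolding f_def by (simp add: abs_sgn_eq)
  have norm: "Linf_norm f \<le> 1"
    unfolding Linf_norm_def using f1 by (intro esssup_I) (auto simp: ennreal_le_1)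
  have fD: "integrable mu (\<lambda>x. f x * walsh i x)" for i
    by (rule mu.integrable_const_bound[where B = 1]) (use f1 in \<open>auto simp: abs_mult\<close>)
  have fDir: "integrable mu (\<lambda>x. f x * walsh_dirichlet k x)" for k
    unfolding walsh_dirichlet_def sum_distrib_left using fD by simp
  have val: "matrix_transform T n f x = (LINT x|mu. \<bar>?V x\<bar>)" if x: "\<forall>l<n. rad l x = 1" for x
  proof -
    have partial: "walsh_partial_sum k f x = (LINT z|mu. f z * walsh_dirichlet k z)" if "k \<le> n" for k
    proof -
      have "walsh_partial_sum k f x = (\<Sum>i<k. walsh_coeff f i)"
        unfolding walsh_partial_sum_def
      proof (rule sum.cong)
        fix i assume "i \<in> {..<k}"
        then have "i < 2 ^ n" using that less_exp[of n] by (meson lessThan_iff less_le_trans less_trans)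
        then show "walsh_coeff f i * walsh i x = walsh_coeff f i" using walsh_eq_1[OF x] by simp
      qed simp
      also have "\<dots> = (LINT z|mu. f z * walsh_dirichlet k z)"
        unfolding walsh_coeff_def walsh_dirichlet_def sum_distrib_left using fD by simp
      finally show ?thesis .
    qed
    have "matrix_transform T n f x = (\<Sum>j\<le>n. T j n * (LINT z|mu. f z * walsh_dirichlet (n - j) z))"
      unfolding matrix_transform_eq by (simp add: partial)
    also have "\<dots> = (LINT z|mu. (\<Sum>j\<le>n. T j n * (f z * walsh_dirichlet (n - j) z)))"
      using fDir by simp
    also have "\<dots> = (LINT z|mu. f z * ?V z)"
      unfolding V transform_kernel_def
      by (simp add: sum_distrib_left ac_simps flip: lessThan_Suc_atMost)
    also have "\<dots> = (LINT z|mu. \<bar>?V z\<bar>)"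
      unfolding f_def by (simp add: abs_sgn mult.commute)
    finally show ?thesis .
  qed
  have "AE x in mu. ennreal \<bar>matrix_transform T n f x\<bar> \<le> Linf_norm (matrix_transform T n f)"
    unfolding Linf_norm_def by (rule esssup_AE)
  then have "\<exists>x. (\<forall>l<n. rad l x = 1) \<and> ennreal \<bar>matrix_transform T n f x\<bar> \<le> Linf_norm (matrix_transform T n f)"
  proof (rule contrapos_pp)
    assume none: "\<not> ?thesis"
    show "\<not> (AE x in mu. ennreal \<bar>matrix_transform T n f x\<bar> \<le> Linf_norm (matrix_transform T n f))"
    proof
      assume "AE x in mu. ennreal \<bar>matrix_transform T n f x\<bar> \<le> Linf_norm (matrix_transform T n f)"
      \<comment> \<open>If the inequality failed on the whole interval, the interval would be null,
        and the Dirichlet kernel supported on it could not have integral 1.\<close>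
      then have "AE x in mu. walsh_dirichlet (2 ^ n) x = 0"
      proof eventually_elim
        case (elim x)
        then have "\<not> (\<forall>l<n. rad l x = 1)" using none by blast
        then show ?case using walsh_dirichlet_power_cases[of n x] by blast
      qed
      then have "(LINT x|mu. walsh_dirichlet (2 ^ n) x) = 0" by (rule integral_eq_zero_AE)
      then show False by (simp add: integral_walsh_dirichlet)
    qed
  qed
  then obtain x where x: "\<forall>l<n. rad l x = 1"
    "ennreal \<bar>matrix_transform T n f x\<bar> \<le> Linf_norm (matrix_transform T n f)" by blast
  have "(\<integral>\<^sup>+ x. \<bar>?V x\<bar> \<partial>mu) = ennreal (LINT x|mu. \<bar>?V x\<bar>)"
    by (rule nn_integral_eq_integral) (auto simp: V transform_kernel_def[abs_def])
  also have "\<dots> \<le> Linf_norm (matrix_transform T n f)"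
    using x(2) unfolding val[OF x(1)] by simp
  also have "\<dots> \<le> operator_norm Linf_space Linf_norm Linf_norm (matrix_transform T n)"
    unfolding operator_norm_def
    by (rule SUP_upper) (use norm in \<open>auto simp: Linf_space_def intro: le_less_trans\<close>)
  finally show ?thesis .
qed

lemma walsh_coeff_dirichlet: "(LINT x|mu. walsh_dirichlet k x * walsh i x) = (if i < k then 1 else 0)"
proof -
  have "(LINT x|mu. walsh_dirichlet k x * walsh i x) = (\<Sum>j<k. LINT x|mu. walsh j x * walsh i x)"
    unfolding walsh_dirichlet_def sum_distrib_right
    by (rule Bochner_Integration.integral_sum) (rule integrable_walsh_mult)
  also have "\<dots> = (\<Sum>j<k. if j = i then 1 else 0)" by (simp add: integral_walsh_mult)
  finally show ?thesis by simp
qed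

text \<open>The test function is \<open>rad N\<close> times the kernel of order \<open>2^N\<close>;
  its dyadic partial sums are 0 or the function itself, so its Hardy norm is at most 1. Its
  transform is \<open>rad N\<close> times the kernel of order \<open>m = n - 2^N\<close>, which by
  the recursion differs from the full kernel by 1 for the Dirichlet term and 4 for the reflected
  block.\<close>

lemma L1_kernel_le_H1_operator_norm:
  assumes t: "\<And>j. 0 \<le> T j n" "\<And>j. T (Suc j) n \<le> T j n"
    and le1: "\<And>m. m \<le> n \<Longrightarrow> partial_weight (\<lambda>j. T j n) m \<le> 1"
  shows "(\<integral>\<^sup>+ x. \<bar>matrix_kernel T n x\<bar> \<partial>mu)
    \<le> operator_norm H1_space H1_norm L1_norm (matrix_transform T n) + 5"
proof (cases "n = 0")
  case True
  then show ?thesis by (simp add: matrix_kernel_def)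
next
  case False
  let ?t = "\<lambda>k. T k n"
  define N where "N = floor_log n"
  define m where "m = n - 2 ^ N"
  have n: "n = 2 ^ N + m" "m < 2 ^ N"
    unfolding m_def N_def using floor_log_exp2_le[of n] floor_log_exp2_gt[of n] False by auto
  define f where "f x = walsh_dirichlet (2 ^ Suc N) x - walsh_dirichlet (2 ^ N) x" for x
  have absf: "\<bar>f x\<bar> = walsh_dirichlet (2 ^ N) x" for x
    unfolding f_def walsh_dirichlet_power_diff[symmetric]
    by (simp add: abs_mult walsh_dirichlet_power_nonneg)
  have intf: "integrable mu f" unfolding f_def[abs_def] by (simp del: power_Suc)
  have intD: "integrable mu (\<lambda>x. walsh_dirichlet k x * walsh i x)" for k i
    unfolding walsh_dirichlet_def sum_distrib_right by (simp add: integrable_walsh_mult)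
  have coeff: "walsh_coeff f i = (if i < 2 ^ Suc N then 1 else 0) - (if i < 2 ^ N then 1 else 0)" for i
    unfolding walsh_coeff_def f_def left_diff_distrib
    by (subst Bochner_Integration.integral_diff) (rule intD, rule intD, simp only: walsh_coeff_dirichlet)
  have sum_if: "(\<Sum>i<k. (if i < M then 1 else 0) * walsh i x) = walsh_dirichlet (min k M) x" for k M x
    unfolding walsh_dirichlet_def by (rule sum.mono_neutral_cong_right) auto
  have partial: "walsh_partial_sum k f x
      = walsh_dirichlet (min k (2 ^ Suc N)) x - walsh_dirichlet (min k (2 ^ N)) x" for k x
    unfolding walsh_partial_sum_def coeff left_diff_distrib sum_subtractf sum_if ..
  have "dyadic_maximal f x \<le> ennreal \<bar>f x\<bar>" for x
    unfolding dyadic_maximal_def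
  proof (rule SUP_least)
    fix p
    show "ennreal \<bar>walsh_partial_sum (2 ^ p) f x\<bar> \<le> ennreal \<bar>f x\<bar>"
    proof (cases "p \<le> N")
      case True
      then have "(2::nat) ^ p \<le> 2 ^ N" "(2::nat) ^ p \<le> 2 ^ Suc N" by (intro power_increasing; simp)+
      then show ?thesis unfolding partial by (simp add: min_absorb1 del: power_Suc)
    next
      case False
      then have "(2::nat) ^ N \<le> 2 ^ p" "(2::nat) ^ Suc N \<le> 2 ^ p" by (intro power_increasing; simp)+
      then show ?thesis unfolding partial f_def by (simp add: min_absorb2 del: power_Suc)
    qed
  qed
  then have "H1_norm f \<le> (\<integral>\<^sup>+ x. ennreal \<bar>f x\<bar> \<partial>mu)"
    unfolding H1_norm_def by (rule nn_integral_mono)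
  also have "\<dots> = ennreal (LINT x|mu. walsh_dirichlet (2 ^ N) x)"
    unfolding absf by (rule nn_integral_eq_integral) (auto simp: walsh_dirichlet_power_nonneg)
  also have "\<dots> = 1" by (simp add: integral_walsh_dirichlet)
  finally have norm: "H1_norm f \<le> 1" .
  have T: "matrix_transform T n f x = rad N x * transform_kernel ?t m x" for x
  proof -
    have "matrix_transform T n f x
        = (\<Sum>j\<le>n. ?t j * (walsh_dirichlet (n - j) x - walsh_dirichlet (min (n - j) (2 ^ N)) x))"
      unfolding matrix_transform_eq partial
    proof (rule sum.cong)
      fix j
      have "n - j \<le> 2 ^ Suc N" using n by simp
      then show "?t j * (walsh_dirichlet (min (n - j) (2 ^ Suc N)) x - walsh_dirichlet (min (n - j) (2 ^ N)) x)
        = ?t j * (walsh_dirichlet (n - j) x - walsh_dirichlet (min (n - j) (2 ^ N)) x)"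
        by (simp only: min_absorb1)
    qed simp
    also have "\<dots> = (\<Sum>j<m. ?t j * (rad N x * walsh_dirichlet (m - j) x))"
    proof (rule sum.mono_neutral_cong_right)
      show "\<forall>j\<in>{..n} - {..<m}. ?t j * (walsh_dirichlet (n - j) x - walsh_dirichlet (min (n - j) (2 ^ N)) x) = 0"
        using n by (auto simp: min_absorb1)
      fix j assume "j \<in> {..<m}"
      then have j: "n - j = 2 ^ N + (m - j)" "m - j \<le> 2 ^ N" using n by auto
      then have "min (n - j) (2 ^ N) = 2 ^ N" by simp
      then show "?t j * (walsh_dirichlet (n - j) x - walsh_dirichlet (min (n - j) (2 ^ N)) x)
          = ?t j * (rad N x * walsh_dirichlet (m - j) x)"
        unfolding j(1) using walsh_dirichlet_add_power[OF j(2), of x] by simp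
    qed (use n in auto)
    also have "\<dots> = rad N x * transform_kernel ?t m x"
      unfolding transform_kernel_def by (simp add: sum_distrib_left ac_simps)
    finally show ?thesis .
  qed
  have "(\<integral>\<^sup>+ x. \<bar>transform_kernel ?t m x\<bar> \<partial>mu) = L1_norm (matrix_transform T n f)"
    unfolding L1_norm_def T by (simp add: abs_mult)
  also have "\<dots> \<le> operator_norm H1_space H1_norm L1_norm (matrix_transform T n)"
    unfolding operator_norm_def
    by (rule SUP_upper) (use norm intf in \<open>auto simp: H1_space_def intro: le_less_trans\<close>)
  finally have Vm: "(\<integral>\<^sup>+ x. \<bar>transform_kernel ?t m x\<bar> \<partial>mu)
      \<le> operator_norm H1_space H1_norm L1_norm (matrix_transform T n)" .
  let ?S = "\<lambda>x. \<Sum>j<2 ^ N. ?t (m + j) * walsh_dirichlet j x"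
  have pw: "0 \<le> partial_weight ?t n" "partial_weight ?t n \<le> 1"
    using t le1[of n] by (auto intro: partial_weight_nonneg)
  have "(\<integral>\<^sup>+ x. \<bar>matrix_kernel T n x\<bar> \<partial>mu)
      \<le> (\<integral>\<^sup>+ x. ennreal \<bar>transform_kernel ?t m x\<bar> + (ennreal (walsh_dirichlet (2 ^ N) x) + ennreal \<bar>?S x\<bar>) \<partial>mu)"
  proof (rule nn_integral_mono)
    fix x
    have "\<bar>matrix_kernel T n x\<bar> \<le> \<bar>partial_weight ?t n * walsh_dirichlet (2 ^ N) x\<bar>
        + \<bar>rad N x * transform_kernel ?t m x\<bar> + \<bar>walsh (2 ^ N - 1) x * ?S x\<bar>"
      using transform_kernel_add_power[OF n(2), of ?t x]
      unfolding matrix_kernel_eq n(1)[symmetric] by linarith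
    also have "\<dots> = partial_weight ?t n * walsh_dirichlet (2 ^ N) x + \<bar>transform_kernel ?t m x\<bar> + \<bar>?S x\<bar>"
      using pw walsh_dirichlet_power_nonneg[of N x] by (simp add: abs_mult)
    also have "\<dots> \<le> \<bar>transform_kernel ?t m x\<bar> + (walsh_dirichlet (2 ^ N) x + \<bar>?S x\<bar>)"
      using mult_right_mono[OF pw(2) walsh_dirichlet_power_nonneg[of N x]] by simp
    finally show "ennreal \<bar>matrix_kernel T n x\<bar>
        \<le> ennreal \<bar>transform_kernel ?t m x\<bar> + (ennreal (walsh_dirichlet (2 ^ N) x) + ennreal \<bar>?S x\<bar>)"
      using walsh_dirichlet_power_nonneg[of N x] by (simp add: ennreal_leI flip: ennreal_plus)
  qed
  also have "\<dots> = (\<integral>\<^sup>+ x. \<bar>transform_kernel ?t m x\<bar> \<partial>mu)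
      + ((\<integral>\<^sup>+ x. walsh_dirichlet (2 ^ N) x \<partial>mu) + (\<integral>\<^sup>+ x. \<bar>?S x\<bar> \<partial>mu))"
    by (simp add: nn_integral_add)
  also have "(\<integral>\<^sup>+ x. walsh_dirichlet (2 ^ N) x \<partial>mu) = ennreal (LINT x|mu. walsh_dirichlet (2 ^ N) x)"
    by (rule nn_integral_eq_integral) (auto simp: walsh_dirichlet_power_nonneg)
  also have "\<dots> = 1" by (simp add: integral_walsh_dirichlet)
  also have "(\<integral>\<^sup>+ x. \<bar>?S x\<bar> \<partial>mu) \<le> ennreal (2 * (\<Sum>j<2 ^ N. ?t (m + j))) * 2"
    using mu_borel.nn_integral_decreasing_dirichlet_le[of "\<lambda>j. ?t (m + j)" "2 ^ N"] t
    by (simp add: nn_integral_mu_borel)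
  also have "\<dots> \<le> ennreal 2 * 2"
    using pw(2) partial_weight_nonneg[of ?t m] t(1) unfolding n(1) partial_weight_add
    by (intro mult_right_mono ennreal_leI) auto
  also note Vm
  finally have "(\<integral>\<^sup>+ x. \<bar>matrix_kernel T n x\<bar> \<partial>mu)
      \<le> operator_norm H1_space H1_norm L1_norm (matrix_transform T n) + (1 + ennreal 2 * 2)"
    by (simp add: add_mono)
  then show ?thesis by simp
qed

section \<open>Matrices of transformation and the two-dimensional estimate\<close>

lemma transformation_matrix_column:
  assumes "transformation_matrix T"
  shows "0 \<le> T j n" "T (Suc j) n \<le> T j n" "m \<le> n \<Longrightarrow> partial_weight (\<lambda>j. T j n) m \<le> 1"
proof -
  have *: "\<And>j n. 0 \<le> T j n" "\<And>j n. T (Suc j) n \<le> T j n" "\<And>n. (\<Sum>k\<le>n. T k n) = 1"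
    using assms unfolding transformation_matrix_def by auto
  show "0 \<le> T j n" "T (Suc j) n \<le> T j n" by (rule *)+
  assume "m \<le> n"
  then have "partial_weight (\<lambda>j. T j n) m \<le> partial_weight (\<lambda>j. T j n) (Suc n)"
    by (intro partial_weight_mono *) simp
  then show "partial_weight (\<lambda>j. T j n) m \<le> 1"
    unfolding partial_weight_def lessThan_Suc_atMost by (simp add: *)
qed

lemma digit_variation_bounded:
  assumes T: "transformation_matrix T"
    and cond: "(SUP a. operator_norm H1_space H1_norm L1_norm (matrix_transform T (p a))) < \<infinity>
       \<or> (SUP a. operator_norm Linf_space Linf_norm Linf_norm (matrix_transform T (p a))) < \<infinity>
       \<or> (SUP a. ennreal (upsilon (p a) T)) < \<infinity>"
  obtains C where "0 \<le> C" "\<And>a. digit_variation (\<lambda>j. T j (p a)) (p a) \<le> C"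
proof -
  let ?d = "\<lambda>a. ennreal (digit_variation (\<lambda>j. T j (p a)) (p a))"
  note col = transformation_matrix_column[OF T]
  have "\<exists>B < \<infinity>. \<forall>a. ?d a \<le> B"
    using cond
  proof (elim disjE)
    assume fin: "(SUP a. operator_norm H1_space H1_norm L1_norm (matrix_transform T (p a))) < \<infinity>"
      (is "?B < _")
    have "?d a \<le> 3 * (?B + 5) + 13" for a
    proof -
      have "?d a \<le> 3 * (\<integral>\<^sup>+ x. \<bar>matrix_kernel T (p a) x\<bar> \<partial>mu) + 13"
        unfolding matrix_kernel_eq by (rule digit_variation_le_L1) (rule col; assumption?)+
      also have "(\<integral>\<^sup>+ x. \<bar>matrix_kernel T (p a) x\<bar> \<partial>mu)
          \<le> operator_norm H1_space H1_norm L1_norm (matrix_transform T (p a)) + 5"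
        by (rule L1_kernel_le_H1_operator_norm) (rule col; assumption?)+
      also have "operator_norm H1_space H1_norm L1_norm (matrix_transform T (p a)) \<le> ?B"
        by (rule SUP_upper) simp
      finally show ?thesis by (simp add: add_right_mono mult_left_mono)
    qed
    moreover have "3 * (?B + 5) + 13 < \<infinity>" using fin by (simp add: ennreal_mult_less_top)
    ultimately show ?thesis by blast
  next
    assume fin: "(SUP a. operator_norm Linf_space Linf_norm Linf_norm (matrix_transform T (p a))) < \<infinity>"
      (is "?B < _")
    have "?d a \<le> 3 * ?B + 13" for a
    proof -
      have "?d a \<le> 3 * (\<integral>\<^sup>+ x. \<bar>matrix_kernel T (p a) x\<bar> \<partial>mu) + 13"
        unfolding matrix_kernel_eq by (rule digit_variation_le_L1) (rule col; assumption?)+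
      also have "(\<integral>\<^sup>+ x. \<bar>matrix_kernel T (p a) x\<bar> \<partial>mu)
          \<le> operator_norm Linf_space Linf_norm Linf_norm (matrix_transform T (p a))"
        by (rule L1_kernel_le_Linf_operator_norm)
      also have "\<dots> \<le> ?B" by (rule SUP_upper) simp
      finally show ?thesis by (simp add: add_right_mono mult_left_mono)
    qed
    moreover have "3 * ?B + 13 < \<infinity>" using fin by (simp add: ennreal_mult_less_top)
    ultimately show ?thesis by blast
  next
    assume fin: "(SUP a. ennreal (upsilon (p a) T)) < \<infinity>" (is "?B < _")
    have "?d a \<le> 3 * ?B + 1" for a
    proof -
      have nn: "0 \<le> upsilon (p a) T"
        unfolding upsilon_def tau_def using col(1) by (auto intro!: sum_nonneg mult_nonneg_nonneg)
      have "?d a \<le> ennreal (3 * upsilon (p a) T + 1)"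
        by (intro ennreal_leI digit_variation_le_upsilon) (rule col; assumption?)+
      also have "\<dots> = 3 * ennreal (upsilon (p a) T) + 1"
        using nn by (simp add: ennreal_mult')
      also have "ennreal (upsilon (p a) T) \<le> ?B"
        by (rule SUP_upper) simp
      finally show ?thesis by (simp add: add_right_mono mult_left_mono)
    qed
    moreover have "3 * ?B + 1 < \<infinity>" using fin by (simp add: ennreal_mult_less_top)
    ultimately show ?thesis by blast
  qed
  then obtain B where "B < \<infinity>" "\<And>a. ?d a \<le> B" by blast
  then obtain C where "0 \<le> C" "\<And>a. ?d a \<le> ennreal C" by (cases B) auto
  then show ?thesis using that[of C] by simp
qed

text \<open>The maximal operator acts in the second variable only, the first being a parameter. Its
  integral uses up the \<open>L ln L\<close> hypothesis, so the first variable can be treated by the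
  weak type inequality.\<close>

definition hybrid_op :: "(real \<times> real \<Rightarrow> real) \<Rightarrow> real \<Rightarrow> real \<Rightarrow> ennreal" where
  "hybrid_op f x0 x1 = majorant_op (\<lambda>u. ennreal \<bar>f (x0, u)\<bar>) x1"

lemma measurable_hybrid_op:
  assumes [measurable]: "f \<in> borel_measurable mu2"
  shows "case_prod (hybrid_op f) \<in> borel_measurable (mu \<Otimes>\<^sub>M mu)"
proof -
  have [measurable]: "f \<in> borel_measurable (mu \<Otimes>\<^sub>M mu)" using assms unfolding mu2_def .
  have "(\<lambda>z. majorant_op (\<lambda>u. ennreal \<bar>f (fst z, u)\<bar>) (snd z)) \<in> borel_measurable (mu \<Otimes>\<^sub>M mu)"
  proof (rule measurable_majorant_op)
    show "(\<lambda>(z, u). ennreal \<bar>f (fst z, u)\<bar>) \<in> borel_measurable ((mu \<Otimes>\<^sub>M mu) \<Otimes>\<^sub>M mu)"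
      by measurable
    show "snd \<in> borel_measurable (mu \<Otimes>\<^sub>M mu)"
      by (rule measurable_compose[OF measurable_snd measurable_ident_mu])
  qed
  then show ?thesis unfolding hybrid_op_def by (simp add: case_prod_beta')
qed

text \<open>Integrability is not assumed: a non-integrable function has Bochner integral 0.\<close>

lemma abs_integral_le_nn_integral:
  fixes f :: "'a \<Rightarrow> real"
  shows "ennreal \<bar>LINT x|M. f x\<bar> \<le> (\<integral>\<^sup>+ x. ennreal \<bar>f x\<bar> \<partial>M)"
  using integral_norm_bound_ennreal[of M f] not_integrable_integral_eq[of M f] by fastforce

text \<open>With absolute values inside, the inner integral is dominated with \<open>u0\<close> and
  \<open>x1\<close> fixed, and the resulting function of \<open>u0\<close> is dominated in turn; the
  right-hand side no longer involves \<open>n\<close> and \<open>m\<close>.\<close>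

lemma tensor_transform_le:
  assumes T: "transformation_matrix T0" "transformation_matrix T1"
    and C: "digit_variation (\<lambda>j. T0 j n) n \<le> C0" "digit_variation (\<lambda>j. T1 j m) m \<le> C1"
    and nonneg: "0 \<le> C0" "0 \<le> C1"
    and f [measurable]: "f \<in> borel_measurable mu2" and x1: "x1 \<in> space mu"
  shows "ennreal \<bar>tensor_transform T0 n T1 m f (x0, x1)\<bar>
    \<le> ennreal ((3 + C0) * (3 + C1)) * majorant_op (\<lambda>u. hybrid_op f u x1) x0"
proof -
  have fm [measurable]: "f \<in> borel_measurable (mu \<Otimes>\<^sub>M mu)" using f unfolding mu2_def .
  have [measurable]: "case_prod (hybrid_op f) \<in> borel_measurable (mu \<Otimes>\<^sub>M mu)"
    by (rule measurable_hybrid_op[OF f])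
  have K [measurable]: "(\<lambda>u. matrix_kernel T k (x \<dotplus> u)) \<in> borel_measurable mu" for T k x
    unfolding matrix_kernel_eq
    by (rule measurable_compose[OF measurable_dyadic_add measurable_transform_kernel]) simp
  have one: "(\<integral>\<^sup>+ u. g u * ennreal \<bar>matrix_kernel T k (x \<dotplus> u)\<bar> \<partial>mu) \<le> ennreal (3 + C) * majorant_op g x"
    if "transformation_matrix T" "digit_variation (\<lambda>j. T j k) k \<le> C" "g \<in> borel_measurable mu"
    for T k C g x
  proof -
    note col = transformation_matrix_column[OF that(1)]
    have "(\<integral>\<^sup>+ u. g u * ennreal \<bar>matrix_kernel T k (x \<dotplus> u)\<bar> \<partial>mu)
        \<le> ennreal (3 + digit_variation (\<lambda>j. T j k) k) * majorant_op g x"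
      unfolding matrix_kernel_eq
      by (rule nn_integral_transform_kernel_le_majorant_op[OF that(3)]) (rule col; assumption?)+
    also have "\<dots> \<le> ennreal (3 + C) * majorant_op g x"
      using that(2) by (intro mult_right_mono ennreal_leI) simp_all
    finally show ?thesis .
  qed
  have hyb: "(\<lambda>u. hybrid_op f u x1) \<in> borel_measurable mu"
    using measurable_Pair1[OF measurable_hybrid_op[OF f] x1] by simp
  let ?V0 = "\<lambda>u. ennreal \<bar>matrix_kernel T0 n (x0 \<dotplus> u)\<bar>" and ?V1 = "\<lambda>u. ennreal \<bar>matrix_kernel T1 m (x1 \<dotplus> u)\<bar>"
  have "ennreal \<bar>tensor_transform T0 n T1 m f (x0, x1)\<bar>
      \<le> (\<integral>\<^sup>+ z. ennreal \<bar>case z of (u0, u1) \<Rightarrow>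
            f (u0, u1) * matrix_kernel T0 n (x0 \<dotplus> u0) * matrix_kernel T1 m (x1 \<dotplus> u1)\<bar> \<partial>mu2)"
    unfolding tensor_transform_def prod.case by (rule abs_integral_le_nn_integral)
  also have "\<dots> = (\<integral>\<^sup>+ u0. (\<integral>\<^sup>+ u1. ennreal \<bar>f (u0, u1)\<bar> * ?V0 u0 * ?V1 u1 \<partial>mu) \<partial>mu)"
    unfolding mu2_def
    by (subst mu.nn_integral_fst[symmetric]) (simp_all add: abs_mult ennreal_mult split_beta')
  also have "\<dots> = (\<integral>\<^sup>+ u0. ?V0 u0 * (\<integral>\<^sup>+ u1. ennreal \<bar>f (u0, u1)\<bar> * ?V1 u1 \<partial>mu) \<partial>mu)"
    by (intro nn_integral_cong) (simp add: nn_integral_cmult[symmetric] ac_simps)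
  also have "\<dots> \<le> (\<integral>\<^sup>+ u0. ?V0 u0 * (ennreal (3 + C1) * hybrid_op f u0 x1) \<partial>mu)"
    unfolding hybrid_op_def
  proof (intro nn_integral_mono mult_left_mono one[OF T(2) C(2)])
    fix u0 assume "u0 \<in> space mu"
    then show "(\<lambda>u. ennreal \<bar>f (u0, u)\<bar>) \<in> borel_measurable mu"
      using measurable_Pair2[OF fm] by measurable
  qed simp
  also have "\<dots> = ennreal (3 + C1) * (\<integral>\<^sup>+ u0. hybrid_op f u0 x1 * ?V0 u0 \<partial>mu)"
    by (subst nn_integral_cmult[symmetric]) (use hyb in \<open>auto simp: ac_simps\<close>)
  also have "\<dots> \<le> ennreal (3 + C1) * (ennreal (3 + C0) * majorant_op (\<lambda>u. hybrid_op f u x1) x0)"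
    by (intro mult_left_mono one[OF T(1) C(1)] hyb) simp
  also have "\<dots> = ennreal ((3 + C0) * (3 + C1)) * majorant_op (\<lambda>u. hybrid_op f u x1) x0"
    using nonneg by (simp add: ennreal_mult ac_simps)
  finally show ?thesis .
qed

lemma nn_integral_hybrid_op_le:
  assumes f [measurable]: "f \<in> borel_measurable mu2"
  shows "(\<integral>\<^sup>+ x1. (\<integral>\<^sup>+ x0. hybrid_op f x0 x1 \<partial>mu) \<partial>mu) \<le> 50 * (1 + LlnL_integral f)"
proof -
  interpret pair_sigma_finite mu mu ..
  have fm [measurable]: "f \<in> borel_measurable (mu \<Otimes>\<^sub>M mu)" using f unfolding mu2_def .
  have [measurable]: "ln_plus \<in> borel_measurable borel" unfolding ln_plus_def[abs_def] by measurable
  have "(\<integral>\<^sup>+ x1. (\<integral>\<^sup>+ x0. hybrid_op f x0 x1 \<partial>mu) \<partial>mu) = (\<integral>\<^sup>+ x0. (\<integral>\<^sup>+ x1. hybrid_op f x0 x1 \<partial>mu) \<partial>mu)"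
    by (rule Fubini') (rule measurable_hybrid_op[OF f])
  also have "\<dots> \<le> (\<integral>\<^sup>+ x0. 50 * (1 + (\<integral>\<^sup>+ u. ennreal (\<bar>f (x0, u)\<bar> * ln_plus \<bar>f (x0, u)\<bar>) \<partial>mu)) \<partial>mu)"
    unfolding hybrid_op_def
    by (intro nn_integral_mono nn_integral_majorant_op_le) (rule measurable_Pair2[OF fm])
  also have "\<dots> = 50 * (1 + (\<integral>\<^sup>+ x0. (\<integral>\<^sup>+ u. ennreal (\<bar>f (x0, u)\<bar> * ln_plus \<bar>f (x0, u)\<bar>) \<partial>mu) \<partial>mu))"
    by (simp add: nn_integral_cmult nn_integral_add mu.emeasure_space_1[simplified])
  also have "\<dots> = 50 * (1 + LlnL_integral f)"
    unfolding LlnL_integral_def mu2_def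
    by (subst mu.nn_integral_fst[of "\<lambda>z. ennreal (\<bar>f z\<bar> * ln_plus \<bar>f z\<bar>)", simplified]) simp_all
  finally show ?thesis .
qed

text \<open>The weak type inequality in the first variable is applied on each slice of fixed
  \<open>x1\<close> and integrated over \<open>x1\<close>; \<open>150 = 3 * 50\<close>.\<close>

lemma emeasure_iterated_majorant_le:
  assumes f [measurable]: "f \<in> borel_measurable mu2" and y: "0 < y"
  defines "S \<equiv> {z \<in> space mu2. ennreal (3 * y) < majorant_op (\<lambda>u. hybrid_op f u (snd z)) (fst z)}"
  shows "S \<in> sets mu2" "ennreal y * emeasure mu2 S \<le> 150 * (1 + LlnL_integral f)"
proof -
  interpret pair_sigma_finite mu mu ..
  have hyb [measurable]: "case_prod (hybrid_op f) \<in> borel_measurable (mu \<Otimes>\<^sub>M mu)"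
    by (rule measurable_hybrid_op[OF f])
  have [measurable]: "(\<lambda>z. majorant_op (\<lambda>u. hybrid_op f u (snd z)) (fst z)) \<in> borel_measurable mu2"
    unfolding mu2_def
  proof (rule measurable_majorant_op)
    have "(\<lambda>w. case_prod (hybrid_op f) (snd w, snd (fst w))) \<in> borel_measurable ((mu \<Otimes>\<^sub>M mu) \<Otimes>\<^sub>M mu)"
      by measurable
    then show "(\<lambda>(z, u). hybrid_op f u (snd z)) \<in> borel_measurable ((mu \<Otimes>\<^sub>M mu) \<Otimes>\<^sub>M mu)"
      by (simp add: case_prod_beta')
    show "fst \<in> borel_measurable (mu \<Otimes>\<^sub>M mu)"
      by (rule measurable_compose[OF measurable_fst measurable_ident_mu])
  qed
  show S: "S \<in> sets mu2" unfolding S_def by measurable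
  have slice: "(\<lambda>x0. (x0, x1)) -` S
      = {x \<in> space mu. ennreal (3 * y) < majorant_op (\<lambda>u. hybrid_op f u x1) x}" if "x1 \<in> space mu" for x1
    using that unfolding S_def mu2_def by (auto simp: space_pair_measure)
  have "ennreal y * emeasure mu2 S = ennreal y * (\<integral>\<^sup>+ x1. emeasure mu ((\<lambda>x0. (x0, x1)) -` S) \<partial>mu)"
    using S unfolding mu2_def by (simp add: emeasure_pair_measure_alt2)
  also have "\<dots> = (\<integral>\<^sup>+ x1. ennreal y * emeasure mu ((\<lambda>x0. (x0, x1)) -` S) \<partial>mu)"
    using S unfolding mu2_def by (intro nn_integral_cmult[symmetric] measurable_emeasure_Pair2)
  also have "\<dots> \<le> (\<integral>\<^sup>+ x1. 3 * (\<integral>\<^sup>+ x0. hybrid_op f x0 x1 \<partial>mu) \<partial>mu)"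
  proof (rule nn_integral_mono)
    fix x1 assume x1: "x1 \<in> space mu"
    show "ennreal y * emeasure mu ((\<lambda>x0. (x0, x1)) -` S) \<le> 3 * (\<integral>\<^sup>+ x0. hybrid_op f x0 x1 \<partial>mu)"
      unfolding slice[OF x1]
      using measurable_Pair1[OF hyb x1] by (intro emeasure_majorant_op_le y) simp
  qed
  also have "\<dots> = 3 * (\<integral>\<^sup>+ x1. (\<integral>\<^sup>+ x0. hybrid_op f x0 x1 \<partial>mu) \<partial>mu)"
  proof (rule nn_integral_cmult)
    have "(\<lambda>(x1, x0). hybrid_op f x0 x1) \<in> borel_measurable (mu \<Otimes>\<^sub>M mu)"
      using measurable_pair_swap[OF hyb] by (simp add: case_prod_beta')
    then show "(\<lambda>x1. \<integral>\<^sup>+ x0. hybrid_op f x0 x1 \<partial>mu) \<in> borel_measurable mu"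
      by (rule mu.borel_measurable_nn_integral)
  qed
  also have "\<dots> \<le> 3 * (50 * (1 + LlnL_integral f))"
    by (intro mult_left_mono nn_integral_hybrid_op_le f) simp
  also have "\<dots> = 150 * (1 + LlnL_integral f)" by (simp flip: mult.assoc)
  finally show "ennreal y * emeasure mu2 S \<le> 150 * (1 + LlnL_integral f)" .
qed

theorem theorem1:
  fixes T0 T1 :: "nat \<Rightarrow> nat \<Rightarrow> real" and n0 n1 :: "nat \<Rightarrow> nat"
  assumes "transformation_matrix T0" and "transformation_matrix T1"
    and "strict_mono n0" and "strict_mono n1"
    and "(SUP a. operator_norm H1_space H1_norm L1_norm (matrix_transform T0 (n0 a))) < \<infinity>
       \<or> (SUP a. operator_norm Linf_space Linf_norm Linf_norm (matrix_transform T0 (n0 a))) < \<infinity>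
       \<or> (SUP a. ennreal (upsilon (n0 a) T0)) < \<infinity>"
    and "(SUP a. operator_norm H1_space H1_norm L1_norm (matrix_transform T1 (n1 a))) < \<infinity>
       \<or> (SUP a. operator_norm Linf_space Linf_norm Linf_norm (matrix_transform T1 (n1 a))) < \<infinity>
       \<or> (SUP a. ennreal (upsilon (n1 a) T1)) < \<infinity>"
  shows "\<exists>c::real. c > 0 \<and> (\<forall>f \<in> LlnL_space.
           weak_L1_norm (tensor_maximal T0 n0 T1 n1 f) < ennreal c * (1 + LlnL_integral f))"
proof -
  obtain C0 where C0: "0 \<le> C0" "\<And>a. digit_variation (\<lambda>j. T0 j (n0 a)) (n0 a) \<le> C0"
    using digit_variation_bounded[OF assms(1,5)] by blast
  obtain C1 where C1: "0 \<le> C1" "\<And>a. digit_variation (\<lambda>j. T1 j (n1 a)) (n1 a) \<le> C1"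
    using digit_variation_bounded[OF assms(2,6)] by blast
  define C where "C = (3 + C0) * (3 + C1)"
  have "0 < C" unfolding C_def using C0(1) C1(1) by simp
  have "weak_L1_norm (tensor_maximal T0 n0 T1 n1 f) < ennreal (450 * C + 1) * (1 + LlnL_integral f)"
    if f: "f \<in> LlnL_space" for f
  proof -
    have fm: "f \<in> borel_measurable mu2" and fin: "LlnL_integral f < \<infinity>"
      using f unfolding LlnL_space_def by auto
    let ?M = "\<lambda>z. majorant_op (\<lambda>u. hybrid_op f u (snd z)) (fst z)"
    have le: "tensor_maximal T0 n0 T1 n1 f z \<le> ennreal C * ?M z" if "z \<in> space mu2" for z
    proof -
      have "snd z \<in> space mu" using that unfolding mu2_def by (auto simp: space_pair_measure)
      then have "ennreal \<bar>tensor_transform T0 (n0 a) T1 (n1 b) f (fst z, snd z)\<bar> \<le> ennreal C * ?M z" for a b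
        unfolding C_def by (intro tensor_transform_le assms C0 C1 fm)
      then show ?thesis unfolding tensor_maximal_def by (intro SUP_least) (auto split: prod.split)
    qed
    have "weak_L1_norm (tensor_maximal T0 n0 T1 n1 f) \<le> ennreal (450 * C) * (1 + LlnL_integral f)"
      unfolding weak_L1_norm_def
    proof (rule SUP_least)
      fix y :: real assume "y \<in> {0<..}"
      then have "0 < y" by simp
      \<comment> \<open>Chosen so that height \<open>y\<close> of the maximal function forces height
        \<open>3 * r\<close>, the level of the weak type inequality, of the iterated
        majorant.\<close>
      define r where "r = y / (3 * C)"
      have r: "0 < r" "y = 3 * C * r" unfolding r_def using \<open>0 < y\<close> \<open>0 < C\<close> by auto
      let ?S = "{z \<in> space mu2. ennreal (3 * r) < ?M z}"
      have "{z \<in> space mu2. ennreal y < tensor_maximal T0 n0 T1 n1 f z} \<subseteq> ?S"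
      proof
        fix z assume z: "z \<in> {z \<in> space mu2. ennreal y < tensor_maximal T0 n0 T1 n1 f z}"
        have "ennreal (3 * r) < ?M z"
        proof (rule ccontr)
          assume "\<not> ?thesis"
          then have "ennreal C * ?M z \<le> ennreal C * ennreal (3 * r)" by (intro mult_left_mono) auto
          also have "\<dots> = ennreal y"
            unfolding r(2) using \<open>0 < C\<close> r(1) by (simp add: ennreal_mult[symmetric] ac_simps)
          finally have "tensor_maximal T0 n0 T1 n1 f z \<le> ennreal y" using le[of z] z by auto
          then show False using z by auto
        qed
        then show "z \<in> ?S" using z by auto
      qed
      then have "ennreal y * emeasure mu2 {z \<in> space mu2. ennreal y < tensor_maximal T0 n0 T1 n1 f z}
          \<le> ennreal y * emeasure mu2 ?S"
        by (intro mult_left_mono emeasure_mono emeasure_iterated_majorant_le fm r) simp_all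
      also have "\<dots> = ennreal (3 * C) * (ennreal r * emeasure mu2 ?S)"
        unfolding r(2) using \<open>0 < C\<close> r(1) by (simp add: ennreal_mult mult.assoc)
      also have "\<dots> \<le> ennreal (3 * C) * (150 * (1 + LlnL_integral f))"
        by (intro mult_left_mono emeasure_iterated_majorant_le fm r) simp
      also have "\<dots> = (ennreal (3 * C) * ennreal 150) * (1 + LlnL_integral f)"
        by (simp add: mult.assoc)
      also have "\<dots> = ennreal (450 * C) * (1 + LlnL_integral f)"
        using \<open>0 < C\<close> by (subst ennreal_mult[symmetric]) simp_all
      finally show "ennreal y * emeasure mu2 {z \<in> space mu2. ennreal y < tensor_maximal T0 n0 T1 n1 f z}
          \<le> ennreal (450 * C) * (1 + LlnL_integral f)" .
    qed
    \<comment> \<open>The extra 1 makes the inequality strict, since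
      \<open>1 + LlnL_integral f\<close> is finite and positive.\<close>
    also have "\<dots> < ennreal (450 * C + 1) * (1 + LlnL_integral f)"
    proof -
      obtain L where L: "LlnL_integral f = ennreal L" "0 \<le> L" using fin by (cases "LlnL_integral f") auto
      have "1 + LlnL_integral f = ennreal (1 + L)" using L by simp
      then show ?thesis
        using L(2) \<open>0 < C\<close> by (simp only: ennreal_mult[symmetric]) (simp add: ennreal_mult[symmetric] ennreal_lessI mult_strict_right_mono)
    qed
    finally show ?thesis .
  qed
  then show ?thesis using \<open>0 < C\<close> by (intro exI[of _ "450 * C + 1"]) auto
qed

end
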